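(* For every positive integer $n$, $$M_e(n)-M_o(n)=\frac{1}{\sqrt{n-1/24}}\sum_{0<k<5\sqrt{n}/2}\frac{B_k(n)}{\sqrt{k}}\cosh\left(\frac{\pi}{k}\sqrt{\frac{n-1/24}{6}}\right)+E_n,$$ where the sum is over integers $k$ with $0<k<5\sqrt n/2$, $$B_k(n)=\sum_{\substack{0\le h<2k\\ \gcd(h,2k)=1}}e^{\pi i (2s(h,k)-3s(h,2k))}e^{-2\pi i n h/(2k)},$$ and the error term satisfies $|E_n|<194\, n^{1/4}$.
   Context: For $|q|<1$ write $(z;q)_\infty=\prod_{j\geq 0}(1-zq^j)$. $M_e(n)-M_o(n)$ is defined by $\sum_{n\geq 0}(M_e(n)-M_o(n))q^n=\frac{(q;q)_\infty}{(-q;q)_\infty^2}$ (the number of partitions of $n$ with even Andrews–Garvan crank minus the number with odd crank). $s(h,k)$ is the Dedekind sum $s(h,k)=\sum_{r=1}^{k-1}\frac{r}{k}\left(\frac{hr}{k}-\left\lfloor\frac{hr}{k}\right\rfloor-\frac12\right)$. *)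

theory Defs
  imports "HOL-Analysis.Analysis"
begin

definition crank_gf :: "complex \<Rightarrow> complex" where
  "crank_gf q = (\<Prod>j. (1 - q ^ (j + 1))) / (\<Prod>j. (1 + q ^ (j + 1))) ^ 2"

definition MeMo :: "nat \<Rightarrow> complex" where
  "MeMo n = (deriv ^^ n) crank_gf 0 / of_nat (fact n)"

definition dedekind_sum :: "int \<Rightarrow> nat \<Rightarrow> real" where
  "dedekind_sum h k = (\<Sum>r=1..<k. (real r / real k) *
      (real_of_int h * real r / real k - of_int \<lfloor>real_of_int h * real r / real k\<rfloor> - 1/2))"

definition B_sum :: "nat \<Rightarrow> nat \<Rightarrow> complex" where
  "B_sum k n = (\<Sum>h\<in>{h\<in>{0..<2*k}. gcd h (2*k) = 1}.
      exp (complex_of_real pi * \<i> * complex_of_real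
             (2 * dedekind_sum (int h) k - 3 * dedekind_sum (int h) (2*k)))
    * exp (- 2 * complex_of_real pi * \<i> * of_nat n * of_nat h / of_nat (2*k)))"

end

theory Submission
  imports Defs "HOL-Complex_Analysis.Complex_Analysis" "HOL-Probability.Probability"
    "HOL-Number_Theory.Cong"
begin

text \<open>
  Write $P(q) = (q;q)_\infty$, so that the generating function is $f(q) = P(q)^3 / P(q^2)^2$.
  The transformation $w \mapsto 1/w$ of $P(e^{-2\pi w})$ follows from that of its logarithmic
  derivative, a conditionally convergent lattice sum whose two orders of summation differ by a
  telescoping term. Combined with Dedekind reciprocity, the Euclidean algorithm extends it to all
  rational points. Hence near $e^{2\pi i h/K}$ the function $f$ is small for odd $K$, while for $K = 2k$ it equals, with $z = Kw$,
  $\omega_{h,k}\, z^{-1/2} \exp(\frac{\pi}{24k}(\frac1z - z))\, f(q')$ with $|q'| \le e^{-\pi}$ on the Farey arc.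

  The coefficient is integrated over the circle $|q| = e^{-2\pi/(25n)}$, dissected by Farey fractions
  of order $N$, the largest integer below $5\sqrt n$. Replacing $f(q')$ by $1$ leaves
  $\int w^{-1/2} e^{a/w + bw}\,dw$; with $w = s^2$ it becomes $2\int e^{a/s^2 + bs^2}\,ds$, whose
  integral over a full vertical line is a $\cosh$ and whose tails are dominated by a Gaussian factor.
\<close>

section \<open>Euler's product and the crank generating function\<close>

text \<open>Whether a denominator K yields a main term depends on how squaring q acts there. For odd
  K it doubles both h and z, and the exponents in 1/z of P(q)^3 / P(q^2)^2 combine to a negative
  multiple of Re(1/z). For K = 2k it halves the denominator, the net exponent is positive, and a
  principal part survives. The circle and the Farey order are tied together: c = 1/(25n) satisfies
  N^2 c < 1 <= (N+1)^2 c. This forces Re(1/z) >= K/2 on every arc, while q^(-n) has the constant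
  modulus e^(2 pi/25). Two errors remain: 14.4 K^(-3/2) per arc, from the whole integral if K is odd
  and from f(q') - 1 if K is even, and 5.36 sqrt(N)/n per arc with even K, from the truncated tails.
  With at most K numerators for each K the total is (28.8 + 50.25) sqrt N, and sqrt N < sqrt 5
  n^(1/4) brings it below 194 n^(1/4).\<close>

definition euler_phi :: "complex \<Rightarrow> complex" where
  "euler_phi q = (\<Prod>j. 1 - q ^ (j + 1))"

lemma summable_norm_power_Suc:
  fixes q :: complex
  assumes "norm q < 1"
  shows "summable (\<lambda>j. norm (q ^ (j + 1)))"
proof -
  have "summable (\<lambda>j. norm q * norm q ^ j)"
    using assms by (intro summable_mult summable_geometric) auto
  then show ?thesis by (simp add: norm_power norm_mult)
qed

lemma one_minus_power_nonzero:
  fixes q :: complex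
  assumes "norm q < 1"
  shows "1 - q ^ Suc j \<noteq> 0"
proof
  assume "1 - q ^ Suc j = 0"
  then have "norm (q ^ Suc j) = 1" by simp
  moreover have "norm (q ^ Suc j) < 1"
    using assms power_less_one_iff[of "norm q" "Suc j"] by (simp only: norm_power) simp
  ultimately show False by simp
qed

lemma convergent_prod_euler_phi:
  fixes q :: complex
  assumes "norm q < 1"
  shows "convergent_prod (\<lambda>j. 1 - q ^ (j + 1))"
    and "convergent_prod (\<lambda>j. 1 + q ^ (j + 1))"
  using summable_norm_power_Suc[OF assms]
  by (auto intro!: abs_convergent_prod_imp_convergent_prod summable_imp_abs_convergent_prod
      simp: norm_minus_commute)

lemma euler_phi_LIMSEQ:
  assumes "norm q < 1"
  shows "(\<lambda>n. \<Prod>j<n. 1 - q ^ (j + 1)) \<longlonglongrightarrow> euler_phi q"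
proof -
  have "(\<lambda>n. \<Prod>j\<le>n. 1 - q ^ (j + 1)) \<longlonglongrightarrow> euler_phi q"
    unfolding euler_phi_def by (rule convergent_prod_LIMSEQ[OF convergent_prod_euler_phi(1)[OF assms]])
  then show ?thesis
    unfolding lessThan_Suc_atMost[symmetric] by (rule LIMSEQ_imp_Suc)
qed

lemma euler_phi_nonzero:
  assumes "norm q < 1"
  shows "euler_phi q \<noteq> 0"
  unfolding euler_phi_def
  using prodinf_nonzero[OF convergent_prod_euler_phi(1)[OF assms]] one_minus_power_nonzero[OF assms] by simp

lemma crank_gf_eq_euler_phi:
  assumes q: "norm q < 1"
  shows "crank_gf q = euler_phi q ^ 3 / euler_phi (q ^ 2) ^ 2"
proof -
  have q2: "norm (q ^ 2) < 1" using q by (simp add: norm_power power_less_one_iff)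
  define Q where "Q = (\<Prod>j. 1 + q ^ (j + 1))"
  have "euler_phi q * Q = (\<Prod>j. (1 - q ^ (j + 1)) * (1 + q ^ (j + 1)))"
    unfolding euler_phi_def Q_def by (intro prodinf_mult convergent_prod_euler_phi q)
  also have "\<dots> = euler_phi (q ^ 2)"
    unfolding euler_phi_def
    by (intro prodinf_cong) (simp add: algebra_simps power2_eq_square power_mult_distrib)
  finally have eq: "euler_phi q * Q = euler_phi (q ^ 2)" .
  then have "Q = euler_phi (q ^ 2) / euler_phi q"
    using euler_phi_nonzero[OF q] by (simp add: field_simps)
  moreover have "crank_gf q = euler_phi q / Q ^ 2"
    unfolding crank_gf_def euler_phi_def Q_def ..
  ultimately show ?thesis
    using euler_phi_nonzero[OF q] by (simp add: power2_eq_square power3_eq_cube)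
qed

text \<open>Locally uniform convergence serves twice: it makes the product holomorphic, and it later
  permits differentiating the product logarithmically term by term. The majorant is r^(j+1).\<close>

lemma uniform_limit_euler_phi:
  assumes "r < 1"
  shows "uniform_limit (cball 0 r) (\<lambda>n q. \<Prod>j<n. 1 - q ^ (j + 1)) euler_phi sequentially"
proof (cases "r < 0")
  case True
  then show ?thesis by (simp add: uniform_limit_iff)
next
  case False
  have "uniformly_convergent_on (cball 0 r) (\<lambda>n (q::complex). \<Prod>j<n. 1 - q ^ (j + 1))"
  proof (rule uniformly_convergent_on_prod')
    show "uniformly_convergent_on (cball 0 r) (\<lambda>N (q::complex). \<Sum>j<N. norm (1 - q ^ (j + 1) - 1))"
    proof (rule Weierstrass_m_test')
      show "norm (norm (1 - q ^ (n + 1) - 1)) \<le> r ^ (n + 1)" if "q \<in> cball 0 r" for n and q :: complex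
      proof -
        have "norm (1 - q ^ (n + 1) - 1) = norm q ^ (n + 1)" by (simp add: norm_power norm_mult)
        also have "\<dots> \<le> r ^ (n + 1)" using that by (intro power_mono) auto
        finally show ?thesis by simp
      qed
      show "summable (\<lambda>n. r ^ (n + 1))"
        using summable_norm_power_Suc[of "of_real r"] False assms by (simp add: norm_power norm_mult)
    qed
  qed (auto intro!: continuous_intros)
  then obtain l where l: "uniform_limit (cball 0 r) (\<lambda>n (q::complex). \<Prod>j<n. 1 - q ^ (j + 1)) l sequentially"
    by (auto simp: uniformly_convergent_on_def)
  have eq: "l q = euler_phi q" if "q \<in> cball 0 r" for q
    using tendsto_uniform_limitI[OF l that] euler_phi_LIMSEQ[of q] that assms
    by (intro LIMSEQ_unique) auto
  show ?thesis by (rule iffD1[OF uniform_limit_cong' l]) (simp_all add: eq)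
qed

lemma holomorphic_euler_phi [holomorphic_intros]:
  assumes "A \<subseteq> ball 0 1"
  shows "euler_phi holomorphic_on A"
proof -
  have "euler_phi holomorphic_on ball 0 1"
  proof (rule holomorphic_uniform_sequence)
    show "\<exists>d>0. cball x d \<subseteq> ball 0 1 \<and>
        uniform_limit (cball x d) (\<lambda>n q. \<Prod>j<n. 1 - q ^ (j + 1)) euler_phi sequentially"
      if "x \<in> ball 0 1" for x :: complex
    proof (intro exI conjI)
      show "0 < (1 - norm x) / 2" using that by simp
      have *: "norm y \<le> (1 + norm x) / 2" if "y \<in> cball x ((1 - norm x) / 2)" for y
      proof -
        have "norm y \<le> norm x + dist x y"
          by (metis dist_0_norm dist_commute dist_triangle)
        with that show ?thesis by (simp add: field_simps)
      qed
      show "cball x ((1 - norm x) / 2) \<subseteq> ball 0 1"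
        using * that by (force simp: field_simps)
      show "uniform_limit (cball x ((1 - norm x) / 2))
          (\<lambda>n q. \<Prod>j<n. 1 - q ^ (j + 1)) euler_phi sequentially"
        by (rule uniform_limit_on_subset[OF uniform_limit_euler_phi[of "(1 + norm x) / 2"]])
           (use * that in auto)
    qed
  qed (auto intro!: holomorphic_intros)
  then show ?thesis using assms holomorphic_on_subset by blast
qed

text \<open>Each factor is at most 1 + |q|^(j+1) <= exp(|q|^(j+1)), and the exponents form a
  geometric series. The bound is explicit because the final constant is.\<close>

lemma norm_euler_phi_le:
  assumes "norm q < 1"
  shows "norm (euler_phi q) \<le> exp (norm q / (1 - norm q))"
proof (rule tendsto_upperbound)
  show "(\<lambda>n. norm (\<Prod>j<n. 1 - q ^ (j + 1))) \<longlonglongrightarrow> norm (euler_phi q)"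
    by (intro tendsto_norm euler_phi_LIMSEQ assms)
  have "norm (\<Prod>j<n. 1 - q ^ (j + 1)) \<le> exp (norm q / (1 - norm q))" for n
  proof -
    have "norm (\<Prod>j<n. 1 - q ^ (j + 1)) \<le> (\<Prod>j<n. exp (norm q * norm q ^ j))"
      unfolding prod_norm[symmetric]
    proof (intro prod_mono conjI norm_ge_zero)
      fix j
      have "norm (1 - q ^ (j + 1)) \<le> 1 + norm q * norm q ^ j"
        using norm_triangle_ineq4[of 1 "q ^ (j + 1)"] by (simp add: norm_power norm_mult)
      also have "\<dots> \<le> exp (norm q * norm q ^ j)" by (rule exp_ge_add_one_self)
      finally show "norm (1 - q ^ (j + 1)) \<le> exp (norm q * norm q ^ j)" .
    qed
    also have "\<dots> = exp (norm q * (\<Sum>j<n. norm q ^ j))"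
      by (simp add: exp_sum sum_distrib_left)
    also have "(\<Sum>j<n. norm q ^ j) \<le> (\<Sum>j. norm q ^ j)"
      using assms by (intro sum_le_suminf summable_geometric) auto
    also have "\<dots> = 1 / (1 - norm q)" using assms by (intro suminf_geometric) auto
    finally show ?thesis by (simp add: mult_left_mono)
  qed
  then show "\<forall>\<^sub>F n in sequentially. norm (\<Prod>j<n. 1 - q ^ (j + 1)) \<le> exp (norm q / (1 - norm q))"
    by simp
qed simp

text \<open>With r = |q|, 1/(1 - r^(j+1)) = 1 + r^(j+1)/(1 - r^(j+1)) <= exp(r^(j+1)/(1 - r)); this
  extra 1/(1 - r) explains the square in the exponent.\<close>

lemma norm_inverse_euler_phi_le:
  assumes "norm q < 1"
  shows "norm (inverse (euler_phi q)) \<le> exp (norm q / (1 - norm q) ^ 2)"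
proof (rule tendsto_upperbound)
  define r where "r = norm q"
  have r: "0 \<le> r" "r < 1" using assms by (auto simp: r_def)
  show "(\<lambda>n. norm (inverse (\<Prod>j<n. 1 - q ^ (j + 1)))) \<longlonglongrightarrow> norm (inverse (euler_phi q))"
    by (intro tendsto_norm tendsto_inverse euler_phi_LIMSEQ euler_phi_nonzero assms)
  have "norm (inverse (\<Prod>j<n. 1 - q ^ (j + 1))) \<le> exp (norm q / (1 - norm q) ^ 2)" for n
  proof -
    have "norm (inverse (\<Prod>j<n. 1 - q ^ (j + 1))) = (\<Prod>j<n. inverse (norm (1 - q ^ (j + 1))))"
      by (simp only: norm_inverse prod_norm[symmetric] prod_inversef[symmetric] o_def)
    also have "\<dots> \<le> (\<Prod>j<n. exp (r / (1 - r) * r ^ j))"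
    proof (intro prod_mono conjI)
      fix j
      have le: "r ^ (j + 1) \<le> r" using r power_decreasing[of 1 "j+1" r] by simp
      have "1 - r ^ (j + 1) \<le> norm (1 - q ^ (j + 1))"
        using norm_triangle_ineq2[of 1 "q ^ (j + 1)"] unfolding norm_power r_def by simp
      then have "inverse (norm (1 - q ^ (j + 1))) \<le> inverse (1 - r ^ (j + 1))"
        using le r by (intro le_imp_inverse_le) auto
      also have "\<dots> = 1 + r ^ (j + 1) / (1 - r ^ (j + 1))"
        using le r by (simp add: field_simps)
      also have "\<dots> \<le> 1 + r ^ (j + 1) / (1 - r)"
        using le r by (intro add_left_mono divide_left_mono) auto
      also have "\<dots> \<le> exp (r ^ (j + 1) / (1 - r))" by (rule exp_ge_add_one_self)
      finally show "inverse (norm (1 - q ^ (j + 1))) \<le> exp (r / (1 - r) * r ^ j)" by simp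
    qed simp
    also have "\<dots> = exp (r / (1 - r) * (\<Sum>j<n. r ^ j))"
      by (simp add: exp_sum sum_distrib_left)
    also have "\<dots> \<le> exp (r / (1 - r) * (\<Sum>j. r ^ j))"
      using r by (intro exp_le_cancel_iff[THEN iffD2] mult_left_mono sum_le_suminf summable_geometric) auto
    also have "(\<Sum>j. r ^ j) = 1 / (1 - r)" using r by (intro suminf_geometric) auto
    finally show ?thesis by (simp add: r_def power2_eq_square)
  qed
  then show "\<forall>\<^sub>F n in sequentially. norm (inverse (\<Prod>j<n. 1 - q ^ (j + 1))) \<le> exp (norm q / (1 - norm q) ^ 2)"
    by simp
qed simp

section \<open>The inversion formula\<close>

text \<open>A majorant of product form makes the family unconditionally summable over pairs, so both
  iterated sums agree. The exchange is done with \<open>has_sum\<close>; the interface stays with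
  \<open>sums\<close>, the form in which rows and columns are evaluated.\<close>

lemma sums_swap:
  fixes f :: "nat \<Rightarrow> nat \<Rightarrow> complex"
  assumes bound: "\<And>m k. norm (f m k) \<le> g m * h k"
    and g: "summable g" "\<And>m. g m \<ge> 0" and h: "summable h" "\<And>k. h k \<ge> (0::real)"
    and rows: "\<And>m. f m sums a m" and cols: "\<And>k. (\<lambda>m. f m k) sums b k"
  obtains s where "a sums s" "b sums s"
proof -
  have h_sum: "((\<lambda>k. g m * h k) has_sum g m * suminf h) UNIV" for m
    using h by (intro has_sum_cmult_right norm_summable_imp_has_sum) (auto simp: summable_sums)
  have "(\<lambda>(m, k). g m * h k) summable_on UNIV \<times> UNIV"
  proof (rule summable_on_SigmaI)
    show "((\<lambda>k. case (m, k) of (m, k) \<Rightarrow> g m * h k) has_sum g m * suminf h) UNIV" for m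
      using h_sum by simp
    show "(\<lambda>m. g m * suminf h) summable_on UNIV"
      using g by (intro summable_on_cmult_left norm_summable_imp_summable_on) auto
  qed (use g h in auto)
  then have "(\<lambda>p. norm (case p of (m, k) \<Rightarrow> f m k)) summable_on UNIV \<times> UNIV"
    by (rule Infinite_Sum.abs_summable_on_comparison_test') (use bound in auto)
  then have "(\<lambda>(m, k). f m k) summable_on UNIV \<times> UNIV"
    by (rule Infinite_Sum.abs_summable_summable)
  then obtain s where s: "((\<lambda>(m, k). f m k) has_sum s) (UNIV \<times> UNIV)"
    unfolding summable_on_def by blast
  have row: "(f m has_sum a m) UNIV" for m
  proof (rule norm_summable_imp_has_sum[OF _ rows])
    show "summable (\<lambda>k. norm (f m k))"
      by (rule summable_comparison_test'[OF summable_mult[OF h(1), of "g m"], of 0]) (simp add: bound)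
  qed
  have col: "((\<lambda>m. f m k) has_sum b k) UNIV" for k
  proof (rule norm_summable_imp_has_sum[OF _ cols])
    show "summable (\<lambda>m. norm (f m k))"
      by (rule summable_comparison_test'[OF summable_mult2[OF g(1), of "h k"], of 0]) (simp add: bound)
  qed
  show ?thesis
  proof
    show "a sums s"
      by (rule has_sum_imp_sums, rule has_sum_SigmaD[OF s]) (simp add: row)
    have "((\<lambda>(k, m). f m k) has_sum s) (UNIV \<times> UNIV)"
      using s by (subst (asm) has_sum_swap) simp
    then have "(b has_sum s) UNIV"
      by (rule has_sum_SigmaD) (simp add: col)
    then show "b sums s" by (rule has_sum_imp_sums)
  qed
qed

section \<open>Partial fractions of the cotangent and the squared cosecant\<close>

lemma sin_pi_nonzero:
  assumes "Im z \<noteq> 0"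
  shows "sin (of_real pi * z) \<noteq> 0"
proof
  assume "sin (of_real pi * z) = 0"
  then obtain n :: int where "of_real pi * z = of_real (of_int n * pi)"
    by (auto simp: Complex_Transcendental.sin_eq_0)
  then have "Im (of_real pi * z) = 0" by (simp only: Im_complex_of_real)
  with assms show False by simp
qed

text \<open>The logarithmic derivative of Euler's reflection formula Gamma(z) Gamma(1 - z) = pi /
  sin(pi z): both sides are differentiated and the nonzero Gamma product is cancelled.\<close>

lemma Digamma_reflection:
  fixes z :: complex
  assumes "Im z \<noteq> 0"
  shows "Digamma (1 - z) - Digamma z = of_real pi * cot (of_real pi * z)"
proof -
  have nonint: "z \<notin> \<int>\<^sub>\<le>\<^sub>0" "1 - z \<notin> \<int>\<^sub>\<le>\<^sub>0"
    using assms by (auto elim!: nonpos_Ints_cases simp: complex_eq_iff)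
  note sin0 = sin_pi_nonzero[OF assms]
  have G0: "Gamma z \<noteq> 0" "Gamma (1 - z) \<noteq> 0"
    using nonint by (auto simp: Gamma_eq_zero_iff)
  have "((\<lambda>z. Gamma z * Gamma (1 - z)) has_field_derivative
      Gamma z * Gamma (1 - z) * (Digamma z - Digamma (1 - z))) (at z)"
    using nonint by (auto intro!: derivative_eq_intros simp: algebra_simps)
  moreover have "((\<lambda>z. of_real pi / sin (of_real pi * z)) has_field_derivative
      of_real pi / sin (of_real pi * z) * (- of_real pi * cot (of_real pi * z))) (at z)"
  proof -
    have "((\<lambda>z. sin (of_real pi * z)) has_field_derivative cos (of_real pi * z) * of_real pi) (at z)"
      by (auto intro!: derivative_eq_intros)
    from DERIV_cmult[OF DERIV_inverse'[OF this sin0], of "of_real pi"] show ?thesis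
      by (simp add: cot_def divide_inverse mult_ac)
  qed
  ultimately have "Gamma z * Gamma (1 - z) * (Digamma z - Digamma (1 - z)) =
      Gamma z * Gamma (1 - z) * (- of_real pi * cot (of_real pi * z))"
    unfolding Gamma_reflection_complex by (rule DERIV_unique)
  then have "Digamma z - Digamma (1 - z) = - of_real pi * cot (of_real pi * z)"
    unfolding mult_cancel_left using G0 by (simp only: mult_eq_0_iff) blast
  then show ?thesis by (simp add: algebra_simps)
qed

abbreviation pi_csc2 :: "complex \<Rightarrow> complex" where
  "pi_csc2 z \<equiv> of_real pi ^ 2 / sin (of_real pi * z) ^ 2"

text \<open>One more differentiation of the reflection formula, which holds on the whole open set Im
  z \<noteq> 0.\<close>

lemma Polygamma_1_reflection:
  fixes z :: complex
  assumes "Im z \<noteq> 0"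
  shows "Polygamma 1 z + Polygamma 1 (1 - z) = pi_csc2 z"
proof -
  have nonint: "z \<notin> \<int>\<^sub>\<le>\<^sub>0" "1 - z \<notin> \<int>\<^sub>\<le>\<^sub>0"
    using assms by (auto elim!: nonpos_Ints_cases simp: complex_eq_iff)
  note sin0 = sin_pi_nonzero[OF assms]
  have "((\<lambda>z. Digamma (1 - z) - Digamma z) has_field_derivative
      - Polygamma 1 (1 - z) - Polygamma 1 z) (at z)"
    using nonint by (auto intro!: derivative_eq_intros DERIV_chain2[OF has_field_derivative_Polygamma])
  moreover have "((\<lambda>z. Digamma (1 - z) - Digamma z) has_field_derivative
      - (pi_csc2 z)) (at z)"
  proof (rule has_field_derivative_transform_within_open)
    show "((\<lambda>z. of_real pi * cot (of_real pi * z)) has_field_derivative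
      - (pi_csc2 z)) (at z)"
    proof -
      have "(cot has_field_derivative - inverse (sin (of_real pi * z) ^ 2)) (at (of_real pi * z))"
        using sin0 by (rule DERIV_cot)
      then have "((\<lambda>z. cot (of_real pi * z)) has_field_derivative
          - inverse (sin (of_real pi * z) ^ 2) * of_real pi) (at z)"
        by (rule DERIV_chain2) (auto intro!: derivative_eq_intros)
      from DERIV_cmult[OF this, of "of_real pi"] show ?thesis
        by (simp add: power2_eq_square inverse_eq_divide mult_ac)
    qed
    show "open {z. Im z \<noteq> 0}" by (intro open_Collect_neq continuous_intros)
  qed (use assms Digamma_reflection in auto)
  ultimately have "- Polygamma 1 (1 - z) - Polygamma 1 z = - (pi_csc2 z)"
    by (rule DERIV_unique)
  then show ?thesis by (simp add: algebra_simps)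
qed

text \<open>Subtracting the digamma series at 1 + z from that at 1 - z cancels Euler's constant and
  the terms 1/(m+1). The recurrence of \<open>Digamma\<close> then turns 1 + z into z at the cost of
  1/z.\<close>

lemma sums_cot:
  fixes z :: complex
  assumes "Im z \<noteq> 0"
  shows "(\<lambda>m. 1 / (of_nat (m + 1) + z) - 1 / (of_nat (m + 1) - z)) sums
    (of_real pi * cot (of_real pi * z) - 1 / z)"
proof -
  have nz: "z \<noteq> 0" "1 + z \<noteq> 0" "1 - z \<noteq> 0" using assms by (auto simp: complex_eq_iff)
  have D: "(\<lambda>n. inverse (of_nat (Suc n)) - inverse (x + of_nat n)) sums (Digamma x + euler_mascheroni)"
    if "x \<noteq> 0" for x :: complex
    using summable_Digamma[OF that] by (simp add: Digamma_def summable_sums)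
  have "(\<lambda>m. 1 / (of_nat (m + 1) + z) - 1 / (of_nat (m + 1) - z)) sums (Digamma (1 - z) - Digamma (1 + z))"
    using sums_diff[OF D[OF nz(3)] D[OF nz(2)]] by (simp add: inverse_eq_divide algebra_simps)
  also have "Digamma (1 - z) - Digamma (1 + z) = of_real pi * cot (of_real pi * z) - 1 / z"
    using Digamma_reflection[OF assms] Digamma_plus1[OF nz(1)] by (simp add: algebra_simps)
  finally show ?thesis .
qed

lemma sums_inverse_square:
  fixes z :: complex
  assumes "z \<noteq> 0"
  shows "(\<lambda>k. 1 / (z + of_nat k) ^ 2) sums Polygamma 1 z"
  using Polygamma_LIMSEQ[OF assms, of 1] by (simp add: power2_eq_square inverse_eq_divide)

text \<open>The shifts of z by nonnegative integers come from \<open>Polygamma 1 z\<close>, those by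
  negative integers from \<open>Polygamma 1 (1 - z)\<close>.\<close>

lemma sums_inverse_sin_square:
  fixes z :: complex
  assumes "Im z \<noteq> 0"
  shows "(\<lambda>k. 1 / (z + of_nat (k + 1)) ^ 2 + 1 / (z - of_nat (k + 1)) ^ 2) sums
    (pi_csc2 z - 1 / z ^ 2)"
proof -
  have nz: "z \<noteq> 0" "1 - z \<noteq> 0" using assms by (auto simp: complex_eq_iff)
  have "(\<lambda>k. 1 / (z + of_nat (Suc k)) ^ 2) sums (Polygamma 1 z - 1 / z ^ 2)"
    using sums_inverse_square[OF nz(1)] by (subst sums_Suc_iff) simp
  moreover have "(\<lambda>k. 1 / (z - of_nat (k + 1)) ^ 2) sums Polygamma 1 (1 - z)"
  proof -
    have "1 - z + of_nat k = - (z - of_nat (k + 1))" for k by simp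
    then have "(1 - z + of_nat k) ^ 2 = (z - of_nat (k + 1)) ^ 2" for k
      by (metis power2_minus)
    then show ?thesis using sums_inverse_square[OF nz(2)] by simp
  qed
  ultimately have "(\<lambda>k. 1 / (z + of_nat (k + 1)) ^ 2 + 1 / (z - of_nat (k + 1)) ^ 2) sums
     (Polygamma 1 z - 1 / z ^ 2 + Polygamma 1 (1 - z))"
    using sums_add by fastforce
  then show ?thesis using Polygamma_1_reflection[OF assms] by (simp add: algebra_simps)
qed

section \<open>The lattice sum of weight two\<close>

lemma tendsto_cot_imaginary:
  fixes w :: complex
  assumes "Re w > 0"
  shows "(\<lambda>K. cot (of_real pi * (\<i> * (of_nat K + 1/2) * w))) \<longlonglongrightarrow> - \<i>"
proof -
  define E where "E = (\<lambda>K. exp (- (2 * of_real pi * (of_nat K + 1/2) * w)))"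
  have "norm (exp (- (2 * of_real pi * w))) < 1" using assms by simp
  then have "(\<lambda>K. exp (- (2 * of_real pi * w)) ^ K * exp (- (of_real pi * w))) \<longlonglongrightarrow> 0 * exp (- (of_real pi * w))"
    by (intro tendsto_intros) simp
  also have "(\<lambda>K. exp (- (2 * of_real pi * w)) ^ K * exp (- (of_real pi * w))) = E"
    unfolding E_def exp_of_nat_mult[symmetric] exp_add[symmetric]
    by (intro ext arg_cong[of _ _ exp]) (simp add: algebra_simps)
  finally have lim: "E \<longlonglongrightarrow> 0" by simp
  have eq: "cot (of_real pi * (\<i> * (of_nat K + 1/2) * w)) = - \<i> * ((1 + E K) / (1 - E K))" for K
  proof -
    define u where "u = of_real pi * (of_nat K + 1/2) * w"
    have EK: "E K = exp (-u) * exp (-u)" unfolding E_def exp_add[symmetric]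
      by (rule arg_cong[of _ _ exp]) (simp add: u_def algebra_simps)
    have "cot (\<i> * u) = \<i> * (exp (-u) + exp u) / (exp (-u) - exp u)"
    proof -
      have eq: "a / 2 / (b / (2 * \<i>)) = \<i> * a / b" for a b :: complex
        by (cases "b = 0") (simp_all add: field_simps)
      show ?thesis unfolding cot_def cos_exp_eq sin_exp_eq eq by simp
    qed
    also have "\<dots> = - \<i> * ((1 + E K) / (1 - E K))"
    proof -
      have "exp (-u) + exp u = exp u * (1 + E K)" "exp (-u) - exp u = - (exp u * (1 - E K))"
        unfolding EK by (simp_all add: algebra_simps exp_minus)
      then show ?thesis by simp
    qed
    also have "\<i> * u = of_real pi * (\<i> * (of_nat K + 1/2) * w)" unfolding u_def by simp
    finally show ?thesis .
  qed
  have "(\<lambda>K. - \<i> * ((1 + E K) / (1 - E K))) \<longlonglongrightarrow> - \<i> * ((1 + 0) / (1 - 0))"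
    by (intro tendsto_intros lim) auto
  then show ?thesis unfolding eq by simp
qed

text \<open>The imaginary part controls m, and the real part controls |\<kappa>| up to a loss of m
  |Im w|. Adding (1 + |Im w|)/Re w times the first estimate to the second absorbs the loss.\<close>

lemma norm_lattice_ge:
  fixes w :: complex and \<kappa> m :: real
  assumes w: "Re w > 0" and m: "m \<ge> 0"
  shows "norm (\<i> * of_real m * w + of_real \<kappa>) \<ge> (m + \<bar>\<kappa>\<bar>) / (1 + (1 + \<bar>Im w\<bar>) / Re w)"
proof -
  define u where "u = \<i> * of_real m * w + of_real \<kappa>"
  have "m * Re w \<le> norm u"
    using abs_Im_le_cmod[of u] unfolding u_def by simp
  then have 1: "m * (1 + \<bar>Im w\<bar>) \<le> norm u * ((1 + \<bar>Im w\<bar>) / Re w)"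
    using w mult_right_mono[of "m * Re w" "norm u" "(1 + \<bar>Im w\<bar>) / Re w"] by simp
  have "\<bar>\<kappa> - m * Im w\<bar> \<le> norm u"
    using abs_Re_le_cmod[of u] unfolding u_def by (simp add: algebra_simps)
  moreover have "\<bar>\<kappa>\<bar> - m * \<bar>Im w\<bar> \<le> \<bar>\<kappa> - m * Im w\<bar>"
    using abs_triangle_ineq2[of \<kappa> "m * Im w"] m by (simp add: abs_mult)
  ultimately have "m + \<bar>\<kappa>\<bar> \<le> norm u * (1 + (1 + \<bar>Im w\<bar>) / Re w)"
    using 1 by (simp add: algebra_simps)
  moreover have "0 < 1 + (1 + \<bar>Im w\<bar>) / Re w"
    using w by (intro add_pos_nonneg) auto
  ultimately show ?thesis unfolding u_def by (simp add: pos_divide_le_eq)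
qed

text \<open>The summand of the double series for $E_2$, corrected by a telescoping term so that it
  becomes absolutely summable.\<close>

definition corrected :: "complex \<Rightarrow> complex" where
  "corrected u = 1 / u ^ 2 - (1 / (u - 1/2) - 1 / (u + 1/2))"

text \<open>Over a common denominator the summand is -1/(4 u^2 (u^2 - 1/4)), of fourth order decay
  in m + |\<kappa>|. Splitting the fourth power into m^2 (1 + |\<kappa>|)^2 gives the product
  majorant that \<open>sums_swap\<close> requires.\<close>

lemma norm_corrected_le:
  fixes w :: complex and \<kappa> m :: real
  assumes w: "Re w > 0" and m: "m \<ge> 1"
  shows "norm (corrected (\<i> * of_real m * w + of_real \<kappa>))
    \<le> (1 + (1 + \<bar>Im w\<bar>) / Re w) ^ 4 * (1 / m ^ 2) * (1 / (1 + \<bar>\<kappa>\<bar>) ^ 2)"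
proof -
  define \<Delta> where "\<Delta> = 1 + (1 + \<bar>Im w\<bar>) / Re w"
  have \<Delta>: "\<Delta> > 0" unfolding \<Delta>_def using w by (intro add_pos_nonneg) auto
  define u where "u = \<i> * of_real m * w + of_real \<kappa>"
  define s where "s = m + \<bar>\<kappa>\<bar>"
  have s: "s \<ge> m" "s \<ge> 1 + \<bar>\<kappa>\<bar>" "s \<ge> 1" using m by (auto simp: s_def)
  have abs_half: "\<bar>\<kappa>\<bar> - 1/2 \<le> \<bar>\<kappa> - 1/2\<bar>" "\<bar>\<kappa>\<bar> - 1/2 \<le> \<bar>\<kappa> + 1/2\<bar>" by auto
  \<comment> \<open>Shifting by 1/2 costs at most half of s, because s >= 1.\<close>
  have half: "s / 2 \<le> m + \<bar>\<kappa> - 1/2\<bar>" "s / 2 \<le> m + \<bar>\<kappa> + 1/2\<bar>" 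
  proof -
    have "s / 2 \<le> s - 1/2" using s(3) by simp
    also have "s - 1/2 \<le> m + \<bar>\<kappa> - 1/2\<bar>" using abs_half(1) by (simp add: s_def)
    finally show "s / 2 \<le> m + \<bar>\<kappa> - 1/2\<bar>" .
    have "s / 2 \<le> s - 1/2" using s(3) by simp
    also have "s - 1/2 \<le> m + \<bar>\<kappa> + 1/2\<bar>" using abs_half(2) by (simp add: s_def)
    finally show "s / 2 \<le> m + \<bar>\<kappa> + 1/2\<bar>" .
  qed
  have u0: "s / \<Delta> \<le> norm u"
    using norm_lattice_ge[OF w, of m \<kappa>] m unfolding u_def s_def \<Delta>_def by simp
  have u1: "s / 2 / \<Delta> \<le> norm (u - 1/2)"
  proof -
    have "s / 2 / \<Delta> \<le> (m + \<bar>\<kappa> - 1/2\<bar>) / \<Delta>"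
      using half(1) \<Delta> by (intro divide_right_mono) auto
    also have "\<dots> \<le> norm (\<i> * of_real m * w + of_real (\<kappa> - 1/2))"
      using norm_lattice_ge[OF w, of m "\<kappa> - 1/2"] m unfolding \<Delta>_def by simp
    finally show ?thesis by (simp add: u_def algebra_simps)
  qed
  have u2: "s / 2 / \<Delta> \<le> norm (u + 1/2)"
  proof -
    have "s / 2 / \<Delta> \<le> (m + \<bar>\<kappa> + 1/2\<bar>) / \<Delta>"
      using half(2) \<Delta> by (intro divide_right_mono) auto
    also have "\<dots> \<le> norm (\<i> * of_real m * w + of_real (\<kappa> + 1/2))"
      using norm_lattice_ge[OF w, of m "\<kappa> + 1/2"] m unfolding \<Delta>_def by simp
    finally show ?thesis by (simp add: u_def algebra_simps)
  qed
  have pos: "0 < s / \<Delta>" "0 < s / 2 / \<Delta>" using s \<Delta> by auto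
  have nz: "u \<noteq> 0" "u - 1/2 \<noteq> 0" "u + 1/2 \<noteq> 0"
    using pos u0 u1 u2 by (metis norm_zero not_le)+
  have "corrected u = - (1/4) / (u ^ 2 * ((u - 1/2) * (u + 1/2)))"
  proof -
    have "1 / (u - 1/2) - 1 / (u + 1/2) = 1 / ((u - 1/2) * (u + 1/2))"
      using nz by (simp add: diff_frac_eq)
    then have "corrected u = ((u - 1/2) * (u + 1/2) - u ^ 2) / (u ^ 2 * ((u - 1/2) * (u + 1/2)))"
      unfolding corrected_def using nz diff_frac_eq[of "u ^ 2" "(u - 1/2) * (u + 1/2)" 1 1] by simp
    also have "(u - 1/2) * (u + 1/2) - u ^ 2 = - (1/4)" by (simp add: field_simps power2_eq_square)
    finally show ?thesis .
  qed
  then have "norm (corrected u) = (1/4) / (norm u ^ 2 * (norm (u - 1/2) * norm (u + 1/2)))"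
    by (simp add: norm_divide norm_mult norm_power)
  also have "\<dots> \<le> (1/4) / ((s / \<Delta>) ^ 2 * ((s / 2 / \<Delta>) * (s / 2 / \<Delta>)))"
    using pos u0 u1 u2 nz by (intro divide_left_mono mult_mono power_mono mult_pos_pos zero_less_power) auto
  also have "\<dots> = \<Delta> ^ 4 * (1 / (s ^ 2 * s ^ 2))"
    using s \<Delta> by (simp add: field_simps power2_eq_square power4_eq_xxxx)
  also have "\<dots> \<le> \<Delta> ^ 4 * (1 / (m ^ 2 * (1 + \<bar>\<kappa>\<bar>) ^ 2))"
    using s m \<Delta> by (intro mult_left_mono divide_left_mono mult_mono power_mono) auto
  finally show ?thesis unfolding u_def \<Delta>_def by simp
qed

lemma tendsto_inverse_shifted:
  "(\<lambda>k. 1 / (z + of_nat k)) \<longlonglongrightarrow> (0::complex)"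
  "(\<lambda>k. 1 / (z - of_nat k)) \<longlonglongrightarrow> (0::complex)"
proof -
  show *: "(\<lambda>k. 1 / (z + of_nat k)) \<longlonglongrightarrow> 0" for z :: complex
    unfolding inverse_eq_divide[symmetric]
    by (intro filterlim_compose[OF tendsto_inverse_0] tendsto_add_filterlim_at_infinity[OF tendsto_const] tendsto_of_nat)
  have "(\<lambda>k. - (1 / (- z + of_nat k))) \<longlonglongrightarrow> - 0" by (intro tendsto_minus *)
  moreover have "- (1 / (- z + of_nat k)) = 1 / (z - of_nat k)" for k
    by (metis minus_diff_eq minus_divide_right uminus_add_conv_diff)
  ultimately show "(\<lambda>k. 1 / (z - of_nat k)) \<longlonglongrightarrow> 0" by simp
qed

text \<open>Over a whole row the correction telescopes and its terms tend to 0 at both ends, so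
  correcting does not change the row sum. The term at v itself is moved to the right.\<close>

lemma sums_corrected:
  assumes "Im v \<noteq> 0"
  shows "(\<lambda>k. corrected (v + of_nat (k + 1)) + corrected (v - of_nat (k + 1))) sums
    (pi_csc2 v - corrected v)"
proof -
  have 1: "(\<lambda>k. 1 / (v + 1/2 + of_nat k) - 1 / (v + 1/2 + of_nat (Suc k))) sums (1 / (v + 1/2 + of_nat 0) - 0)"
    by (intro telescope_sums' tendsto_inverse_shifted)
  have 2: "(\<lambda>k. 1 / (v - 1/2 - of_nat (Suc k)) - 1 / (v - 1/2 - of_nat k)) sums (0 - 1 / (v - 1/2 - of_nat 0))"
    by (intro telescope_sums tendsto_inverse_shifted)
  have "(\<lambda>k. (1 / (v + of_nat (k + 1)) ^ 2 + 1 / (v - of_nat (k + 1)) ^ 2) -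
       ((1 / (v + 1/2 + of_nat k) - 1 / (v + 1/2 + of_nat (Suc k))) +
        (1 / (v - 1/2 - of_nat (Suc k)) - 1 / (v - 1/2 - of_nat k)))) sums
     ((pi_csc2 v - 1 / v ^ 2) -
      ((1 / (v + 1/2 + of_nat 0) - 0) + (0 - 1 / (v - 1/2 - of_nat 0))))"
    by (intro sums_diff sums_add 1 2 sums_inverse_sin_square assms)
  moreover have "(1 / (v + of_nat (k + 1)) ^ 2 + 1 / (v - of_nat (k + 1)) ^ 2) -
       ((1 / (v + 1/2 + of_nat k) - 1 / (v + 1/2 + of_nat (Suc k))) +
        (1 / (v - 1/2 - of_nat (Suc k)) - 1 / (v - 1/2 - of_nat k))) =
     corrected (v + of_nat (k + 1)) + corrected (v - of_nat (k + 1))" for k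
  proof -
    have eqs: "v + of_nat (k + 1) - 1/2 = v + 1/2 + of_nat k" "v + of_nat (k + 1) + 1/2 = v + 1/2 + of_nat (Suc k)"
      "v - of_nat (k + 1) - 1/2 = v - 1/2 - of_nat (Suc k)" "v - of_nat (k + 1) + 1/2 = v - 1/2 - of_nat k"
      by (simp_all add: field_simps)
    show ?thesis unfolding corrected_def eqs by (rule add_diff_add)
  qed
  ultimately have "(\<lambda>k. corrected (v + of_nat (k + 1)) + corrected (v - of_nat (k + 1))) sums
     ((pi_csc2 v - 1 / v ^ 2) -
      ((1 / (v + 1/2 + of_nat 0) - 0) + (0 - 1 / (v - 1/2 - of_nat 0))))"
    by (simp only:)
  moreover have "(pi_csc2 v - 1 / v ^ 2) -
      ((1 / (v + 1/2 + of_nat 0) - 0) + (0 - 1 / (v - 1/2 - of_nat 0))) =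
      pi_csc2 v - corrected v"
    by (simp add: corrected_def)
  ultimately show ?thesis by (simp only:)
qed

text \<open>Over finitely many columns the telescoping leaves two boundary terms at distance K +
  1/2. They vanish in the limit for each fixed v, but their sum over all rows does not; this
  produces the non-modular term.\<close>

lemma sum_corrected:
  "corrected v + (\<Sum>k<K. corrected (v + of_nat (k + 1)) + corrected (v - of_nat (k + 1))) =
   1 / v ^ 2 + (\<Sum>k<K. 1 / (v + of_nat (k + 1)) ^ 2 + 1 / (v - of_nat (k + 1)) ^ 2)
   - (1 / (v - (of_nat K + 1/2)) - 1 / (v + (of_nat K + 1/2)))"
proof (induction K)
  case 0
  show ?case by (simp add: corrected_def)
next
  case (Suc K)
  have eqs: "v + of_nat (K + 1) - 1/2 = v + (of_nat K + 1/2)" "v + of_nat (K + 1) + 1/2 = v + (of_nat (Suc K) + 1/2)"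
    "v - of_nat (K + 1) - 1/2 = v - (of_nat (Suc K) + 1/2)" "v - of_nat (K + 1) + 1/2 = v - (of_nat K + 1/2)"
    by (simp_all add: field_simps)
  have "corrected (v + of_nat (K + 1)) = 1 / (v + of_nat (K + 1)) ^ 2 -
        (1 / (v + (of_nat K + 1/2)) - 1 / (v + (of_nat (Suc K) + 1/2)))"
    "corrected (v - of_nat (K + 1)) = 1 / (v - of_nat (K + 1)) ^ 2 -
        (1 / (v - (of_nat (Suc K) + 1/2)) - 1 / (v - (of_nat K + 1/2)))"
    unfolding corrected_def eqs by (rule refl)+
  \<comment> \<open>Here p and q are the boundary terms for K, and p' and q' those for K +
    1.\<close>
  moreover have "a + (s + (x + y)) = e + (t + (ex + ey)) - (p' - q')"
    if "a + s = e + t - (p - q)" "x = ex - (q - q')" "y = ey - (p' - p)"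
    for a s e t p q p' q' x y ex ey :: complex
    using that by algebra
  ultimately show ?case using Suc unfolding sum.lessThan_Suc by blast
qed

text \<open>This is the transformation law of the weight two Eisenstein series. Rows have fixed m
  and sum to values at w; columns have a fixed integer shift and sum to values at 1/w. The corrected
  terms may be summed in either order. Removing the correction is free by rows, but by columns it
  costs the limit of \<open>D\<close>, namely -pi/w.\<close>

lemma inverse_sin_square_transformation:
  fixes w :: complex
  assumes w: "Re w > 0"
  obtains Q Q' where
    "(\<lambda>m. pi_csc2 (\<i> * of_nat (m + 1) * w)) sums Q"
    "(\<lambda>m. pi_csc2 (\<i> * of_nat (m + 1) * (1 / w))) sums Q'"
    "Q + Q' / w ^ 2 = of_real pi / w - of_real pi ^ 2 / 6 * (1 + 1 / w ^ 2)"
proof -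
  have w0: "w \<noteq> 0" using w by auto
  have w': "Re (1 / w) > 0" using w by (simp add: Re_divide complex_eq_iff power2_eq_square add_pos_nonneg)
  have Im_i: "Im (\<i> * of_real r * x) = r * Re x" for r x by simp
  define V where "V m = \<i> * of_nat (m + 1) * w" for m
  have Im_V: "Im (V m) \<noteq> 0" for m using w by (simp add: V_def)
  \<comment> \<open>Nonzero columns are taken in pairs k + 1 and -(k + 1); the column 0 is kept
    apart and sums to \<open>C0\<close>.\<close>
  define T where "T m k = corrected (V m + of_nat (k + 1)) + corrected (V m - of_nat (k + 1))" for m k
  define \<Delta> where "\<Delta> = (1 + (1 + \<bar>Im w\<bar>) / Re w) ^ 4"
  have \<Delta>: "\<Delta> \<ge> 0" by (simp add: \<Delta>_def)
  have sq: "summable (\<lambda>m. 1 / (real (m + 1)) ^ 2)"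
    using inverse_squares_sums by (auto simp: sums_iff)
  have sqc: "(\<lambda>m. 1 / of_nat (m + 1) ^ 2) sums (of_real pi ^ 2 / 6 :: complex)"
    using sums_of_real[OF inverse_squares_sums, where 'a = complex] by simp
  have C: "norm (corrected (V m + of_real \<kappa>)) \<le> \<Delta> * (1 / (real (m + 1)) ^ 2) * (1 / (1 + \<bar>\<kappa>\<bar>) ^ 2)" for m \<kappa>
    using norm_corrected_le[OF w, of "real (m + 1)" \<kappa>] unfolding V_def \<Delta>_def by simp
  have T_le: "norm (T m k) \<le> (1 / (real (m + 1)) ^ 2) * (2 * \<Delta> * (1 / (real (k + 1)) ^ 2))" for m k
  proof -
    have "1 / (1 + \<bar>real (k + 1)\<bar>) ^ 2 \<le> 1 / (real (k + 1)) ^ 2"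
      by (intro divide_left_mono power_mono) auto
    then have le: "\<Delta> * (1 / (real (m + 1)) ^ 2) * (1 / (1 + \<bar>real (k + 1)\<bar>) ^ 2)
        \<le> \<Delta> * (1 / (real (m + 1)) ^ 2) * (1 / (real (k + 1)) ^ 2)"
      using \<Delta> by (intro mult_left_mono) auto
    have "norm (T m k) \<le> norm (corrected (V m + of_real (real (k + 1)))) + norm (corrected (V m + of_real (- real (k + 1))))"
      (is "_ \<le> norm (corrected ?x) + norm (corrected ?y)")
    proof -
      have "?x = V m + of_nat (k + 1)" "?y = V m - of_nat (k + 1)" by simp_all
      then show ?thesis unfolding T_def by (metis norm_triangle_ineq)
    qed
    with C[of m "real (k + 1)"] C[of m "- real (k + 1)"] le show ?thesis by simp
  qed
  have rows: "T m sums (pi_csc2 (V m) - corrected (V m))" for m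
    unfolding T_def using sums_corrected[OF Im_V] .
  have "summable (\<lambda>m. T m k)" for k
    by (rule summable_comparison_test'[OF summable_mult2[OF sq], of 0, OF T_le])
  then have cols: "(\<lambda>m. T m k) sums (\<Sum>m. T m k)" for k by (rule summable_sums)
  obtain s where s: "(\<lambda>m. pi_csc2 (V m) - corrected (V m)) sums s"
      "(\<lambda>k. \<Sum>m. T m k) sums s"
    by (rule sums_swap[OF T_le sq _ summable_mult[OF sq] _ rows cols]) (use \<Delta> in auto)
  have "summable (\<lambda>m. corrected (V m))"
    by (rule summable_comparison_test'[OF summable_mult[OF sq, of \<Delta>], of 0]) (use C[of _ 0] in simp)
  then obtain C0 where C0: "(\<lambda>m. corrected (V m)) sums C0" by (auto simp: summable_def)
  have Q: "(\<lambda>m. pi_csc2 (V m)) sums (s + C0)"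
    using sums_add[OF s(1) C0] by simp
  \<comment> \<open>The column sums without the correction. For y = i (k+1)/w, the points V m +
    (k+1) and V m - (k+1) are i w times -(y - (m+1)) and y + (m+1), so the partial fractions of the
    squared cosecant at y apply.\<close>
  define E where "E k = - (1 / w ^ 2) * (pi_csc2 (\<i> * of_nat (k + 1) * (1 / w)))
      - 1 / of_nat (k + 1) ^ 2" for k
  have E_col: "(\<lambda>m. 1 / (V m + of_nat (k + 1)) ^ 2 + 1 / (V m - of_nat (k + 1)) ^ 2) sums E k" for k
  proof -
    define y where "y = \<i> * of_nat (k + 1) * (1 / w)"
    have y: "Im y \<noteq> 0" using w' Im_i[of "real (k + 1)" "1 / w"] unfolding y_def of_real_of_nat_eq by auto
    have "(\<lambda>m. - (1 / w ^ 2) * (1 / (y + of_nat (m + 1)) ^ 2 + 1 / (y - of_nat (m + 1)) ^ 2)) sums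
        (- (1 / w ^ 2) * (pi_csc2 y - 1 / y ^ 2))"
      by (intro sums_mult sums_inverse_sin_square y)
    moreover have "- (1 / w ^ 2) * (1 / (y + of_nat (m + 1)) ^ 2 + 1 / (y - of_nat (m + 1)) ^ 2) =
        1 / (V m + of_nat (k + 1)) ^ 2 + 1 / (V m - of_nat (k + 1)) ^ 2" for m
    proof -
      have "V m + of_nat (k + 1) = \<i> * w * - (y - of_nat (m + 1))"
        "V m - of_nat (k + 1) = \<i> * w * (y + of_nat (m + 1))"
        using w0 by (simp_all add: V_def y_def field_simps)
      then have "(V m + of_nat (k + 1)) ^ 2 = - (w ^ 2) * (y - of_nat (m + 1)) ^ 2"
        "(V m - of_nat (k + 1)) ^ 2 = - (w ^ 2) * (y + of_nat (m + 1)) ^ 2"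
        by (simp_all only: power_mult_distrib power2_minus power2_i mult_minus_left mult_1_left)
      then show ?thesis by (simp add: divide_simps)
    qed
    moreover have "- (1 / w ^ 2) * (pi_csc2 y - 1 / y ^ 2) = E k"
      using w0 unfolding E_def y_def by (simp add: power_mult_distrib power_divide algebra_simps del: of_nat_Suc of_nat_add)
    ultimately show ?thesis by simp
  qed
  define E0 where "E0 = - (1 / w ^ 2) * (of_real pi ^ 2 / 6)"
  have E0: "(\<lambda>m. 1 / V m ^ 2) sums E0"
  proof -
    have "(\<lambda>m. - (1 / w ^ 2) * (1 / of_nat (m + 1) ^ 2)) sums E0"
      unfolding E0_def by (intro sums_mult sqc)
    then show ?thesis unfolding V_def by (simp add: power_mult_distrib mult_ac)
  qed
  \<comment> \<open>The half-integer boundary points in the scale in which the rows become integers,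
    so that \<open>sums_cot\<close> evaluates the boundary terms summed over all rows.\<close>
  define Y where "Y K = \<i> * (of_nat K + 1/2) * (1 / w)" for K
  define D where "D K = (1 / (\<i> * w)) * (of_real pi * cot (of_real pi * Y K) - 1 / Y K)" for K
  have D: "(\<lambda>m. 1 / (V m - (of_nat K + 1/2)) - 1 / (V m + (of_nat K + 1/2))) sums D K" for K
  proof -
    have "Im (Y K) = (real K + 1/2) * Re (1 / w)"
      using Im_i[of "real K + 1/2" "1 / w"] unfolding Y_def by simp
    then have "Im (Y K) \<noteq> 0" using w' by auto
    then have "(\<lambda>m. (1 / (\<i> * w)) * (1 / (of_nat (m + 1) + Y K) - 1 / (of_nat (m + 1) - Y K))) sums D K"
      unfolding D_def by (intro sums_mult sums_cot)
    moreover have "(1 / (\<i> * w)) * (1 / (of_nat (m + 1) + Y K) - 1 / (of_nat (m + 1) - Y K)) =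
       1 / (V m - (of_nat K + 1/2)) - 1 / (V m + (of_nat K + 1/2))" for m
    proof -
      have "V m - (of_nat K + 1/2) = \<i> * w * (of_nat (m + 1) + Y K)"
        "V m + (of_nat K + 1/2) = \<i> * w * (of_nat (m + 1) - Y K)"
        using w0 by (simp_all add: V_def Y_def field_simps)
      then show ?thesis by (simp add: right_diff_distrib)
    qed
    ultimately show ?thesis by simp
  qed
  have partial: "C0 + (\<Sum>k<K. \<Sum>m. T m k) = E0 + (\<Sum>k<K. E k) - D K" for K
  proof (rule sums_unique2)
    show "(\<lambda>m. corrected (V m) + (\<Sum>k<K. T m k)) sums (C0 + (\<Sum>k<K. \<Sum>m. T m k))"
      by (intro sums_add sums_sum C0 cols)
    show "(\<lambda>m. corrected (V m) + (\<Sum>k<K. T m k)) sums (E0 + (\<Sum>k<K. E k) - D K)"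
      unfolding T_def sum_corrected by (intro sums_add sums_diff sums_sum E0 E_col D)
  qed
  \<comment> \<open>The imaginary part of \<open>Y K\<close> tends to infinity, where the cotangent
    tends to -i.\<close>
  have "D \<longlonglongrightarrow> (1 / (\<i> * w)) * (of_real pi * (- \<i>) - 0)"
    unfolding D_def
  proof (intro tendsto_intros)
    show "(\<lambda>K. cot (of_real pi * Y K)) \<longlonglongrightarrow> - \<i>"
      unfolding Y_def by (rule tendsto_cot_imaginary[OF w'])
    have "(\<lambda>K. w / \<i> * (1 / (1/2 + of_nat K))) \<longlonglongrightarrow> w / \<i> * 0"
      by (intro tendsto_mult tendsto_const tendsto_inverse_shifted)
    moreover have "1 / (\<i> * a * (1 / w)) = w / \<i> * (1 / a)" for a
      using w0 by (cases "a = 0") (auto simp: divide_simps)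
    ultimately show "(\<lambda>K. 1 / Y K) \<longlonglongrightarrow> 0"
      unfolding Y_def by (simp only: add.commute[of _ "1/2"] mult_zero_right)
  qed
  then have D_lim: "D \<longlonglongrightarrow> - (of_real pi / w)" using w0 by simp
  have "(\<lambda>K. C0 + (\<Sum>k<K. \<Sum>m. T m k) - E0 + D K) \<longlonglongrightarrow> C0 + s - E0 + - (of_real pi / w)"
    using s(2) D_lim unfolding sums_def by (intro tendsto_intros)
  then have E_sums: "E sums (C0 + s - E0 - of_real pi / w)"
    unfolding partial sums_def by simp
  have "(\<lambda>k. - (w ^ 2) * (E k + 1 / of_nat (k + 1) ^ 2)) sums
      (- (w ^ 2) * (C0 + s - E0 - of_real pi / w + of_real pi ^ 2 / 6))"
    by (intro sums_mult sums_add E_sums sqc)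
  then have Q': "(\<lambda>m. pi_csc2 (\<i> * of_nat (m + 1) * (1 / w))) sums
      (- (w ^ 2) * (C0 + s - E0 - of_real pi / w + of_real pi ^ 2 / 6))"
    using w0 unfolding E_def by simp
  show ?thesis
  proof (rule that[OF Q[unfolded V_def] Q'])
    show "s + C0 + - (w ^ 2) * (C0 + s - E0 - of_real pi / w + of_real pi ^ 2 / 6) / w ^ 2 =
        of_real pi / w - of_real pi ^ 2 / 6 * (1 + 1 / w ^ 2)"
    proof -
      have eq: "- (w ^ 2) * X / w ^ 2 = - X" for X using w0 by simp
      show ?thesis unfolding eq E0_def by (simp add: algebra_simps)
    qed
  qed
qed

text \<open>Both series are iterated sums of n x^(n m) over n, m >= 1: a geometric series when m is
  summed first, its derivative when n is.\<close>

lemma lambert_series: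
  fixes x :: complex
  assumes x: "norm x < 1" and s: "(\<lambda>n. of_nat (n + 1) * x ^ (n + 1) / (1 - x ^ (n + 1))) sums s"
  shows "(\<lambda>m. x ^ (m + 1) / (1 - x ^ (m + 1)) ^ 2) sums s"
proof -
  define f where "f n m = of_nat (n + 1) * x ^ ((n + 1) * (m + 1))" for n m
  have power_less: "norm (x ^ (m + 1)) < 1" for m
    using x power_less_one_iff[of "norm x" "m + 1"] by (simp only: norm_power) simp
  have bound: "norm (f n m) \<le> (of_nat (Suc n) * norm x ^ n) * norm x ^ m" for n m
  proof -
    \<comment> \<open>The exponent is at least n + m, which separates the variables in the
      majorant.\<close>
    have "norm x ^ ((n + 1) * (m + 1)) \<le> norm x ^ (n + m)"
      using x by (intro power_decreasing) auto
    then have "real (Suc n) * norm x ^ ((n + 1) * (m + 1)) \<le> real (Suc n) * norm x ^ (n + m)"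
      by (intro mult_left_mono) auto
    moreover have "norm (f n m) = real (Suc n) * norm x ^ ((n + 1) * (m + 1))"
      unfolding f_def norm_mult norm_power norm_of_nat by simp
    ultimately show ?thesis by (simp add: power_add mult.assoc)
  qed
  have rows: "f n sums (of_nat (n + 1) * x ^ (n + 1) / (1 - x ^ (n + 1)))" for n
  proof -
    have "(\<lambda>m. of_nat (n + 1) * x ^ (n + 1) * (x ^ (n + 1)) ^ m) sums
        (of_nat (n + 1) * x ^ (n + 1) * (1 / (1 - x ^ (n + 1))))"
      by (intro sums_mult geometric_sums power_less)
    moreover have "x ^ ((n + 1) * (m + 1)) = x ^ (n + 1) * (x ^ (n + 1)) ^ m" for m
      by (metis Suc_eq_plus1 power_Suc power_mult)
    ultimately show ?thesis unfolding f_def by (simp only: mult.assoc times_divide_eq_right mult_1_right)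
  qed
  have cols: "(\<lambda>n. f n m) sums (x ^ (m + 1) / (1 - x ^ (m + 1)) ^ 2)" for m
  proof -
    have "(\<lambda>n. x ^ (m + 1) * (of_nat (Suc n) * (x ^ (m + 1)) ^ n)) sums
        (x ^ (m + 1) * (1 / (1 - x ^ (m + 1)) ^ 2))"
      by (intro sums_mult geometric_deriv_sums power_less)
    moreover have "x ^ (m + 1) * (of_nat (Suc n) * (x ^ (m + 1)) ^ n) = f n m" for n
    proof -
      have "x ^ ((n + 1) * (m + 1)) = (x ^ (m + 1)) ^ (n + 1)" by (metis power_mult mult.commute)
      also have "\<dots> = x ^ (m + 1) * (x ^ (m + 1)) ^ n" by simp
      finally show ?thesis unfolding f_def Suc_eq_plus1 by (simp only: mult_ac)
    qed
    ultimately show ?thesis by simp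
  qed
  have g: "summable (\<lambda>n. of_nat (Suc n) * norm x ^ n :: real)"
    using geometric_deriv_sums[of "norm x"] x by (auto simp: sums_iff)
  obtain t where t: "(\<lambda>n. of_nat (n + 1) * x ^ (n + 1) / (1 - x ^ (n + 1))) sums t"
      "(\<lambda>m. x ^ (m + 1) / (1 - x ^ (m + 1)) ^ 2) sums t"
    by (rule sums_swap[OF bound g _ _ _ rows cols]) (use x in \<open>auto intro: summable_geometric\<close>)
  with s show ?thesis using sums_unique2 by blast
qed

text \<open>Dedekind's eta function at i w without its factor exp(-pi w/12); that factor reappears
  as exp(pi/12 (1/w - w)) in the inversion formula.\<close>

definition eta_product :: "complex \<Rightarrow> complex" where
  "eta_product w = euler_phi (exp (- (2 * of_real pi * w)))"

lemma eta_product_nonzero: "Re w > 0 \<Longrightarrow> eta_product w \<noteq> 0"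
  unfolding eta_product_def by (intro euler_phi_nonzero) simp

lemma eta_product_has_field_derivative:
  assumes w: "Re w > 0"
  shows "(eta_product has_field_derivative deriv eta_product w) (at w)"
proof -
  have "eta_product holomorphic_on {w. Re w > 0}"
  proof -
    have "(\<lambda>w. exp (- (2 * of_real pi * w))) holomorphic_on {w. Re w > 0}"
      by (intro holomorphic_intros)
    moreover have "(\<lambda>w. exp (- (2 * of_real pi * w))) ` {w. Re w > 0} \<subseteq> ball 0 1"
      by (auto simp: image_subset_iff)
    ultimately have "(euler_phi \<circ> (\<lambda>w. exp (- (2 * of_real pi * w)))) holomorphic_on {w. Re w > 0}"
      by (intro holomorphic_on_compose_gen[OF _ holomorphic_euler_phi[OF order_refl]]) auto
    then show ?thesis by (simp add: o_def eta_product_def[abs_def])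
  qed
  moreover have "open {w. Re w > 0}" by (intro open_Collect_less continuous_intros)
  ultimately show ?thesis using w holomorphic_derivI by blast
qed

text \<open>Termwise logarithmic differentiation gives 2 pi times the Lambert series of n x^n/(1 -
  x^n) with x = exp(-2 pi w). After resummation, x^m/(1 - x^m)^2 = -1/(4 sin(pi i m w)^2).\<close>

lemma eta_product_logderiv:
  assumes w: "Re w > 0"
  shows "(\<lambda>m. pi_csc2 (\<i> * of_nat (m + 1) * w)) sums
    (- 2 * of_real pi * (deriv eta_product w / eta_product w))"
proof -
  define x where "x = exp (- (2 * of_real pi * w))"
  have x: "norm x < 1" unfolding x_def using w by simp
  define f where "f j v = 1 - exp (- (2 * of_real pi * v)) ^ (j + 1)" for j and v :: complex
  \<comment> \<open>On this ball Re v > Re w/2, so the argument of \<open>euler_phi\<close> stays in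
    the closed disc of radius exp(-pi Re w) < 1.\<close>
  define A where "A = ball w (Re w / 2)"
  have A: "Re v > Re w / 2" if "v \<in> A" for v
    using that abs_Re_le_cmod[of "w - v"] unfolding A_def mem_ball dist_norm by simp
  have "uniform_limit A (\<lambda>n v. \<Prod>k<n. f k v) eta_product sequentially"
    unfolding f_def eta_product_def
  proof (rule uniform_limit_compose'[OF uniform_limit_euler_phi])
    show "exp (- (pi * Re w)) < 1" using w by simp
    have "- (2 * (pi * Re v)) \<le> - (pi * Re w)" if "v \<in> A" for v
      using A[OF that] mult_left_mono[of "Re w" "2 * Re v" pi] by simp
    then show "(\<lambda>v. exp (- (2 * of_real pi * v))) \<in> A \<rightarrow> cball 0 (exp (- (pi * Re w)))"
      by auto
  qed
  then have "(\<lambda>k. deriv (f k) w / f k w) sums (deriv eta_product w / eta_product w)"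
  proof (rule logderiv_prodinf_complex_uniform_limit)
    show "f k holomorphic_on A" for k unfolding f_def by (intro holomorphic_intros)
    show "eta_product w \<noteq> 0" using eta_product_nonzero[OF w] .
  qed (use w in \<open>auto simp: A_def\<close>)
  moreover have "deriv (f k) w / f k w = 2 * of_real pi * (of_nat (k + 1) * x ^ (k + 1) / (1 - x ^ (k + 1)))" for k
  proof -
    have "f k = (\<lambda>v. 1 - exp (- (2 * of_real pi * (of_nat (k + 1) * v))))"
      unfolding f_def exp_of_nat_mult[symmetric] by (simp add: mult_ac)
    then have "(f k has_field_derivative 2 * of_real pi * (of_nat (k + 1) * exp (- (2 * of_real pi * (of_nat (k + 1) * w))))) (at w)"
      by (auto intro!: derivative_eq_intros)
    also have "exp (- (2 * of_real pi * (of_nat (k + 1) * w))) = x ^ (k + 1)"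
      unfolding x_def exp_of_nat_mult[symmetric] by (simp add: mult_ac)
    finally have "deriv (f k) w = 2 * of_real pi * (of_nat (k + 1) * x ^ (k + 1))"
      by (rule DERIV_imp_deriv)
    then show ?thesis by (simp add: f_def x_def)
  qed
  ultimately have "(\<lambda>k. 2 * of_real pi * (of_nat (k + 1) * x ^ (k + 1) / (1 - x ^ (k + 1)))) sums
      (deriv eta_product w / eta_product w)" by simp
  then have "(\<lambda>k. (1 / (2 * of_real pi)) * (2 * of_real pi * (of_nat (k + 1) * x ^ (k + 1) / (1 - x ^ (k + 1))))) sums
      ((1 / (2 * of_real pi)) * (deriv eta_product w / eta_product w))"
    by (rule sums_mult)
  then have "(\<lambda>k. of_nat (k + 1) * x ^ (k + 1) / (1 - x ^ (k + 1))) sums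
      ((1 / (2 * of_real pi)) * (deriv eta_product w / eta_product w))"
    by (simp del: of_nat_Suc of_nat_add power_Suc add: mult.assoc[symmetric])
  moreover have scale: "- 4 * of_real pi ^ 2 * ((1 / (2 * of_real pi)) * X) = - 2 * of_real pi * X" for X :: complex
    by (simp add: power2_eq_square)
  ultimately have "(\<lambda>m. - 4 * of_real pi ^ 2 * (x ^ (m + 1) / (1 - x ^ (m + 1)) ^ 2)) sums
      (- 4 * of_real pi ^ 2 * ((1 / (2 * of_real pi)) * (deriv eta_product w / eta_product w)))"
    using sums_mult[OF lambert_series[OF x], of _ "- 4 * of_real pi ^ 2"] by blast
  then have "(\<lambda>m. - 4 * of_real pi ^ 2 * (x ^ (m + 1) / (1 - x ^ (m + 1)) ^ 2)) sums
      (- 2 * of_real pi * (deriv eta_product w / eta_product w))"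
    unfolding scale .
  moreover have "- 4 * of_real pi ^ 2 * (x ^ (m + 1) / (1 - x ^ (m + 1)) ^ 2) =
      pi_csc2 (\<i> * of_nat (m + 1) * w)" for m
  proof -
    define v where "v = of_real pi * of_nat (m + 1) * w"
    have xm: "x ^ (m + 1) = exp (- v) * exp (- v)"
      unfolding x_def exp_of_nat_mult[symmetric] exp_add[symmetric]
      by (rule arg_cong[of _ _ exp]) (simp add: v_def algebra_simps)
    have "sin (\<i> * v) = (exp (- v) - exp v) / (2 * \<i>)" unfolding sin_exp_eq by simp
    then have "sin (\<i> * v) ^ 2 = - ((exp (- v) - exp v) ^ 2) / 4"
      by (simp add: power_divide power_mult_distrib)
    also have "(exp (- v) - exp v) ^ 2 = (1 - x ^ (m + 1)) ^ 2 / x ^ (m + 1)"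
    proof -
      have "exp (- v) * exp v = 1" by (simp add: exp_minus)
      then have "(exp (- v) - exp v) ^ 2 * (exp (- v) * exp (- v)) = (1 - exp (- v) * exp (- v)) ^ 2"
        by algebra
      then show ?thesis unfolding xm by (simp add: field_simps)
    qed
    finally show ?thesis
      unfolding v_def by (simp add: mult_ac)
  qed
  ultimately show ?thesis by simp
qed

lemma eta_logderiv_transformation:
  assumes w: "Re w > 0"
  shows "deriv eta_product w / eta_product w + deriv eta_product (1 / w) / eta_product (1 / w) / w ^ 2
    = of_real pi / 12 * (1 + 1 / w ^ 2) - 1 / (2 * w)"
proof -
  have w': "Re (1 / w) > 0"
    using w by (auto simp: Re_divide power2_eq_square add_pos_nonneg)
  define L where "L w = deriv eta_product w / eta_product w" for w
  obtain Q Q' where Q: "(\<lambda>m. pi_csc2 (\<i> * of_nat (m + 1) * w)) sums Q"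
    "(\<lambda>m. pi_csc2 (\<i> * of_nat (m + 1) * (1 / w))) sums Q'"
    "Q + Q' / w ^ 2 = of_real pi / w - of_real pi ^ 2 / 6 * (1 + 1 / w ^ 2)"
    using inverse_sin_square_transformation[OF w] .
  have "Q = - 2 * of_real pi * L w" "Q' = - 2 * of_real pi * L (1 / w)"
    unfolding L_def using sums_unique2[OF Q(1) eta_product_logderiv[OF w]]
      sums_unique2[OF Q(2) eta_product_logderiv[OF w']] by simp_all
  then have "- 2 * of_real pi * (L w + L (1 / w) / w ^ 2) = Q + Q' / w ^ 2"
    by (simp add: distrib_left)
  also note Q(3)
  also have "of_real pi / w - of_real pi ^ 2 / 6 * (1 + 1 / w ^ 2) =
      - 2 * of_real pi * (of_real pi / 12 * (1 + 1 / w ^ 2) - 1 / (2 * w))"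
  proof -
    have "p * b - p ^ 2 / 6 * (1 + a) = - 2 * p * (p / 12 * (1 + a) - b / 2)" for p a b :: complex
      by (simp add: field_simps power2_eq_square)
    from this[of "of_real pi" "1 / w" "1 / w ^ 2"] show ?thesis by simp
  qed
  finally have "- 2 * of_real pi * (L w + L (1 / w) / w ^ 2) =
      - 2 * of_real pi * (of_real pi / 12 * (1 + 1 / w ^ 2) - 1 / (2 * w))"
    .
  then have "L w + L (1 / w) / w ^ 2 = of_real pi / 12 * (1 + 1 / w ^ 2) - 1 / (2 * w)"
    by (simp only: mult_cancel_left) simp
  then show ?thesis unfolding L_def .
qed

text \<open>A derivative written as f x times a displays the logarithmic derivative a: products add
  these factors and inverses negate them. The derivative of the quotient \<open>R\<close> below is
  assembled this way.\<close>

lemma DERIV_mult_log: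
  assumes "(f has_field_derivative f x * a) (at x)" "(g has_field_derivative g x * b) (at x)"
  shows "((\<lambda>x. f x * g x) has_field_derivative (f x * g x) * (a + b)) (at x)"
  using DERIV_mult[OF assms] by (simp add: algebra_simps)

lemma DERIV_inverse_log:
  fixes f :: "complex \<Rightarrow> complex"
  assumes "(f has_field_derivative f x * a) (at x)" "f x \<noteq> 0"
  shows "((\<lambda>x. inverse (f x)) has_field_derivative inverse (f x) * (- a)) (at x)"
proof -
  have "inverse (f x) * (f x * a) * inverse (f x) = inverse (f x) * a"
    using assms(2) by simp
  with DERIV_inverse'[OF assms] show ?thesis by simp
qed

text \<open>The quotient \<open>R\<close> of the two sides has logarithmic derivative 0 by
  \<open>eta_logderiv_transformation\<close>, so it is constant on the half-plane. The fixed point w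
  = 1 of the inversion shows that the constant is 1.\<close>

theorem eta_product_inversion:
  assumes w: "Re w > 0"
  shows "eta_product (1 / w) = csqrt w * exp (of_real pi / 12 * (1 / w - w)) * eta_product w"
proof -
  define H where "H = {w. Re w > 0}"
  define R where "R w = eta_product (1 / w) * exp (of_real pi / 12 * (w - 1 / w)) *
      inverse (csqrt w) * inverse (eta_product w)" for w
  have "R constant_on H"
  proof -
    have "\<exists>c. \<forall>w\<in>H. R w = c"
    proof (rule has_field_derivative_zero_constant)
      show "convex H" unfolding H_def by (rule convex_halfspace_Re_gt)
      fix w assume "w \<in> H"
      then have w: "Re w > 0" by (simp add: H_def)
      have w0: "w \<noteq> 0" using w by auto
      have w': "Re (1 / w) > 0"
        using w by (auto simp: Re_divide power2_eq_square add_pos_nonneg)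
      define L where "L w = deriv eta_product w / eta_product w" for w
      have eta: "(eta_product has_field_derivative eta_product v * L v) (at v)" if "Re v > 0" for v
        using eta_product_has_field_derivative[OF that] eta_product_nonzero[OF that] by (simp add: L_def)
      have 1: "((\<lambda>w. eta_product (1 / w)) has_field_derivative eta_product (1 / w) * (- L (1 / w) / w ^ 2)) (at w)"
      proof -
        have "((\<lambda>w. 1 / w) has_field_derivative - 1 / w ^ 2) (at w)"
          using w0 by (auto intro!: derivative_eq_intros simp: power2_eq_square)
        from DERIV_chain2[OF eta[OF w'] this] show ?thesis by simp
      qed
      have 2: "((\<lambda>w. exp (of_real pi / 12 * (w - 1 / w))) has_field_derivative
          exp (of_real pi / 12 * (w - 1 / w)) * (of_real pi / 12 * (1 + 1 / w ^ 2))) (at w)"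
        using w0 by (auto intro!: derivative_eq_intros simp: power2_eq_square)
      have 3: "((\<lambda>w. csqrt w) has_field_derivative csqrt w * (1 / (2 * w))) (at w)"
      proof -
        have "w \<notin> \<real>\<^sub>\<le>\<^sub>0" using w by (auto simp: complex_nonpos_Reals_iff)
        then have "(csqrt has_field_derivative inverse (2 * csqrt w)) (at w)"
          by (rule has_field_derivative_csqrt)
        also have "inverse (2 * csqrt w) = csqrt w * (1 / (2 * csqrt w ^ 2))"
          using w0 by (simp add: field_simps power2_eq_square)
        finally show ?thesis by simp
      qed
      have "(R has_field_derivative R w *
          (- L (1 / w) / w ^ 2 + of_real pi / 12 * (1 + 1 / w ^ 2) + - (1 / (2 * w)) + - L w)) (at w)"
        unfolding R_def
        by (intro DERIV_mult_log DERIV_inverse_log 1 2 3 eta w) (use w0 eta_product_nonzero[OF w] in auto)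
      also have "- L (1 / w) / w ^ 2 + of_real pi / 12 * (1 + 1 / w ^ 2) + - (1 / (2 * w)) + - L w = 0"
        using eta_logderiv_transformation[OF w] unfolding L_def[symmetric] by (simp add: algebra_simps)
      finally show "(R has_field_derivative 0) (at w within H)"
        by (simp add: has_field_derivative_at_within)
    qed
    then show ?thesis by (simp add: constant_on_def)
  qed
  moreover have "1 \<in> H" "w \<in> H" using w by (auto simp: H_def)
  ultimately have "R w = R 1" by (auto simp: constant_on_def)
  also have "R 1 = 1" unfolding R_def using eta_product_nonzero[of 1] by simp
  finally have "eta_product (1 / w) * exp (of_real pi / 12 * (w - 1 / w)) = csqrt w * eta_product w"
    unfolding R_def using eta_product_nonzero[OF w] w by (auto simp: field_simps)
  moreover have "exp (of_real pi / 12 * (1 / w - w)) * exp (of_real pi / 12 * (w - 1 / w)) = 1"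
    unfolding exp_add[symmetric] distrib_left[symmetric] by simp
  ultimately show ?thesis by algebra
qed

section \<open>Dedekind sums and the modular transformation\<close>

lemma dedekind_sum_mod:
  assumes "k > 0"
  shows "dedekind_sum (h mod int k) k = dedekind_sum h k"
  unfolding dedekind_sum_def
proof (intro sum.cong refl)
  fix r
  define m where "m = h div int k"
  have h: "h = h mod int k + int k * m" unfolding m_def by simp
  have "real_of_int h * real r / real k = real_of_int (h mod int k) * real r / real k + real_of_int (m * int r)"
    using assms by (subst h) (simp add: field_simps)
  then show "real r / real k * (real_of_int (h mod int k) * real r / real k -
        of_int \<lfloor>real_of_int (h mod int k) * real r / real k\<rfloor> - 1/2) =
      real r / real k * (real_of_int h * real r / real k -
        of_int \<lfloor>real_of_int h * real r / real k\<rfloor> - 1/2)"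
    by (simp only: floor_add_int[symmetric]) simp
qed

text \<open>Coprimality keeps h r/k off the integers for 0 < r < k. Hence the floor of -x is minus
  the floor of x, less 1, and the summand is odd in h.\<close>

lemma dedekind_sum_minus:
  assumes "coprime h (int k)"
  shows "dedekind_sum (- h) k = - dedekind_sum h k"
  unfolding dedekind_sum_def sum_negf[symmetric]
proof (intro sum.cong refl)
  fix r assume r: "r \<in> {1..<k}"
  define x where "x = real_of_int h * real r / real k"
  have "x \<noteq> of_int \<lfloor>x\<rfloor>"
  proof
    assume "x = of_int \<lfloor>x\<rfloor>"
    then have "real_of_int (h * int r) = real_of_int (\<lfloor>x\<rfloor> * int k)"
      using r unfolding x_def by (simp add: field_simps)
    then have "int k dvd h * int r" by (metis dvd_triv_right of_int_eq_iff)
    then have "int k dvd int r"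
      using assms by (simp add: coprime_dvd_mult_right_iff coprime_commute)
    then have "k dvd r" by simp
    with r show False by (auto dest: dvd_imp_le)
  qed
  then have "\<lfloor>- x\<rfloor> = - \<lfloor>x\<rfloor> - 1" by linarith
  then have eq: "of_int \<lfloor>- x\<rfloor> = - of_int \<lfloor>x\<rfloor> - (1::real)" by simp
  have x': "real_of_int (- h) * real r / real k = - x" by (simp add: x_def)
  show "real r / real k * (real_of_int (- h) * real r / real k -
        of_int \<lfloor>real_of_int (- h) * real r / real k\<rfloor> - 1/2) =
      - (real r / real k * (real_of_int h * real r / real k -
        of_int \<lfloor>real_of_int h * real r / real k\<rfloor> - 1/2))"
    unfolding x' x_def[symmetric] eq by (simp add: algebra_simps)
qed

lemma bij_betw_mult_mod:
  fixes h k :: nat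
  assumes "coprime h k"
  shows "bij_betw (\<lambda>r. h * r mod k) {1..<k} {1..<k}"
proof -
  have "inj_on (\<lambda>r. h * r mod k) {1..<k}"
  proof (rule inj_onI)
    fix x y assume xy: "x \<in> {1..<k}" "y \<in> {1..<k}" "h * x mod k = h * y mod k"
    then have "[h * x = h * y] (mod k)" by (simp add: cong_def)
    then have "[x = y] (mod k)" using assms by (simp add: cong_mult_lcancel_nat)
    with xy show "x = y" by (simp add: cong_def)
  qed
  moreover have "(\<lambda>r. h * r mod k) ` {1..<k} \<subseteq> {1..<k}"
  proof (intro image_subsetI)
    fix r assume r: "r \<in> {1..<k}"
    have "\<not> k dvd h * r"
      using r assms by (auto simp: coprime_dvd_mult_right_iff coprime_commute dest: dvd_imp_le)
    then have "h * r mod k \<noteq> 0" by (simp add: mod_eq_0_iff_dvd)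
    with r show "h * r mod k \<in> {1..<k}" by auto
  qed
  ultimately show ?thesis
    by (simp add: bij_betw_def endo_inj_surj)
qed

text \<open>Lattice points under the diagonal of a k by h rectangle, with weight 2 v at height v,
  are counted by columns r and by rows v. Coprimality keeps lattice points off the diagonal, so weak
  and strict inequalities agree.\<close>

lemma sum_div_triangular:
  fixes h k :: nat
  assumes "coprime h k" "h > 0" "k > 0"
  shows "(\<Sum>r=1..<k. (h * r div k) * (h * r div k + 1)) = (\<Sum>v=1..<h. 2 * v * (k - 1 - k * v div h))"
proof -
  have "(\<Sum>r=1..<k. (h * r div k) * (h * r div k + 1)) = (\<Sum>r=1..<k. \<Sum>v=1..<h. if v \<le> h * r div k then 2 * v else 0)"
  proof (intro sum.cong refl)
    fix r assume r: "r \<in> {1..<k}"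
    have "h * r div k < h" using r assms by (simp add: div_less_iff_less_mult)
    then have "{v \<in> {1..<h}. v \<le> h * r div k} = {1..h * r div k}" by auto
    then have "(\<Sum>v=1..<h. if v \<le> h * r div k then 2 * v else 0) = (\<Sum>v=1..h * r div k. 2 * v)"
      by (simp add: sum.If_cases Int_def)
    also have "(\<Sum>v=1..n. 2 * v) = n * (n + 1)" for n :: nat by (induction n) auto
    finally show "(h * r div k) * (h * r div k + 1) = (\<Sum>v=1..<h. if v \<le> h * r div k then 2 * v else 0)" ..
  qed
  also have "\<dots> = (\<Sum>v=1..<h. \<Sum>r=1..<k. if v \<le> h * r div k then 2 * v else 0)"
    by (rule sum.swap)
  also have "\<dots> = (\<Sum>v=1..<h. 2 * v * (k - 1 - k * v div h))"
  proof (intro sum.cong refl)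
    fix v assume v: "v \<in> {1..<h}"
    have "k * v div h < k" using v assms by (simp add: div_less_iff_less_mult)
    have iff: "v \<le> h * r div k \<longleftrightarrow> k * v div h < r" if "r \<in> {1..<k}" for r
    proof -
      have "h * r \<noteq> v * k"
      proof
        assume "h * r = v * k"
        then have "k dvd h * r" by simp
        then have "k dvd r" using assms by (simp add: coprime_dvd_mult_right_iff coprime_commute)
        with that show False by (auto dest: dvd_imp_le)
      qed
      then show ?thesis
        using assms by (auto simp: less_eq_div_iff_mult_less_eq div_less_iff_less_mult mult.commute)
    qed
    have "(\<Sum>r=1..<k. if v \<le> h * r div k then 2 * v else 0) = (\<Sum>r=1..<k. if k * v div h < r then 2 * v else 0)"
      by (intro sum.cong refl) (simp add: iff)
    also have "\<dots> = (\<Sum>r\<in>{r \<in> {1..<k}. k * v div h < r}. 2 * v)"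
      by (simp add: sum.If_cases Int_def)
    also have "{r \<in> {1..<k}. k * v div h < r} = {k * v div h<..<k}" by auto
    finally show "(\<Sum>r=1..<k. if v \<le> h * r div k then 2 * v else 0) = 2 * v * (k - 1 - k * v div h)"
      by (simp add: mult.commute)
  qed
  finally show ?thesis .
qed

lemma sum_first_nat: "(\<Sum>r=1..<k. real r) = real k * (real k - 1) / 2"
  by (induction k) (auto simp: field_simps)

lemma sum_first_square: "(\<Sum>r=1..<k. real r ^ 2) = real k * (real k - 1) * (2 * real k - 1) / 6"
  by (induction k) (auto simp: field_simps power2_eq_square)

lemma dedekind_sum_expand:
  fixes h k :: nat
  assumes "k > 0"
  shows "real k ^ 2 * dedekind_sum (int h) k =
    real h * (\<Sum>r=1..<k. real r ^ 2) - real k * (\<Sum>r=1..<k. real r * real (h * r div k))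
      - real k / 2 * (\<Sum>r=1..<k. real r)"
proof -
  have "real k ^ 2 * dedekind_sum (int h) k =
      (\<Sum>r=1..<k. real h * real r ^ 2 - real k * (real r * real (h * r div k)) - real k / 2 * real r)"
    unfolding dedekind_sum_def sum_distrib_left
  proof (intro sum.cong refl)
    fix r
    have "\<lfloor>real_of_int (int h) * real r / real k\<rfloor> = int (h * r div k)"
      using floor_divide_of_nat_eq[of "h * r" k] by simp
    then show "real k ^ 2 * (real r / real k * (real_of_int (int h) * real r / real k -
          of_int \<lfloor>real_of_int (int h) * real r / real k\<rfloor> - 1/2)) =
        real h * real r ^ 2 - real k * (real r * real (h * r div k)) - real k / 2 * real r"
      using assms by (simp add: field_simps power2_eq_square)
  qed
  then show ?thesis by (simp add: sum_subtractf sum_distrib_left)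
qed

text \<open>Write h r = k F + M with remainder M. Since M permutes 1..k-1, the sums of M and M^2 are
  those of r and r^2, which gives \<open>F1\<close> and \<open>F2\<close>. The lattice count gives
  \<open>F3\<close>, tying the sum of F^2 to the sum of v G in the other Dedekind sum. Eliminating
  the sums with F and G leaves the law.\<close>

theorem dedekind_sum_reciprocity:
  fixes h k :: nat
  assumes "coprime h k" "h > 0" "k > 0"
  shows "dedekind_sum (int h) k + dedekind_sum (int k) h =
    - 1/4 + (real h / real k + real k / real h + 1 / (real h * real k)) / 12"
proof -
  define F where "F r = real (h * r div k)" for r
  define G where "G v = real (k * v div h)" for v
  define M where "M r = real (h * r mod k)" for r
  define a where "a = real h"
  define b where "b = real k"
  have pos: "a > 0" "b > 0" using assms by (auto simp: a_def b_def)
  have hr: "a * real r = b * F r + M r" for r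
    unfolding a_def b_def F_def M_def of_nat_mult[symmetric] of_nat_add[symmetric] by simp
  note bij = bij_betw_mult_mod[OF assms(1)]
  have M1: "(\<Sum>r=1..<k. M r) = (\<Sum>r=1..<k. real r)"
    unfolding M_def using sum.reindex_bij_betw[OF bij, of real] .
  have M2: "(\<Sum>r=1..<k. M r ^ 2) = (\<Sum>r=1..<k. real r ^ 2)"
    unfolding M_def using sum.reindex_bij_betw[OF bij, of "\<lambda>r. real r ^ 2"] .
  have "(\<Sum>r=1..<k. M r) = (\<Sum>r=1..<k. a * real r - b * F r)"
    using hr by (intro sum.cong refl) (simp add: algebra_simps)
  then have F1: "b * (\<Sum>r=1..<k. F r) = (a - 1) * (\<Sum>r=1..<k. real r)"
    unfolding M1 sum_subtractf sum_distrib_left[symmetric] by (simp add: algebra_simps)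
  have "(\<Sum>r=1..<k. M r ^ 2) = (\<Sum>r=1..<k. a ^ 2 * real r ^ 2 - 2 * a * b * (real r * F r) + b ^ 2 * F r ^ 2)"
  proof (intro sum.cong refl)
    fix r
    have eq: "M r = a * real r - b * F r" using hr[of r] by simp
    show "M r ^ 2 = a ^ 2 * real r ^ 2 - 2 * a * b * (real r * F r) + b ^ 2 * F r ^ 2"
      unfolding eq by (simp add: power2_eq_square algebra_simps)
  qed
  then have F2: "(\<Sum>r=1..<k. real r ^ 2) = a ^ 2 * (\<Sum>r=1..<k. real r ^ 2)
      - 2 * a * b * (\<Sum>r=1..<k. real r * F r) + b ^ 2 * (\<Sum>r=1..<k. F r ^ 2)"
    unfolding M2 sum.distrib sum_subtractf sum_distrib_left[symmetric] .
  have "(\<Sum>r=1..<k. F r ^ 2 + F r) = real (\<Sum>r=1..<k. (h * r div k) * (h * r div k + 1))"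
    unfolding of_nat_sum F_def by (intro sum.cong refl) (simp add: power2_eq_square algebra_simps)
  also have "\<dots> = (\<Sum>v=1..<h. 2 * (b - 1) * real v - 2 * (real v * G v))"
    unfolding sum_div_triangular[OF assms] of_nat_sum
  proof (intro sum.cong refl)
    fix v assume v: "v \<in> {1..<h}"
    have "k * v div h < k" using v assms by (simp add: div_less_iff_less_mult)
    then have "real (k - 1 - k * v div h) = b - 1 - G v"
      unfolding b_def G_def by (simp add: of_nat_diff)
    then show "real (2 * v * (k - 1 - k * v div h)) = 2 * (b - 1) * real v - 2 * (real v * G v)"
      unfolding of_nat_mult by (simp only:) (simp add: algebra_simps)
  qed
  finally have F3: "(\<Sum>r=1..<k. F r ^ 2) = 2 * (b - 1) * (\<Sum>v=1..<h. real v) - 2 * (\<Sum>v=1..<h. real v * G v)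
      - (\<Sum>r=1..<k. F r)"
    unfolding sum.distrib sum_subtractf sum_distrib_left[symmetric] by simp
  define s where "s = dedekind_sum (int h) k"
  define t where "t = dedekind_sum (int k) h"
  define X where "X = (\<Sum>r=1..<k. real r * F r)"
  define Y where "Y = (\<Sum>v=1..<h. real v * G v)"
  have S: "b ^ 2 * s = a * (b * (b - 1) * (2 * b - 1) / 6) - b * X - b / 2 * (b * (b - 1) / 2)"
    using dedekind_sum_expand[OF assms(3), of h]
    unfolding sum_first_nat sum_first_square s_def X_def F_def a_def b_def .
  have T: "a ^ 2 * t = b * (a * (a - 1) * (2 * a - 1) / 6) - a * Y - a / 2 * (a * (a - 1) / 2)"
    using dedekind_sum_expand[OF assms(2), of k]
    unfolding sum_first_nat sum_first_square t_def Y_def G_def a_def b_def .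
  define Z where "Z = (\<Sum>r=1..<k. F r ^ 2)"
  have Fsum: "(\<Sum>r=1..<k. F r) = (a - 1) * (b - 1) / 2"
  proof -
    have "b * (\<Sum>r=1..<k. F r) = b * ((a - 1) * (b - 1) / 2)"
      using F1 unfolding sum_first_nat b_def[symmetric] by (simp add: mult_ac)
    then show ?thesis using pos by (simp only: mult_cancel_left) simp
  qed
  have Z: "Z = 2 * (b - 1) * (a * (a - 1) / 2) - 2 * Y - (a - 1) * (b - 1) / 2"
    using F3 unfolding Fsum Z_def Y_def sum_first_nat a_def .
  have F2': "b * (b - 1) * (2 * b - 1) / 6 = a ^ 2 * (b * (b - 1) * (2 * b - 1) / 6) - 2 * a * b * X + b ^ 2 * Z"
    using F2 unfolding X_def Z_def sum_first_square b_def .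
  have "a * (a * t) = a * (b * ((a - 1) * (2 * a - 1) / 6) - Y - a * (a - 1) / 4)"
    using T by (simp add: power2_eq_square algebra_simps)
  then have at: "a * t = b * ((a - 1) * (2 * a - 1) / 6) - Y - a * (a - 1) / 4"
    using pos by (simp only: mult_cancel_left) simp
  have X: "2 * a * b * X = a ^ 2 * (b * (b - 1) * (2 * b - 1) / 6) + b ^ 2 * Z - b * (b - 1) * (2 * b - 1) / 6"
    using F2' by simp
  \<comment> \<open>With this multiplier \<open>X\<close> enters as 2 a b X, as \<open>F2\<close>
    supplies it, and the two occurrences of \<open>Y\<close> cancel.\<close>
  have "12 * a * b ^ 2 * (s + t) = 12 * a * (b ^ 2 * s) + 12 * b ^ 2 * (a * t)"
    by (simp add: algebra_simps)
  also have "\<dots> = 12 * a * (a * (b * (b - 1) * (2 * b - 1) / 6) - b / 2 * (b * (b - 1) / 2)) - 6 * (2 * a * b * X)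
      + 12 * b ^ 2 * (b * ((a - 1) * (2 * a - 1) / 6) - Y - a * (a - 1) / 4)"
    unfolding S at by (simp add: algebra_simps)
  also have "\<dots> = b * (- 3 * a * b + a ^ 2 + b ^ 2 + 1)"
    unfolding X Z by (simp add: field_simps power2_eq_square)
  finally have "12 * a * b ^ 2 * (s + t) = b * (- 3 * a * b + a ^ 2 + b ^ 2 + 1)" .
  then have "12 * a * b * (s + t) = - 3 * a * b + a ^ 2 + b ^ 2 + 1"
    using pos by (simp add: power2_eq_square)
  then have "s + t = (- 3 * a * b + a ^ 2 + b ^ 2 + 1) / (12 * a * b)"
    using pos by (simp add: field_simps)
  also have "\<dots> = - 1/4 + (a / b + b / a + 1 / (a * b)) / 12"
    using pos by (simp add: field_simps power2_eq_square)
  finally show ?thesis unfolding s_def t_def a_def b_def .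
qed

section \<open>Branches of the square root and the transformation at rational points\<close>

lemma abs_Im_csqrt_less:
  assumes "Re z > 0"
  shows "\<bar>Im (csqrt z)\<bar> < Re (csqrt z)"
proof -
  define c where "c = csqrt z"
  have "c ^ 2 = z" by (simp add: c_def)
  then have "Re z = Re c ^ 2 - Im c ^ 2" by (metis Re_power2)
  then have "\<bar>Im c\<bar> ^ 2 < Re c ^ 2" using assms by simp
  moreover have "0 \<le> Re c" unfolding c_def by (rule Re_csqrt)
  ultimately show ?thesis unfolding c_def[symmetric] by (rule power2_less_imp_less)
qed

text \<open>Principal roots of points in the right half-plane lie in the sector |arg| < pi/4, so a
  product of two of them has positive real part and is again a principal root.\<close>

lemma csqrt_mult_Re_pos:
  assumes "Re a > 0" "Re b > 0"
  shows "csqrt (a * b) = csqrt a * csqrt b"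
proof (rule csqrt_unique)
  show "(csqrt a * csqrt b) ^ 2 = a * b" by (simp add: power_mult_distrib)
  have "\<bar>Im (csqrt a) * Im (csqrt b)\<bar> < Re (csqrt a) * Re (csqrt b)"
    unfolding abs_mult by (intro mult_strict_mono' abs_Im_csqrt_less assms) auto
  then have "Im (csqrt a) * Im (csqrt b) < Re (csqrt a) * Re (csqrt b)" by linarith
  then show "0 < Re (csqrt a * csqrt b) \<or> Re (csqrt a * csqrt b) = 0 \<and> 0 \<le> Im (csqrt a * csqrt b)"
    by (simp del: csqrt.sel)
qed

text \<open>Rotating the sector |arg| < pi/4 by -pi/4 keeps it in the right half-plane. The phase
  e^(-pi i/4) will match the -1/4 of the reciprocity law.\<close>

lemma csqrt_minus_i_mult:
  assumes "Re w > 0"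
  shows "csqrt (- \<i> * w) = exp (- (of_real pi * \<i> / 4)) * csqrt w"
proof (rule csqrt_unique)
  define e where "e = exp (- (of_real pi * \<i> / 4))"
  have "e ^ 2 = exp (- (of_real pi / 2 * \<i>))"
    unfolding e_def exp_double[symmetric] by (rule arg_cong[of _ _ exp]) simp
  also have "\<dots> = - \<i>" by (simp add: exp_minus exp_eq_polar cis_conv_exp[symmetric] flip: of_real_divide)
  finally show "(e * csqrt w) ^ 2 = - \<i> * w" by (simp add: power_mult_distrib)
  have e: "Re e = sqrt 2 / 2" "Im e = - (sqrt 2 / 2)"
    unfolding e_def by (simp_all add: Re_exp Im_exp cos_45 sin_45)
  have "\<bar>Im (csqrt w)\<bar> < Re (csqrt w)" by (rule abs_Im_csqrt_less[OF assms])
  then have "0 < sqrt 2 / 2 * (Re (csqrt w) + Im (csqrt w))" by (simp del: csqrt.sel)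
  also have "\<dots> = Re (e * csqrt w)" using e by (simp add: algebra_simps del: csqrt.sel)
  finally show "0 < Re (e * csqrt w) \<or> Re (e * csqrt w) = 0 \<and> 0 \<le> Im (e * csqrt w)" by blast
qed

text \<open>The scaling lets the modular substitution act as w -> 1/w for every denominator k, with
  only the numerator changing. The root of unity is approached as w -> 0.\<close>

definition cusp :: "int \<Rightarrow> nat \<Rightarrow> complex \<Rightarrow> complex" where
  "cusp h k w = exp (2 * of_real pi * \<i> * (of_int h + \<i> * w) / of_nat k)"

lemma norm_cusp: "norm (cusp h k w) = exp (- (2 * pi * Re w / real k))"
proof -
  have "Re (2 * of_real pi * \<i> * (of_int h + \<i> * w) / of_nat k) = - (2 * pi * Re w / real k)"
    by (simp add: Re_divide_of_nat algebra_simps)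
  then show ?thesis unfolding cusp_def norm_exp_eq_Re by simp
qed

lemma cusp_mod:
  assumes "k > 0"
  shows "cusp (h mod int k) k w = cusp h k w"
proof -
  define m where "m = h div int k"
  have h: "h = h mod int k + int k * m" unfolding m_def by simp
  have "2 * of_real pi * \<i> * (of_int h + \<i> * w) / of_nat k =
      2 * of_real pi * \<i> * (of_int (h mod int k) + \<i> * w) / of_nat k + 2 * of_int m * of_real pi * \<i>"
    using assms by (subst h) (simp add: field_simps)
  moreover have "exp (2 * of_int m * of_real pi * \<i>) = 1"
    using exp_integer_2pi[of "of_int m"] by simp
  ultimately show ?thesis
    unfolding cusp_def by (simp only: exp_add mult_1_right)
qed

lemma cusp_eq:
  assumes "k > 0"
  shows "cusp h k w = exp (- (2 * of_real pi * ((w - \<i> * of_int h) / of_nat k)))"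
  unfolding cusp_def by (rule arg_cong[of _ _ exp]) (use assms in \<open>simp add: field_simps\<close>)

text \<open>Strong induction on k along the Euclidean algorithm: h is reduced to its residue n, one
  inversion exchanges the pair (n, k) for (-k, n), and the induction hypothesis covers the smaller
  denominator n. Dedekind reciprocity accounts for the change of phase.\<close>

theorem euler_phi_modular_transformation:
  fixes h H :: int and k :: nat and w :: complex
  assumes "k > 0" "int k dvd h * H + 1" "Re w > 0"
  shows "euler_phi (cusp H k (1 / w)) =
    exp (of_real pi * \<i> * of_real (dedekind_sum h k)) * csqrt w *
    exp (of_real pi / (12 * of_nat k) * (1 / w - w)) * euler_phi (cusp h k w)"
  using assms
proof (induction k arbitrary: h H w rule: less_induct)
  case (less k)
  have w0: "w \<noteq> 0" using less.prems by auto
  show ?case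
  proof (cases "k = 1")
    case True
    have "cusp h 1 w = cusp (h mod int 1) 1 w" "cusp H 1 (1 / w) = cusp (H mod int 1) 1 (1 / w)"
      by (simp_all only: cusp_mod)
    then have "euler_phi (cusp h 1 w) = eta_product w" "euler_phi (cusp H 1 (1 / w)) = eta_product (1 / w)"
      by (simp_all add: eta_product_def cusp_eq)
    moreover have "dedekind_sum h 1 = 0" by (simp add: dedekind_sum_def)
    ultimately show ?thesis using eta_product_inversion[OF less.prems(3)] True by simp
  next
    case False
    with less.prems(1) have k: "k > 1" by simp
    define h0 where "h0 = h mod int k"
    have dvd0: "int k dvd h0 * H + 1"
    proof -
      have "h0 * H + 1 = h * H + 1 - int k * (h div int k * H)"
        unfolding h0_def by (simp add: minus_mult_div_eq_mod[symmetric] algebra_simps)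
      then show ?thesis using dvd_diff[OF less.prems(2) dvd_triv_left[of "int k" "h div int k * H"]]
        by (simp only:)
    qed
    have h0_bounds: "0 \<le> h0" "h0 < int k" using k by (auto simp: h0_def)
    have "h0 \<noteq> 0" using dvd0 k by auto
    define n where "n = nat h0"
    have n: "int n = h0" "0 < n" "n < k" using h0_bounds \<open>h0 \<noteq> 0\<close> by (auto simp: n_def)
    \<comment> \<open>The companion of -k modulo n: -k H' + 1 = -\<open>h0\<close> H is a multiple
      of n = \<open>h0\<close>.\<close>
    define H' where "H' = (h0 * H + 1) div int k"
    have H': "int k * H' = h0 * H + 1" using dvd0 by (simp add: H'_def)
    have coprime: "coprime n k"
    proof -
      have "coprime h0 (int k)"
      proof (rule coprimeI)
        fix c assume "c dvd h0" "c dvd int k"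
        then have "c dvd int k * H' - h0 * H" by (intro dvd_diff dvd_mult2)
        then show "is_unit c" unfolding H' by simp
      qed
      then show ?thesis using n(1) by (metis coprime_int_iff)
    qed
    define N where "N = (of_nat n :: complex)"
    define K where "K = (of_nat k :: complex)"
    have K0: "K \<noteq> 0" "N \<noteq> 0" using k n by (auto simp: K_def N_def)
    have N: "of_int h0 = N" using n(1) by (metis N_def of_int_of_nat_eq)
    define d where "d = N + \<i> * w"
    have d0: "d \<noteq> 0"
    proof
      assume "d = 0"
      then have "Im d = 0" by simp
      with less.prems(3) show False by (simp add: d_def N_def)
    qed
    \<comment> \<open>\<open>eta_product W\<close> is the value at the cusp h/k with parameter w.
      The choice of w' makes 1/\<open>W\<close> = (w' + i k)/n, which is the cusp -k/n with
      parameter w'.\<close>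
    define w' where "w' = K * w / d"
    define W where "W = (w - \<i> * N) / K"
    have W: "Re W > 0" using less.prems(3) k by (simp add: W_def N_def K_def Re_divide_of_nat)
    have W_d: "W = - \<i> * d / K" by (simp add: W_def d_def algebra_simps)
    have w': "Re w' > 0"
    proof -
      \<comment> \<open>Positivity of the real part is easier to see on the inverse, where it comes
        from n/(k w) alone.\<close>
      have "inverse w' = (N / w + \<i>) / K"
        using w0 d0 K0 by (simp add: w'_def d_def field_simps)
      moreover have "Re ((N / w + \<i>) / K) > 0"
        using less.prems(3) k n(2) unfolding N_def K_def
        by (simp add: Re_divide_of_nat) (simp add: Re_divide add_pos_nonneg power2_eq_square zero_less_mult_iff divide_pos_pos)
      ultimately have "Re (inverse w') > 0" by simp
      then show ?thesis by (simp add: zero_less_divide_iff sum_power2_gt_zero_iff not_less) (smt (verit) not_sum_power2_lt_zero)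
    qed
    have IH: "euler_phi (cusp H' n (1 / w')) =
        exp (of_real pi * \<i> * of_real (dedekind_sum (- int k) n)) * csqrt w' *
        exp (of_real pi / (12 * of_nat n) * (1 / w' - w')) * euler_phi (cusp (- int k) n w')"
    proof (rule less.IH)
      have "- int k * H' + 1 = - (h0 * H)" using H' by simp
      then show "int n dvd - int k * H' + 1" using n(1) by simp
    qed (use n w' in auto)
    have W_inv: "1 / W = w' / N + \<i> * K / N"
    proof -
      have "w' + \<i> * K = (K * w + \<i> * K * d) / d" using d0 by (simp add: w'_def add_divide_distrib)
      also have "K * w + \<i> * K * d = \<i> * K * N" by (simp add: d_def algebra_simps)
      finally have "(w' + \<i> * K) / N = \<i> * K / d" using K0 by simp
      moreover have "1 / W = \<i> * K / d" using d0 K0 by (simp add: W_d field_simps)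
      ultimately show ?thesis by (simp add: add_divide_distrib)
    qed
    have f1: "cusp H' n (1 / w') = cusp H k (1 / w)"
    proof -
      have "K * of_int H' = N * of_int H + 1"
        using arg_cong[OF H', of "of_int :: int \<Rightarrow> complex"] by (simp add: K_def N)
      then have e1: "of_int H' = (N * of_int H + 1) / K" using K0 by (simp add: field_simps)
      have e2: "1 / w' = N / (K * w) + \<i> / K" using w0 d0 K0 by (simp add: w'_def d_def field_simps)
      have "of_int H' + \<i> * (1 / w') = N * ((of_int H + \<i> * (1 / w)) / K)"
        unfolding e1 e2 using w0 K0 by (simp add: field_simps)
      then have "(of_int H' + \<i> * (1 / w')) / N = (of_int H + \<i> * (1 / w)) / K"
        using K0 by simp
      then show ?thesis unfolding cusp_def N_def[symmetric] K_def[symmetric] by (metis times_divide_eq_right)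
    qed
    have f2: "euler_phi (cusp h k w) = eta_product W"
    proof -
      have "cusp h k w = cusp h0 k w" unfolding h0_def using cusp_mod k by simp
      then show ?thesis using k by (simp add: eta_product_def cusp_eq W_def N K_def)
    qed
    have f3: "euler_phi (cusp (- int k) n w') = eta_product (1 / W)"
    proof -
      have "(w' - \<i> * of_int (- int k)) / N = 1 / W"
        unfolding W_inv by (simp add: K_def[symmetric] add_divide_distrib)
      then show ?thesis using n by (simp add: eta_product_def cusp_eq N_def)
    qed
    have f4: "eta_product (1 / W) = csqrt W * exp (of_real pi / 12 * (1 / W - W)) * eta_product W"
      by (rule eta_product_inversion[OF W])
    have f5: "csqrt W * csqrt w' = exp (- (of_real pi * \<i> / 4)) * csqrt w"
    proof -
      have "W * w' = - \<i> * w" using d0 K0 by (simp add: W_d w'_def)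
      then show ?thesis
        using csqrt_mult_Re_pos[OF W w'] csqrt_minus_i_mult[OF less.prems(3)] by simp
    qed
    \<comment> \<open>\<open>g2\<close> leaves the remainder i (n/k + k/n + 1/(n k))/12. Together
      with the phase -1/4 of the square roots, this is what reciprocity adds to s(-k, n) to give
      s(h, k).\<close>
    have f6: "exp (of_real pi * \<i> * of_real (dedekind_sum (- int k) n)) * exp (- (of_real pi * \<i> / 4)) *
        exp (of_real pi / (12 * N) * (1 / w' - w')) * exp (of_real pi / 12 * (1 / W - W)) =
        exp (of_real pi * \<i> * of_real (dedekind_sum h k)) * exp (of_real pi / (12 * K) * (1 / w - w))"
    proof -
      have "dedekind_sum (- int k) n = - dedekind_sum (int k) n"
        using coprime by (intro dedekind_sum_minus) (simp add: coprime_commute)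
      moreover have "dedekind_sum h k = dedekind_sum (int n) k"
        unfolding n(1) h0_def using dedekind_sum_mod k by simp
      ultimately have "dedekind_sum (- int k) n - 1/4 + (real n / real k + real k / real n + 1 / (real n * real k)) / 12
          = dedekind_sum h k"
        using dedekind_sum_reciprocity[OF coprime] n k by simp
      from arg_cong[OF this, of complex_of_real]
      have g1: "of_real (dedekind_sum (- int k) n) - 1/4 + (N / K + K / N + 1 / (N * K)) / 12
          = (of_real (dedekind_sum h k) :: complex)"
        by (simp add: N_def K_def)
      have g2: "1 / (12 * N) * (1 / w' - w') + 1 / 12 * (1 / W - W) =
          1 / (12 * K) * (1 / w - w) + \<i> * (N / K + K / N + 1 / (N * K)) / 12"
      proof -
        have e2: "1 / w' = N / (K * w) + \<i> / K" using w0 d0 K0 by (simp add: w'_def d_def field_simps)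
        show ?thesis unfolding W_inv e2 unfolding W_def using w0 K0 by (simp add: field_simps)
      qed
      have "of_real pi * \<i> * of_real (dedekind_sum (- int k) n) + - (of_real pi * \<i> / 4) +
          of_real pi / (12 * N) * (1 / w' - w') + of_real pi / 12 * (1 / W - W) =
          of_real pi * \<i> * of_real (dedekind_sum h k) + of_real pi / (12 * K) * (1 / w - w)"
      proof -
        have "p * \<i> * D + - (p * \<i> / 4) + p * u + p * v = p * \<i> * S + p * y"
          if "D - 1/4 + X / 12 = S" "u + v = y + \<i> * X / 12" for p D S X u v y :: complex
        proof -
          have "p * \<i> * D + - (p * \<i> / 4) + p * u + p * v = p * \<i> * (D - 1/4) + p * (u + v)"
            by (simp add: algebra_simps)
          also have "\<dots> = p * \<i> * (D - 1/4 + X / 12) + p * y"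
            unfolding that(2) by (simp add: algebra_simps)
          finally show ?thesis unfolding that(1) .
        qed
        from this[OF g1 g2, of "of_real pi"] show ?thesis by simp
      qed
      then show ?thesis unfolding exp_add[symmetric] by (rule arg_cong)
    qed
    have "A * c' * E1 * (c * E2 * P) = B * c'' * E3 * P"
      if "c * c' = e * c''" "A * e * E1 * E2 = B * E3" for A B c c' c'' e E1 E2 E3 P :: complex
    proof -
      have "A * c' * E1 * (c * E2 * P) = (c * c') * A * E1 * E2 * P" by (simp add: mult_ac)
      also have "\<dots> = (A * e * E1 * E2) * c'' * P" unfolding that(1) by (simp add: mult_ac)
      finally show ?thesis unfolding that(2) by (simp add: mult_ac)
    qed
    from this[OF f5 f6] show ?thesis
      using IH unfolding f1 f2 f3 f4 N_def[symmetric] K_def[symmetric] by simp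
  qed
qed

section \<open>Farey dissection\<close>

text \<open>Excluding the endpoints lets a mediant split the set into itself and two disjoint sets
  of the same kind. Cross-multiplication keeps the order of fractions within the natural
  numbers.\<close>

definition farey_between :: "nat \<Rightarrow> nat \<Rightarrow> nat \<Rightarrow> nat \<Rightarrow> nat \<Rightarrow> (nat \<times> nat) set" where
  "farey_between N a b c d = {(h, k). coprime h k \<and> 0 < k \<and> k \<le> N \<and> a * k < h * b \<and> h * d < c * k}"

lemma finite_farey_between: "d > 0 \<Longrightarrow> finite (farey_between N a b c d)"
proof (rule finite_subset)
  assume d: "d > 0"
  show "farey_between N a b c d \<subseteq> {..c * N} \<times> {..N}"
  proof (intro subrelI)
    fix h k assume "(h, k) \<in> farey_between N a b c d"
    then have *: "k \<le> N" "h * d < c * k" by (auto simp: farey_between_def)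
    have "h \<le> h * d" using d by simp
    also have "\<dots> \<le> c * N" using * by (meson less_imp_le order_trans mult_le_mono2)
    finally show "(h, k) \<in> {..c * N} \<times> {..N}" using * by simp
  qed
qed simp

text \<open>Since b c - a d = 1, k = b (c k - h d) + d (h b - a k), and both brackets are positive
  integers.\<close>

lemma farey_between_denominator:
  assumes "b * c = a * d + 1" "a * k < h * b" "h * d < c * k"
  shows "b + d \<le> (k::nat)"
proof -
  have "int k = int b * (int c * int k - int h * int d) + int d * (int h * int b - int a * int k)"
  proof -
    have "int b * int c = int a * int d + 1" using assms(1) by (metis of_nat_mult of_nat_add of_nat_1)
    then show ?thesis by (simp add: algebra_simps) algebra
  qed
  moreover have "int c * int k - int h * int d \<ge> 1" "int h * int b - int a * int k \<ge> 1"
    using assms(2,3) by (simp_all flip: of_nat_mult)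
  then have "int b * (int c * int k - int h * int d) \<ge> int b * 1"
    "int d * (int h * int b - int a * int k) \<ge> int d * 1" by (intro mult_left_mono; simp)+
  ultimately show ?thesis by linarith
qed

lemma coprime_of_det: "b * c = a * d + 1 \<Longrightarrow> coprime c (d::nat)" "b * c = a * d + 1 \<Longrightarrow> coprime a (b::nat)"
proof -
  show "coprime c d" if "b * c = a * d + 1"
  proof (rule coprimeI)
    fix x assume "x dvd c" "x dvd d"
    then have "x dvd a * d + 1" "x dvd a * d" using that by (metis dvd_mult)+
    then show "is_unit x" using dvd_add_right_iff by blast
  qed
  show "coprime a b" if "b * c = a * d + 1"
  proof (rule coprimeI)
    fix x assume "x dvd a" "x dvd b"
    then have "x dvd a * d + 1" "x dvd a * d" using that by (metis dvd_mult2)+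
    then show "is_unit x" using dvd_add_right_iff by blast
  qed
qed

text \<open>The determinant relation passes to both halves and makes the mediant reduced, so a
  reduced fraction equal to it in value is the same pair; all others lie strictly on one
  side.\<close>

lemma farey_between_mediant:
  assumes det: "b * c = a * d + 1" and pos: "b > 0" "d > 0" and le: "b + d \<le> N"
  shows "farey_between N a b c d = insert (a + c, b + d)
      (farey_between N a b (a + c) (b + d) \<union> farey_between N (a + c) (b + d) c d)"
    and "(a + c, b + d) \<notin> farey_between N a b (a + c) (b + d) \<union> farey_between N (a + c) (b + d) c d"
    and "farey_between N a b (a + c) (b + d) \<inter> farey_between N (a + c) (b + d) c d = {}"
proof -
  have med: "b * (a + c) = a * (b + d) + 1" "(b + d) * c = (a + c) * d + 1"
    using det by (simp_all add: algebra_simps)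
  show "farey_between N a b c d = insert (a + c, b + d)
      (farey_between N a b (a + c) (b + d) \<union> farey_between N (a + c) (b + d) c d)" (is "?L = ?R")
  proof (intro equalityI subrelI)
    fix h k assume hk: "(h, k) \<in> ?L"
    then have *: "coprime h k" "0 < k" "k \<le> N" "a * k < h * b" "h * d < c * k"
      by (auto simp: farey_between_def)
    consider "h * (b + d) < (a + c) * k" | "(a + c) * k < h * (b + d)" | "h * (b + d) = (a + c) * k" by linarith
    then show "(h, k) \<in> ?R"
    proof cases
      case 3
      have "coprime (a + c) (b + d)" using coprime_of_det(1)[OF med(1)] .
      then have "h = a + c \<and> k = b + d"
        using 3 *(1,2) pos by (metis coprime_crossproduct_nat mult.commute)
      then show ?thesis by simp
    qed (use * in \<open>auto simp: farey_between_def\<close>)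
  next
    fix h k assume "(h, k) \<in> ?R"
    then consider "h = a + c" "k = b + d" | "(h, k) \<in> farey_between N a b (a + c) (b + d)"
      | "(h, k) \<in> farey_between N (a + c) (b + d) c d" by blast
    then show "(h, k) \<in> ?L"
    proof cases
      case 1
      then show ?thesis using med pos le coprime_of_det(1)[OF med(1)]
        by (auto simp: farey_between_def algebra_simps)
    next
      case 2
      then have *: "coprime h k" "0 < k" "k \<le> N" "a * k < h * b" "h * (b + d) < (a + c) * k"
        by (auto simp: farey_between_def)
      have "h * d < c * k"
      proof -
        have "h * b + h * d < a * k + c * k" using *(5) by (simp add: algebra_simps)
        with *(4) show ?thesis by linarith
      qed
      with * show ?thesis by (simp add: farey_between_def)
    next
      case 3
      then have *: "coprime h k" "0 < k" "k \<le> N" "(a + c) * k < h * (b + d)" "h * d < c * k"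
        by (auto simp: farey_between_def)
      have "a * k < h * b"
      proof -
        have "a * k + c * k < h * b + h * d" using *(4) by (simp add: algebra_simps)
        with *(5) show ?thesis by linarith
      qed
      with * show ?thesis by (simp add: farey_between_def)
    qed
  qed
  show "(a + c, b + d) \<notin> farey_between N a b (a + c) (b + d) \<union> farey_between N (a + c) (b + d) c d"
    "farey_between N a b (a + c) (b + d) \<inter> farey_between N (a + c) (b + d) c d = {}"
    by (auto simp: farey_between_def)
qed

text \<open>An arc at h/k ends at the mediant with a Farey neighbour of denominator k', at distance
  1/(k (k + k')). The bounds encode N + 1 <= k + k' <= 2 N.\<close>

definition admissible_arc :: "nat \<Rightarrow> nat \<Rightarrow> real \<Rightarrow> bool" where
  "admissible_arc N k x \<longleftrightarrow> 1 / (2 * real k * real N) \<le> x \<and> x \<le> 1 / (real k * (real N + 1))"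

lemma admissible_arc_base:
  assumes "0 < b" "b \<le> N" "d \<le> N" "N < b + d"
  shows "admissible_arc N b (1 / (real b * (real b + real d)))"
proof -
  have *: "real b + real d \<le> 2 * real N" "real N + 1 \<le> real b + real d" "0 < real b"
    using assms by linarith+
  have "real b * (real b + real d) \<le> real b * (2 * real N)"
    "real b * (real N + 1) \<le> real b * (real b + real d)" using * by (intro mult_left_mono; simp)+
  then show ?thesis
    unfolding admissible_arc_def using * by (auto intro!: divide_left_mono mult_pos_pos simp: mult_ac)
qed

text \<open>Mediants are inserted while their denominators are at most N; otherwise the two
  fractions are neighbours and the interval is cut at their mediant. The endpoints own only half
  arcs, to be completed when adjacent intervals are joined.\<close>

theorem farey_dissection:
  fixes G :: "real \<Rightarrow> 'a :: banach"
  assumes G: "continuous_on UNIV G"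
    and "b * c = a * d + 1" "0 < b" "b \<le> N" "0 < d" "d \<le> N"
  shows "\<exists>L R l r. admissible_arc N b r \<and> admissible_arc N d l \<and>
    (\<forall>(h, k) \<in> farey_between N a b c d. admissible_arc N k (L (h, k)) \<and> admissible_arc N k (R (h, k))) \<and>
    integral {real a / real b..real c / real d} G =
      integral {real a / real b..real a / real b + r} G
      + (\<Sum>(h, k) \<in> farey_between N a b c d. integral {real h / real k - L (h, k)..real h / real k + R (h, k)} G)
      + integral {real c / real d - l..real c / real d} G"
  using assms(2-)
\<comment> \<open>The sum of the end denominators grows with each mediant and stays at most 2 N, so
  the truncated difference strictly decreases.\<close>
proof (induction "2 * N - (b + d)" arbitrary: a b c d rule: less_induct)
  case less
  have int: "G integrable_on {x..y}" for x y
    using G continuous_on_subset by (intro integrable_continuous_interval) blast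
  define m where "m = (real a + real c) / (real b + real d)"
  have bc: "real b * real c = real a * real d + 1"
    using arg_cong[OF less.prems(1), of real] by simp
  have m1: "m - real a / real b = 1 / (real b * (real b + real d))"
    using less.prems bc by (simp add: m_def field_simps)
  have m2: "real c / real d - m = 1 / (real d * (real d + real b))"
    using less.prems bc by (simp add: m_def field_simps)
  have "real a / real b \<le> m" using m1 by (smt (verit) divide_nonneg_nonneg mult_nonneg_nonneg of_nat_0_le_iff)
  moreover have "m \<le> real c / real d" using m2 by (smt (verit) divide_nonneg_nonneg mult_nonneg_nonneg of_nat_0_le_iff)
  ultimately have split: "integral {real a / real b..real c / real d} G =
      integral {real a / real b..m} G + integral {m..real c / real d} G"
    using Henstock_Kurzweil_Integration.integral_combine[OF _ _ int] by metis
  show ?case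
  proof (cases "b + d \<le> N")
    case False
    then have "farey_between N a b c d = {}"
      using farey_between_denominator[OF less.prems(1)] by (force simp: farey_between_def)
    moreover have "admissible_arc N b (m - real a / real b)" "admissible_arc N d (real c / real d - m)"
      unfolding m1 m2 using less.prems False by (intro admissible_arc_base; simp)+
    ultimately show ?thesis
      using split by (intro exI[of _ "\<lambda>_. 0"] exI[of _ "m - real a / real b"] exI[of _ "real c / real d - m"])
        (auto intro!: exI[of _ "real c / real d - m"] exI[of _ "m - real a / real b"])
  next
    case True
    have med: "b * (a + c) = a * (b + d) + 1" "(b + d) * c = (a + c) * d + 1"
      using less.prems(1) by (simp_all add: algebra_simps)
    have m: "m = real (a + c) / real (b + d)" by (simp add: m_def)
    let ?S = "farey_between N a b c d"
    let ?S1 = "farey_between N a b (a + c) (b + d)"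
    let ?S2 = "farey_between N (a + c) (b + d) c d"
    obtain L1 R1 l1 r1 where 1: "admissible_arc N b r1" "admissible_arc N (b + d) l1"
      "\<forall>(h, k) \<in> ?S1. admissible_arc N k (L1 (h, k)) \<and> admissible_arc N k (R1 (h, k))"
      "integral {real a / real b..m} G = integral {real a / real b..real a / real b + r1} G
      + (\<Sum>(h, k) \<in> ?S1. integral {real h / real k - L1 (h, k)..real h / real k + R1 (h, k)} G)
      + integral {m - l1..m} G"
      using less.hyps[OF _ med(1)] less.prems True unfolding m by force
    obtain L2 R2 l2 r2 where 2: "admissible_arc N (b + d) r2" "admissible_arc N d l2"
      "\<forall>(h, k) \<in> ?S2. admissible_arc N k (L2 (h, k)) \<and> admissible_arc N k (R2 (h, k))"
      "integral {m..real c / real d} G = integral {m..m + r2} G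
      + (\<Sum>(h, k) \<in> ?S2. integral {real h / real k - L2 (h, k)..real h / real k + R2 (h, k)} G)
      + integral {real c / real d - l2..real c / real d} G"
      using less.hyps[OF _ med(2)] less.prems True unfolding m by force
    \<comment> \<open>The mediant itself gets the default values: \<open>l1\<close> from the left
      interval and \<open>r2\<close> from the right one join to its full arc.\<close>
    define L where "L p = (if p \<in> ?S1 then L1 p else if p \<in> ?S2 then L2 p else l1)" for p
    define R where "R p = (if p \<in> ?S1 then R1 p else if p \<in> ?S2 then R2 p else r2)" for p
    note S = farey_between_mediant[OF less.prems(1,2,4) True]
    have fin: "finite ?S1" "finite ?S2" using less.prems by (auto intro: finite_farey_between)
    define I where "I L R = (\<lambda>(h, k). integral {real h / real k - L (h, k)..real h / real k + R (h, k)} G)" for L R :: "nat \<times> nat \<Rightarrow> real"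
    have "(\<Sum>p\<in>?S. I L R p) = I L R (a + c, b + d) + ((\<Sum>p\<in>?S1. I L R p) + (\<Sum>p\<in>?S2. I L R p))"
      unfolding S(1) using S(2,3) fin by (simp add: sum.union_disjoint)
    also have "(\<Sum>p\<in>?S1. I L R p) = (\<Sum>p\<in>?S1. I L1 R1 p)"
      by (intro sum.cong refl) (auto simp: I_def L_def R_def)
    also have "(\<Sum>p\<in>?S2. I L R p) = (\<Sum>p\<in>?S2. I L2 R2 p)"
    proof (intro sum.cong refl)
      fix p assume "p \<in> ?S2"
      then have "p \<notin> ?S1" using S(3) by blast
      with \<open>p \<in> ?S2\<close> show "I L R p = I L2 R2 p" by (auto simp: I_def L_def R_def split: prod.splits)
    qed
    also have "I L R (a + c, b + d) = integral {m - l1..m + r2} G"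
      using S(2) by (simp add: I_def L_def R_def m)
    also have "\<dots> = integral {m - l1..m} G + integral {m..m + r2} G"
    proof -
      have "0 \<le> x" if "admissible_arc N (b + d) x" for x
        using that unfolding admissible_arc_def by (smt (verit) divide_nonneg_nonneg mult_nonneg_nonneg of_nat_0_le_iff)
      with 1(2) 2(1) have "0 \<le> l1" "0 \<le> r2" by blast+
      then show ?thesis using Henstock_Kurzweil_Integration.integral_combine[OF _ _ int, of "m - l1" m "m + r2"] by simp
    qed
    finally have "integral {real a / real b..real c / real d} G =
      integral {real a / real b..real a / real b + r1} G + (\<Sum>p\<in>?S. I L R p)
      + integral {real c / real d - l2..real c / real d} G"
      unfolding split 1(4) 2(4) I_def by (simp add: algebra_simps)
    moreover have "\<forall>(h, k) \<in> ?S. admissible_arc N k (L (h, k)) \<and> admissible_arc N k (R (h, k))"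
      unfolding S(1) using 1 2 S(2) by (auto simp: L_def R_def)
    ultimately show ?thesis using 1(1) 2(2) unfolding I_def by blast
  qed
qed

section \<open>A Bessel integral\<close>

lemma integrable_gaussian:
  fixes b :: real
  assumes b: "b > 0"
  shows "integrable lborel (\<lambda>t. exp (- (b * t ^ 2)))"
proof -
  have "integrable lborel (\<lambda>t. sqrt (pi / b) * normal_density 0 (sqrt (1 / (2 * b))) t)"
    using b by (intro integrable_mult_right integrable_normal_density) simp
  also have "(\<lambda>t. sqrt (pi / b) * normal_density 0 (sqrt (1 / (2 * b))) t) = (\<lambda>t. exp (- (b * t ^ 2)))"
  proof -
    have sq: "sqrt (1 / (2 * b)) ^ 2 = 1 / (2 * b)" using b by (intro real_sqrt_pow2) simp
    show ?thesis unfolding normal_density_def sq using b by (intro ext) (simp add: mult_ac)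
  qed
  finally show ?thesis .
qed

text \<open>The characteristic function of the standard normal distribution, rescaled by c = sqrt(2
  b).\<close>

lemma gaussian_fourier:
  fixes b u :: real
  assumes b: "b > 0"
  shows "(LINT t|lborel. of_real (exp (- (b * t ^ 2))) * exp (\<i> * of_real (u * t))) =
    complex_of_real (sqrt (pi / b) * exp (- (u ^ 2 / (4 * b))))"
proof -
  define c where "c = sqrt (2 * b)"
  have c: "c > 0" "c ^ 2 = 2 * b" using b by (auto simp: c_def)
  have "complex_of_real (exp (- ((u / c) ^ 2) / 2)) = char std_normal_distribution (u / c)"
    by (simp add: char_std_normal_distribution)
  also have "\<dots> = (LINT x|lborel. std_normal_density x *\<^sub>R exp (\<i> * of_real (u / c * x)))"
    unfolding char_def by (subst integral_density) auto
  also have "\<dots> = \<bar>c\<bar> *\<^sub>R (LINT t|lborel. std_normal_density (0 + c * t) *\<^sub>R exp (\<i> * of_real (u / c * (0 + c * t))))"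
    using c(1) by (intro lborel_integral_real_affine) auto
  also have "\<dots> = c *\<^sub>R (LINT t|lborel. (1 / sqrt (2 * pi)) *\<^sub>R (of_real (exp (- (b * t ^ 2))) * exp (\<i> * of_real (u * t))))"
  proof -
    have eqs: "- ((0 + c * t) ^ 2) / 2 = - (b * t ^ 2)" "u / c * (0 + c * t) = u * t" for t
      using c by (simp_all add: power_mult_distrib)
    show ?thesis
      unfolding std_normal_density_def eqs using c(1) by (simp add: scaleR_conv_of_real mult.assoc)
  qed
  also have "\<dots> = (c / sqrt (2 * pi)) *\<^sub>R (LINT t|lborel. of_real (exp (- (b * t ^ 2))) * exp (\<i> * of_real (u * t)))"
    by (simp add: scaleR_conv_of_real)
  finally have "(LINT t|lborel. of_real (exp (- (b * t ^ 2))) * exp (\<i> * of_real (u * t))) =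
      (sqrt (2 * pi) / c) *\<^sub>R complex_of_real (exp (- ((u / c) ^ 2) / 2))"
    using c(1) by simp
  also have "sqrt (2 * pi) / c = sqrt (pi / b)"
    using b by (simp add: c_def real_sqrt_divide real_sqrt_mult)
  also have "- ((u / c) ^ 2) / 2 = - (u ^ 2 / (4 * b))"
    using c(2) by (simp add: power_divide)
  finally show ?thesis by (simp add: scaleR_conv_of_real)
qed

text \<open>Dominated convergence links the Lebesgue integral over the line to gauge integrals over
  [-n, n], to which the fundamental theorem of calculus applies.\<close>

lemma integral_symmetric_LIMSEQ:
  fixes f :: "real \<Rightarrow> complex"
  assumes f: "integrable lborel f"
  shows "(\<lambda>n. integral {- real n..real n} f) \<longlonglongrightarrow> (LINT t|lborel. f t)"
proof -
  have "(\<lambda>n. LINT t|lborel. indicator {- real n..real n} t *\<^sub>R f t) \<longlonglongrightarrow> (LINT t|lborel. f t)"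
  proof (rule integral_dominated_convergence)
    show "integrable lborel (\<lambda>t. norm (f t))" using f by simp
    show "AE t in lborel. (\<lambda>n. indicator {- real n..real n} t *\<^sub>R f t) \<longlonglongrightarrow> f t"
    proof (rule AE_I2)
      fix t
      obtain m :: nat where m: "\<bar>t\<bar> \<le> real m" using real_arch_simple by blast
      have "eventually (\<lambda>n. indicator {- real n..real n} t *\<^sub>R f t = f t) sequentially"
        by (rule eventually_mono[OF eventually_ge_at_top[of m]]) (use m in \<open>auto simp: indicator_def\<close>)
      then show "(\<lambda>n. indicator {- real n..real n} t *\<^sub>R f t) \<longlonglongrightarrow> f t"
        by (rule tendsto_eventually)
    qed
  qed (use f in \<open>auto simp: indicator_def\<close>)
  moreover have "(LINT t|lborel. indicator {- real n..real n} t *\<^sub>R f t) = integral {- real n..real n} f" for n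
  proof -
    have "set_integrable lborel {- real n..real n} f"
      unfolding set_integrable_def using f by (intro integrable_mult_indicator) auto
    then show ?thesis using set_borel_integral_eq_integral(2) unfolding set_lebesgue_integral_def by blast
  qed
  ultimately show ?thesis by simp
qed

section \<open>Moments along a vertical line\<close>

abbreviation vline :: "real \<Rightarrow> real \<Rightarrow> complex" where
  "vline \<sigma> t \<equiv> of_real \<sigma> + \<i> * of_real t"

lemma norm_exp_vertical:
  "norm (exp (of_real b * (vline \<sigma> t) ^ 2)) = exp (b * \<sigma> ^ 2) * exp (- (b * t ^ 2))"
proof -
  have "Re (of_real b * (vline \<sigma> t) ^ 2) = b * \<sigma> ^ 2 + - (b * t ^ 2)"
    by (simp add: Re_power2 algebra_simps)
  then show ?thesis unfolding norm_exp_eq_Re exp_add[symmetric] by simp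
qed

lemma norm_vertical_ge: "\<sigma> > 0 \<Longrightarrow> \<sigma> \<le> norm (vline \<sigma> t)"
  using complex_Re_le_cmod[of "vline \<sigma> t"] by simp

lemma vertical_nonzero: "\<sigma> > 0 \<Longrightarrow> vline \<sigma> t \<noteq> 0"
  by (simp add: complex_eq_iff)

text \<open>These integrands arise on the line Re s = \<sigma> when exp(a/s^2) is expanded in powers
  of a/s^2.\<close>

definition vertical_moment :: "real \<Rightarrow> real \<Rightarrow> nat \<Rightarrow> real \<Rightarrow> complex" where
  "vertical_moment b \<sigma> j t = inverse (vline \<sigma> t) ^ (2 * j) *
     exp (of_real b * (vline \<sigma> t) ^ 2)"

lemma norm_vertical_moment_le:
  assumes "\<sigma> > 0"
  shows "norm (vertical_moment b \<sigma> j t) \<le> inverse \<sigma> ^ (2 * j) * exp (b * \<sigma> ^ 2) * exp (- (b * t ^ 2))"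
proof -
  have "norm (inverse (vline \<sigma> t)) \<le> inverse \<sigma>"
    unfolding norm_inverse using assms norm_vertical_ge[OF assms] by (intro le_imp_inverse_le)
  then have "norm (inverse (vline \<sigma> t)) ^ (2 * j) \<le> inverse \<sigma> ^ (2 * j)"
    by (intro power_mono) auto
  then show ?thesis
    unfolding vertical_moment_def norm_mult norm_power norm_exp_vertical mult.assoc
    by (intro mult_right_mono) auto
qed

lemma continuous_vertical_moment:
  assumes "\<sigma> > 0"
  shows "continuous_on A (vertical_moment b \<sigma> j)"
  unfolding vertical_moment_def[abs_def]
  using vertical_nonzero[OF assms] by (intro continuous_intros) auto

lemma integrable_vertical_moment:
  assumes "\<sigma> > 0" "b > 0"
  shows "integrable lborel (vertical_moment b \<sigma> j)"
proof (rule Bochner_Integration.integrable_bound)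
  show "integrable lborel (\<lambda>t. inverse \<sigma> ^ (2 * j) * exp (b * \<sigma> ^ 2) * exp (- (b * t ^ 2)))"
    by (intro integrable_mult_right integrable_gaussian assms)
  show "vertical_moment b \<sigma> j \<in> borel_measurable lborel"
    using borel_measurable_continuous_onI[OF continuous_vertical_moment[OF assms(1)]] by simp
  show "AE t in lborel. norm (vertical_moment b \<sigma> j t)
      \<le> norm (inverse \<sigma> ^ (2 * j) * exp (b * \<sigma> ^ 2) * exp (- (b * t ^ 2)))"
    using norm_vertical_moment_le[OF assms(1)] assms by (intro AE_I2) (simp add: abs_mult)
qed

text \<open>The cross term 2 b \<sigma> t acts as a frequency. Its Gaussian transform contributes
  exp(-b \<sigma>^2), which cancels exp(b \<sigma>^2), so the value does not depend on the
  line.\<close>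

lemma integral_vertical_moment_0:
  assumes "b > 0"
  shows "(LINT t|lborel. vertical_moment b \<sigma> 0 t) = of_real (sqrt (pi / b))"
proof -
  have "vertical_moment b \<sigma> 0 t = of_real (exp (b * \<sigma> ^ 2)) *
      (of_real (exp (- (b * t ^ 2))) * exp (\<i> * of_real (2 * b * \<sigma> * t)))" for t
  proof -
    have "of_real b * (vline \<sigma> t) ^ 2 =
        complex_of_real (b * \<sigma> ^ 2) + (complex_of_real (- (b * t ^ 2)) + \<i> * of_real (2 * b * \<sigma> * t))"
      by (simp add: power2_eq_square algebra_simps)
    then show ?thesis unfolding vertical_moment_def by (simp only: exp_add exp_of_real) simp
  qed
  then have "(LINT t|lborel. vertical_moment b \<sigma> 0 t) =
      of_real (exp (b * \<sigma> ^ 2)) * complex_of_real (sqrt (pi / b) * exp (- ((2 * b * \<sigma>) ^ 2 / (4 * b))))"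
    using gaussian_fourier[OF assms, of "2 * b * \<sigma>"] by simp
  also have "(2 * b * \<sigma>) ^ 2 / (4 * b) = b * \<sigma> ^ 2" using assms by (simp add: power2_eq_square)
  also have "of_real (exp (b * \<sigma> ^ 2)) * complex_of_real (sqrt (pi / b) * exp (- (b * \<sigma> ^ 2))) =
      of_real (exp (b * \<sigma> ^ 2) * exp (- (b * \<sigma> ^ 2)) * sqrt (pi / b))" by simp
  also have "exp (b * \<sigma> ^ 2) * exp (- (b * \<sigma> ^ 2)) = 1" by (simp add: exp_minus)
  finally show ?thesis by simp
qed

lemma exp_minus_square_LIMSEQ:
  fixes b :: real
  assumes "b > 0"
  shows "(\<lambda>n. exp (- (b * real n ^ 2))) \<longlonglongrightarrow> 0"
proof -
  have "filterlim (\<lambda>n. b * real n ^ 2) at_top sequentially"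
    using assms by (intro filterlim_tendsto_pos_mult_at_top[OF tendsto_const] filterlim_pow_at_top filterlim_real_sequentially) auto
  then show ?thesis
    by (intro filterlim_compose[OF exp_at_bot] filterlim_compose[OF filterlim_uminus_at_bot_at_top])
qed

text \<open>Integration by parts: s^(-(2j+1)) exp(b s^2) vanishes at both ends of the line, so its
  derivative, a combination of the moments j and j + 1, integrates to 0.\<close>

lemma integral_vertical_moment_Suc:
  assumes \<sigma>: "\<sigma> > 0" and b: "b > 0"
  shows "(2 * of_nat j + 1) * (LINT t|lborel. vertical_moment b \<sigma> (Suc j) t) =
    2 * of_real b * (LINT t|lborel. vertical_moment b \<sigma> j t)"
proof -
  define s where "s t = vline \<sigma> t" for t
  have s0: "s t \<noteq> 0" for t unfolding s_def by (rule vertical_nonzero[OF \<sigma>])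
  define F where "F t = inverse (s t) ^ (2 * j + 1) * exp (of_real b * s t ^ 2)" for t
  define f where "f t = \<i> * (2 * of_real b * vertical_moment b \<sigma> j t - (2 * of_nat j + 1) * vertical_moment b \<sigma> (Suc j) t)" for t
  have deriv: "(F has_vector_derivative f t) (at t within A)" for t A
  proof -
    have "((\<lambda>z. inverse z ^ (2 * j + 1) * exp (of_real b * z ^ 2)) has_field_derivative
        2 * of_real b * (inverse (s t) ^ (2 * j) * exp (of_real b * s t ^ 2)) -
        (2 * of_nat j + 1) * (inverse (s t) ^ (2 * Suc j) * exp (of_real b * s t ^ 2))) (at (s t))"
    proof -
      have v: "(inverse has_field_derivative - (inverse (s t) ^ 2)) (at (s t))"
        using s0[of t] by (auto intro!: derivative_eq_intros simp: power2_eq_square)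
      have e: "((\<lambda>z. exp (of_real b * z ^ 2)) has_field_derivative exp (of_real b * s t ^ 2) * (of_real b * (2 * s t))) (at (s t))"
        by (auto intro!: derivative_eq_intros)
      have vs: "inverse (s t) * s t = 1" using s0[of t] by simp
      have "X * (E * (B * (2 * z))) = 2 * B * (Y * E)" if "X = Y * v" "v * z = 1" for X Y E B z v :: complex
        using that by algebra
      from this[OF _ vs, of "inverse (s t) ^ (2 * j + 1)" "inverse (s t) ^ (2 * j)" "exp (of_real b * s t ^ 2)" "of_real b"]
      have eq: "inverse (s t) ^ (2 * j + 1) * (exp (of_real b * s t ^ 2) * (of_real b * (2 * s t))) =
          2 * of_real b * (inverse (s t) ^ (2 * j) * exp (of_real b * s t ^ 2))"
        by (simp del: power_inverse)
      have "inverse (s t) ^ (2 * Suc j) = inverse (s t) ^ (2 * j) * inverse (s t) ^ 2"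
        by (simp only: power_add[symmetric]) simp
      then have 1: "of_nat (2 * j + 1) * (- (inverse (s t) ^ 2) * inverse (s t) ^ (2 * j + 1 - Suc 0)) * exp (of_real b * s t ^ 2)
          = - ((2 * of_nat j + 1) * (inverse (s t) ^ (2 * Suc j) * exp (of_real b * s t ^ 2)))"
        by (simp add: algebra_simps power2_eq_square)
      have 2: "exp (of_real b * s t ^ 2) * (of_real b * (2 * s t)) * inverse (s t) ^ (2 * j + 1) =
          2 * of_real b * (inverse (s t) ^ (2 * j) * exp (of_real b * s t ^ 2))"
        using eq by (subst mult.commute)
      show ?thesis
        by (rule DERIV_cong[OF DERIV_mult[OF DERIV_power[OF v, of "2 * j + 1"] e]])
           (unfold 1 2, simp)
    qed
    moreover have "(s has_vector_derivative \<i>) (at t within A)"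
      unfolding s_def by (auto intro!: derivative_eq_intros)
    ultimately have "((\<lambda>z. inverse z ^ (2 * j + 1) * exp (of_real b * z ^ 2)) \<circ> s has_vector_derivative
        \<i> * (2 * of_real b * (inverse (s t) ^ (2 * j) * exp (of_real b * s t ^ 2)) -
        (2 * of_nat j + 1) * (inverse (s t) ^ (2 * Suc j) * exp (of_real b * s t ^ 2)))) (at t within A)"
      by (intro field_vector_diff_chain_within) (auto intro: has_field_derivative_at_within)
    then show ?thesis unfolding F_def[abs_def] f_def vertical_moment_def s_def[symmetric] by (simp add: o_def)
  qed
  have "integral {- real n..real n} f = F (real n) - F (- real n)" for n
    using fundamental_theorem_of_calculus[of "- real n" "real n" F f] deriv by (auto intro: integral_unique)
  moreover have int_f: "integrable lborel f"
    unfolding f_def by (intro integrable_mult_right Bochner_Integration.integrable_diff integrable_vertical_moment assms)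
  ultimately have lim: "(\<lambda>n. F (real n) - F (- real n)) \<longlonglongrightarrow> (LINT t|lborel. f t)"
    using integral_symmetric_LIMSEQ[OF int_f] by simp
  have F_le: "norm (F t) \<le> inverse \<sigma> ^ (2 * j + 1) * exp (b * \<sigma> ^ 2) * exp (- (b * t ^ 2))" for t
  proof -
    have "norm (inverse (s t)) \<le> inverse \<sigma>"
      unfolding norm_inverse s_def using \<sigma> norm_vertical_ge[OF \<sigma>] by (intro le_imp_inverse_le)
    then have "norm (inverse (s t)) ^ (2 * j + 1) \<le> inverse \<sigma> ^ (2 * j + 1)"
      by (intro power_mono) auto
    moreover have "norm (exp (of_real b * s t ^ 2)) = exp (b * \<sigma> ^ 2) * exp (- (b * t ^ 2))"
      unfolding s_def by (rule norm_exp_vertical)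
    ultimately show ?thesis
      unfolding F_def norm_mult norm_power mult.assoc by (simp only:) (intro mult_right_mono; simp)
  qed
  have "(\<lambda>n. F (real n) - F (- real n)) \<longlonglongrightarrow> 0 - 0"
  proof (intro tendsto_diff)
    have *: "(\<lambda>n. inverse \<sigma> ^ (2 * j + 1) * exp (b * \<sigma> ^ 2) * exp (- (b * real n ^ 2))) \<longlonglongrightarrow> 0"
      by (intro tendsto_mult_right_zero exp_minus_square_LIMSEQ b)
    show "(\<lambda>n. F (real n)) \<longlonglongrightarrow> 0"
      by (rule Lim_null_comparison[OF _ *]) (use F_le in auto)
    show "(\<lambda>n. F (- real n)) \<longlonglongrightarrow> 0"
      by (rule Lim_null_comparison[OF _ *]) (use F_le[of "- real _"] in auto)
  qed
  with lim have "(LINT t|lborel. f t) = 0" using LIMSEQ_unique by fastforce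
  moreover have "(LINT t|lborel. f t) = \<i> * (2 * of_real b * (LINT t|lborel. vertical_moment b \<sigma> j t) -
      (2 * of_nat j + 1) * (LINT t|lborel. vertical_moment b \<sigma> (Suc j) t))"
    unfolding f_def by (simp add: integrable_vertical_moment assms)
  ultimately show ?thesis by simp
qed

lemma cosh_sums_even:
  fixes x :: real
  shows "(\<lambda>j. x ^ (2 * j) / fact (2 * j)) sums cosh x"
proof -
  have "(\<lambda>j. (\<lambda>n. if even n then x ^ n /\<^sub>R fact n else 0) (2 * j)) sums cosh x"
    by (subst sums_mono_reindex) (auto simp: strict_mono_def cosh_converges)
  then show ?thesis by (simp add: divide_inverse mult.commute)
qed

text \<open>By the recursion, a^j/j! times the j-th moment is sqrt(pi/b) (4 a b)^j/(2j)!, a term of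
  the cosh series. Since |s| >= \<sigma> on the line, a Gaussian times the series of
  exp(a/\<sigma>^2) dominates and permits termwise integration.\<close>

lemma vertical_bessel_integral:
  assumes \<sigma>: "\<sigma> > 0" and a: "a \<ge> 0" and b: "b > 0"
  defines "s \<equiv> \<lambda>t. vline \<sigma> t"
  shows "integrable lborel (\<lambda>t. exp (of_real a / s t ^ 2 + of_real b * s t ^ 2))"
    and "(LINT t|lborel. exp (of_real a / s t ^ 2 + of_real b * s t ^ 2)) =
      of_real (sqrt (pi / b) * cosh (2 * sqrt (a * b)))"
proof -
  define c where "c j = complex_of_real (a ^ j / fact j)" for j
  have terms: "(\<lambda>j. c j * vertical_moment b \<sigma> j t) sums exp (of_real a / s t ^ 2 + of_real b * s t ^ 2)" for t
  proof -
    have "(\<lambda>j. (of_real a / s t ^ 2) ^ j /\<^sub>R fact j * exp (of_real b * s t ^ 2)) sums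
        (exp (of_real a / s t ^ 2) * exp (of_real b * s t ^ 2))"
      by (intro sums_mult2 exp_converges)
    moreover have "(of_real a / s t ^ 2) ^ j /\<^sub>R fact j * exp (of_real b * s t ^ 2) = c j * vertical_moment b \<sigma> j t" for j
    proof -
      have "inverse z ^ (2 * j) = inverse (z ^ 2) ^ j" for z :: complex
        by (simp add: power_mult power_inverse)
      then show ?thesis
        unfolding vertical_moment_def s_def c_def
        by (simp add: power_mult_distrib scaleR_conv_of_real divide_inverse)
    qed
    ultimately show ?thesis by (simp add: exp_add)
  qed
  define B where "B t = exp (b * \<sigma> ^ 2) * exp (- (b * t ^ 2))" for t
  have intB: "integrable lborel B"
    unfolding B_def by (intro integrable_mult_right integrable_gaussian b)
  have norm_le: "norm (c j * vertical_moment b \<sigma> j t) \<le> (a / \<sigma> ^ 2) ^ j /\<^sub>R fact j * B t" for j t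
  proof -
    have "norm (c j * vertical_moment b \<sigma> j t) = a ^ j / fact j * norm (vertical_moment b \<sigma> j t)"
      using a by (simp add: c_def norm_mult norm_divide norm_power)
    also have "\<dots> \<le> a ^ j / fact j * (inverse \<sigma> ^ (2 * j) * exp (b * \<sigma> ^ 2) * exp (- (b * t ^ 2)))"
      using a norm_vertical_moment_le[OF \<sigma>] by (intro mult_left_mono) auto
    also have "\<dots> = (a / \<sigma> ^ 2) ^ j /\<^sub>R fact j * B t"
      by (simp add: B_def power_mult power_inverse divide_inverse power_mult_distrib)
    finally show ?thesis .
  qed
  have int: "integrable lborel (\<lambda>t. c j * vertical_moment b \<sigma> j t)" for j
    by (intro integrable_mult_right integrable_vertical_moment assms)
  have sum_exp: "summable (\<lambda>j. (a / \<sigma> ^ 2) ^ j /\<^sub>R fact j)"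
    using exp_converges sums_summable by blast
  have AE: "AE t in lborel. summable (\<lambda>j. norm (c j * vertical_moment b \<sigma> j t))"
    by (intro AE_I2 summable_comparison_test'[OF summable_mult2[OF sum_exp], of 0]) (use norm_le in auto)
  have sumint: "summable (\<lambda>j. LINT t|lborel. norm (c j * vertical_moment b \<sigma> j t))"
  proof (rule summable_comparison_test'[OF summable_mult2[OF sum_exp], of 0])
    fix j
    have "(LINT t|lborel. norm (c j * vertical_moment b \<sigma> j t)) \<le> (LINT t|lborel. (a / \<sigma> ^ 2) ^ j /\<^sub>R fact j * B t)"
      by (intro integral_mono integrable_norm int integrable_mult_right intB norm_le)
    then show "norm (LINT t|lborel. norm (c j * vertical_moment b \<sigma> j t)) \<le> (a / \<sigma> ^ 2) ^ j /\<^sub>R fact j * (LINT t|lborel. B t)"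
      by simp
  qed
  have eq: "(\<lambda>t. \<Sum>j. c j * vertical_moment b \<sigma> j t) = (\<lambda>t. exp (of_real a / s t ^ 2 + of_real b * s t ^ 2))"
    by (intro ext sums_unique[symmetric] terms)
  show "integrable lborel (\<lambda>t. exp (of_real a / s t ^ 2 + of_real b * s t ^ 2))"
    using integrable_suminf[OF int AE sumint] unfolding eq .
  have "(\<lambda>j. LINT t|lborel. c j * vertical_moment b \<sigma> j t) sums
      (LINT t|lborel. exp (of_real a / s t ^ 2 + of_real b * s t ^ 2))"
    using sums_integral[OF int AE sumint] unfolding eq .
  moreover have "(LINT t|lborel. c j * vertical_moment b \<sigma> j t) =
      of_real (sqrt (pi / b) * ((2 * sqrt (a * b)) ^ (2 * j) / fact (2 * j)))" for j
  proof (induction j)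
    case 0
    show ?case using integral_vertical_moment_0[OF b] by (simp add: c_def)
  next
    case (Suc j)
    have nz: "2 * of_nat j + 1 \<noteq> (0::complex)"
      by (metis of_nat_Suc of_nat_eq_0_iff of_nat_mult of_nat_numeral Suc_eq_plus1 add.commute nat.distinct(1))
    have "(LINT t|lborel. vertical_moment b \<sigma> (Suc j) t) =
        2 * of_real b / (2 * of_nat j + 1) * (LINT t|lborel. vertical_moment b \<sigma> j t)"
      using integral_vertical_moment_Suc[OF \<sigma> b, of j] nz by (simp add: field_simps)
    then have "(LINT t|lborel. c (Suc j) * vertical_moment b \<sigma> (Suc j) t) =
        of_real (a / (real j + 1) * (2 * b / (2 * real j + 1))) * (LINT t|lborel. c j * vertical_moment b \<sigma> j t)"
      by (simp add: c_def add.commute mult_ac)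
    also have "\<dots> = of_real (a / (real j + 1) * (2 * b / (2 * real j + 1)) *
        (sqrt (pi / b) * ((2 * sqrt (a * b)) ^ (2 * j) / fact (2 * j))))"
      unfolding Suc.IH by simp
    also have "a / (real j + 1) * (2 * b / (2 * real j + 1)) *
        (sqrt (pi / b) * ((2 * sqrt (a * b)) ^ (2 * j) / fact (2 * j))) =
        sqrt (pi / b) * ((2 * sqrt (a * b)) ^ (2 * Suc j) / fact (2 * Suc j))"
    proof -
      have 1: "(2 * sqrt (a * b)) ^ (2 * Suc j) = (4 * a * b) * (2 * sqrt (a * b)) ^ (2 * j)"
        using a b by (simp add: power_mult_distrib power2_eq_square)
      have 2: "fact (2 * Suc j) = (2 * (real j + 1)) * (2 * real j + 1) * fact (2 * j)"
        by (simp add: algebra_simps)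
      have "a / x * (2 * b / y) * (S * (P / F)) = S * ((4 * a * b) * P / (2 * x * y * F))"
        for x y S P F :: real by (simp add: mult_ac)
      then show ?thesis unfolding 1 2 .
    qed
    finally show ?case .
  qed
  moreover have "(\<lambda>j. complex_of_real (sqrt (pi / b) * ((2 * sqrt (a * b)) ^ (2 * j) / fact (2 * j)))) sums
      of_real (sqrt (pi / b) * cosh (2 * sqrt (a * b)))"
    by (intro sums_of_real sums_mult cosh_sums_even)
  ultimately show "(LINT t|lborel. exp (of_real a / s t ^ 2 + of_real b * s t ^ 2)) =
      of_real (sqrt (pi / b) * cosh (2 * sqrt (a * b)))"
    using sums_unique2 by simp
qed

section \<open>From the full vertical line to a finite arc\<close>

definition bessel_kernel :: "real \<Rightarrow> real \<Rightarrow> complex \<Rightarrow> complex" where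
  "bessel_kernel a b s = 2 * exp (of_real a / s ^ 2 + of_real b * s ^ 2)"

lemma norm_bessel_kernel:
  "norm (bessel_kernel a b s) = 2 * exp (a * Re (1 / s ^ 2) + b * Re (s ^ 2))"
proof -
  have "Re (of_real a / s ^ 2 + of_real b * s ^ 2) = a * Re (1 / s ^ 2) + b * Re (s ^ 2)"
    by (simp add: divide_inverse)
  then show ?thesis unfolding bessel_kernel_def norm_mult norm_exp_eq_Re by simp
qed

text \<open>A primitive on the convex half-plane stands in for Cauchy's theorem: every change of
  path becomes a difference of values of G.\<close>

lemma bessel_kernel_primitive:
  obtains G where "\<And>s. Re s > 0 \<Longrightarrow> (G has_field_derivative bessel_kernel a b s) (at s)"
proof -
  have op: "open {s. Re s > 0}" by (rule open_halfspace_Re_gt)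
  have "bessel_kernel a b holomorphic_on {s. Re s > 0}"
    unfolding bessel_kernel_def[abs_def] by (auto intro!: holomorphic_intros)
  then obtain G where "\<And>s. s \<in> {s. Re s > 0} \<Longrightarrow> (G has_field_derivative bessel_kernel a b s) (at s within {s. Re s > 0})"
    using holomorphic_convex_primitive'[OF convex_halfspace_Re_gt op] by blast
  then show ?thesis using that at_within_open[OF _ op] by auto
qed

lemma primitive_along_line:
  assumes G: "\<And>s. Re s > 0 \<Longrightarrow> (G has_field_derivative g s) (at s)"
    and "Re s0 > 0" "u \<le> v"
  shows "((\<lambda>t. \<i> * of_real \<epsilon> * g (s0 + \<i> * of_real (\<epsilon> * t))) has_integral
    G (s0 + \<i> * of_real (\<epsilon> * v)) - G (s0 + \<i> * of_real (\<epsilon> * u))) {u..v}"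
proof (rule fundamental_theorem_of_calculus[OF assms(3)])
  fix t
  have "((\<lambda>t. s0 + \<i> * of_real (\<epsilon> * t)) has_vector_derivative \<i> * of_real \<epsilon>) (at t within {u..v})"
    by (auto intro!: derivative_eq_intros)
  moreover have "(G has_field_derivative g (s0 + \<i> * of_real (\<epsilon> * t))) (at (s0 + \<i> * of_real (\<epsilon> * t)))"
    using assms(2) by (intro G) simp
  ultimately have "(G \<circ> (\<lambda>t. s0 + \<i> * of_real (\<epsilon> * t)) has_vector_derivative
      \<i> * of_real \<epsilon> * g (s0 + \<i> * of_real (\<epsilon> * t))) (at t within {u..v})"
    by (rule field_vector_diff_chain_within[OF _ has_field_derivative_at_within])
  then show "((\<lambda>t. G (s0 + \<i> * of_real (\<epsilon> * t))) has_vector_derivative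
      \<i> * of_real \<epsilon> * g (s0 + \<i> * of_real (\<epsilon> * t))) (at t within {u..v})"
    by (simp add: o_def)
qed

text \<open>On the vertical ray from s0 away from the real axis, Re(s^2) = c - 2 t y - t^2 while
  |Im(s^2)| >= \<theta>. Hence Re(1/s^2) <= c/\<theta>^2, and the kernel is at most a constant times
  exp(-2 b y t), which integrates to at most 1/(2 b y).\<close>

lemma ray_bound:
  assumes G: "\<And>s. Re s > 0 \<Longrightarrow> (G has_field_derivative bessel_kernel a b s) (at s)"
    and s0: "Re s0 > 0" and \<epsilon>1: "\<epsilon> = 1 \<or> \<epsilon> = (- 1 :: real)" and y: "\<epsilon> * Im s0 = y" "y > 0"
    and a: "a \<ge> 0" and b: "b > 0" and c: "Re (s0 ^ 2) = c" "c > 0" and \<theta>: "\<bar>Im (s0 ^ 2)\<bar> = \<theta>"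
    and T: "T \<ge> 0"
  shows "norm (G (s0 + \<i> * of_real (\<epsilon> * T)) - G s0) \<le> exp (b * c + a * c / \<theta> ^ 2) / (b * y)"
proof -
  have \<epsilon>: "\<epsilon> ^ 2 = 1" and abs_\<epsilon>: "\<bar>\<epsilon>\<bar> = 1" using \<epsilon>1 by auto
  define C where "C = 2 * exp (b * c + a * c / \<theta> ^ 2)"
  have \<theta>': "\<theta> = 2 * Re s0 * y"
  proof -
    have "\<bar>Im s0\<bar> = y" using y \<epsilon>1 by auto
    then show ?thesis using \<theta> s0 by (simp add: Im_power2 abs_mult)
  qed
  have \<theta>0: "\<theta> > 0" using \<theta>' s0 y by simp
  have bound: "norm (\<i> * of_real \<epsilon> * bessel_kernel a b (s0 + \<i> * of_real (\<epsilon> * t))) \<le> C * exp (- (2 * b * y * t))"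
    if t: "t \<in> {0..T}" for t
  proof -
    define u where "u = (s0 + \<i> * of_real (\<epsilon> * t)) ^ 2"
    have "\<epsilon> * t * (\<epsilon> * t) = t ^ 2" using \<epsilon>1 by (auto simp: power2_eq_square)
    then have Re_u: "Re u = c - 2 * t * y - t ^ 2"
      unfolding u_def c(1)[symmetric] y(1)[symmetric] by (simp add: Re_power2 power2_eq_square algebra_simps)
    have "Im u = 2 * Re s0 * (Im s0 + \<epsilon> * t)" unfolding u_def by (simp add: Im_power2)
    also have "Im s0 = \<epsilon> * y" using y(1) \<epsilon>1 by auto
    finally have "Im u = \<epsilon> * (2 * Re s0 * (y + t))" by (simp add: algebra_simps)
    then have "\<bar>Im u\<bar> = 2 * Re s0 * (y + t)" using s0 y t abs_\<epsilon> by (simp add: abs_mult)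
    then have Im_u: "\<theta> \<le> \<bar>Im u\<bar>" using \<theta>' s0 t by (simp add: algebra_simps)
    have "Re (1 / u) \<le> c / \<theta> ^ 2"
    proof (cases "Re u \<le> 0")
      case True
      then have "Re (1 / u) \<le> 0" by (simp add: Re_divide divide_nonpos_nonneg)
      also have "0 \<le> c / \<theta> ^ 2" using c by simp
      finally show ?thesis .
    next
      case False
      have "\<theta> ^ 2 \<le> \<bar>Im u\<bar> ^ 2" using Im_u \<theta>0 by (intro power_mono) auto
      then have le: "\<theta> ^ 2 \<le> Re u ^ 2 + Im u ^ 2" by (simp add: add_increasing)
      have "Re (1 / u) = Re u / (Re u ^ 2 + Im u ^ 2)" by (simp add: Re_divide)
      also have "\<dots> \<le> Re u / \<theta> ^ 2"
        using False \<theta>0 le by (intro divide_left_mono) (auto intro!: mult_pos_pos order.strict_trans2[OF _ le])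
      also have "\<dots> \<le> c / \<theta> ^ 2"
      proof -
        have "0 \<le> t * y" using y(2) t by simp
        then have "Re u \<le> c" using Re_u zero_le_power2[of t] by linarith
        then show ?thesis by (intro divide_right_mono) auto
      qed
      finally show ?thesis .
    qed
    then have "a * Re (1 / u) \<le> a * c / \<theta> ^ 2" using a mult_left_mono by fastforce
    moreover have "b * Re u \<le> b * (c - 2 * t * y)" using Re_u b by (intro mult_left_mono) auto
    ultimately have "a * Re (1 / u) + b * Re u \<le> (b * c + a * c / \<theta> ^ 2) + - (2 * b * y * t)"
      by (simp add: algebra_simps)
    then have "2 * exp (a * Re (1 / u) + b * Re u) \<le> C * exp (- (2 * b * y * t))"
      unfolding C_def mult.assoc exp_add[symmetric] by simp
    moreover have "norm (\<i> * of_real \<epsilon> :: complex) = 1" using abs_\<epsilon> by (simp add: norm_mult)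
    ultimately show ?thesis
      unfolding norm_mult[of "\<i> * of_real \<epsilon>"] norm_bessel_kernel u_def by simp
  qed
  have int: "((\<lambda>t. \<i> * of_real \<epsilon> * bessel_kernel a b (s0 + \<i> * of_real (\<epsilon> * t))) has_integral
    G (s0 + \<i> * of_real (\<epsilon> * T)) - G (s0 + \<i> * of_real (\<epsilon> * 0))) {0..T}"
    by (rule primitive_along_line[OF G s0 T])
  have int2: "((\<lambda>t. C * exp (- (2 * b * y * t))) has_integral
      (- C / (2 * b * y)) * exp (- (2 * b * y * T)) - (- C / (2 * b * y)) * exp (- (2 * b * y * 0))) {0..T}"
  proof (rule fundamental_theorem_of_calculus[OF T])
    fix t
    have "((\<lambda>t. (- C / (2 * b * y)) * exp (- (2 * b * y * t))) has_real_derivative C * exp (- (2 * b * y * t))) (at t within {0..T})"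
      using b y by (auto intro!: derivative_eq_intros simp: field_simps)
    then show "((\<lambda>t. (- C / (2 * b * y)) * exp (- (2 * b * y * t))) has_vector_derivative C * exp (- (2 * b * y * t))) (at t within {0..T})"
      by (simp add: has_real_derivative_iff_has_vector_derivative)
  qed
  have "norm (G (s0 + \<i> * of_real (\<epsilon> * T)) - G (s0 + \<i> * of_real (\<epsilon> * 0))) \<le>
      (- C / (2 * b * y)) * exp (- (2 * b * y * T)) - (- C / (2 * b * y)) * exp (- (2 * b * y * 0))"
    using integral_norm_bound_integral[OF has_integral_integrable[OF int] has_integral_integrable[OF int2] bound]
    unfolding integral_unique[OF int] integral_unique[OF int2] .
  also have "\<dots> \<le> C / (2 * b * y)" using b y C_def by (simp add: field_simps)
  also have "\<dots> = exp (b * c + a * c / \<theta> ^ 2) / (b * y)" by (simp add: C_def)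
  finally show ?thesis by simp
qed

text \<open>At height n the real part of s^2 is at most a constant minus n^2, so moving the abscissa
  from x to 1 costs a vanishing amount. Rays with different abscissas can thus be compared on the
  line Re s = 1.\<close>

lemma horizontal_LIMSEQ:
  assumes G: "\<And>s. Re s > 0 \<Longrightarrow> (G has_field_derivative bessel_kernel a b s) (at s)"
    and x: "x > 0" and \<epsilon>: "\<epsilon> ^ 2 = (1::real)" and a: "a \<ge> 0" and b: "b > 0"
  shows "(\<lambda>n. G (of_real x + \<i> * of_real (\<epsilon> * real n)) - G (1 + \<i> * of_real (\<epsilon> * real n))) \<longlonglongrightarrow> 0"
proof -
  define m where "m = min x 1"
  define M where "M = max x 1"
  have mM: "m > 0" "M > 0" using x by (auto simp: m_def M_def)
  define K where "K = 2 * exp (a / m ^ 2 + b * M ^ 2) * \<bar>x - 1\<bar>"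
  have le: "norm (G (of_real x + \<i> * of_real (\<epsilon> * real n)) - G (1 + \<i> * of_real (\<epsilon> * real n))) \<le> K * exp (- (b * real n ^ 2))" for n
  proof -
    define p where "p = of_real x + \<i> * complex_of_real (\<epsilon> * real n)"
    define q where "q = 1 + \<i> * complex_of_real (\<epsilon> * real n)"
    have seg: "m \<le> Re s \<and> Re s \<le> M \<and> Im s = \<epsilon> * real n" if s: "s \<in> closed_segment p q" for s
    proof -
      obtain u where u: "0 \<le> u" "u \<le> 1" "s = (1 - u) *\<^sub>R p + u *\<^sub>R q"
        using s by (auto simp: closed_segment_def)
      then have "Re s = (1 - u) * x + u * 1" "Im s = (1 - u) * (\<epsilon> * real n) + u * (\<epsilon> * real n)"
        by (simp_all add: p_def q_def)
      moreover have "(1 - u) * m + u * m \<le> (1 - u) * x + u * 1"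
        using u by (intro add_mono mult_left_mono) (auto simp: m_def)
      moreover have "(1 - u) * x + u * 1 \<le> (1 - u) * M + u * M"
        using u by (intro add_mono mult_left_mono) (auto simp: M_def)
      ultimately show ?thesis by (simp add: algebra_simps)
    qed
    have "norm (G p - G q) \<le> 2 * exp (a / m ^ 2 + b * M ^ 2 - b * real n ^ 2) * norm (p - q)"
    proof (rule field_differentiable_bound[where S = "closed_segment p q"])
      fix s assume s: "s \<in> closed_segment p q"
      then have Re_s: "m \<le> Re s" "Re s \<le> M" "Im s = \<epsilon> * real n" using seg by auto
      then show "(G has_field_derivative bessel_kernel a b s) (at s within closed_segment p q)"
        using mM by (intro has_field_derivative_at_within[OF G]) simp
      have "Re (1 / s ^ 2) \<le> norm (1 / s ^ 2)" by (rule complex_Re_le_cmod)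
      also have "\<dots> = 1 / norm s ^ 2" by (simp add: norm_divide norm_power)
      also have "\<dots> \<le> 1 / m ^ 2"
        using mM Re_s(1) complex_Re_le_cmod[of s] by (intro divide_left_mono power_mono mult_pos_pos zero_less_power) auto
      finally have 1: "a * Re (1 / s ^ 2) \<le> a / m ^ 2" using a mult_left_mono by fastforce
      have "Re (s ^ 2) = Re s ^ 2 - (\<epsilon> * real n) ^ 2" by (simp add: Re_power2 Re_s)
      also have "\<dots> \<le> M ^ 2 - real n ^ 2"
        using mM Re_s \<epsilon> by (simp add: power_mult_distrib power_mono)
      finally have "b * Re (s ^ 2) \<le> b * (M ^ 2 - real n ^ 2)" using b by (intro mult_left_mono) auto
      with 1 show "norm (bessel_kernel a b s) \<le> 2 * exp (a / m ^ 2 + b * M ^ 2 - b * real n ^ 2)"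
        unfolding norm_bessel_kernel by (simp add: algebra_simps)
    qed auto
    also have "norm (p - q) = \<bar>x - 1\<bar>"
    proof -
      have "p - q = of_real (x - 1)" by (simp add: p_def q_def)
      then show ?thesis by (simp only: norm_of_real)
    qed
    also have "2 * exp (a / m ^ 2 + b * M ^ 2 - b * real n ^ 2) * \<bar>x - 1\<bar> = K * exp (- (b * real n ^ 2))"
      by (simp add: K_def exp_diff exp_minus field_simps)
    finally show ?thesis by (simp add: p_def q_def)
  qed
  have "(\<lambda>n. K * exp (- (b * real n ^ 2))) \<longlonglongrightarrow> 0"
    by (intro tendsto_mult_right_zero exp_minus_square_LIMSEQ b)
  then show ?thesis by (rule Lim_null_comparison[OF always_eventually, rotated]) (intro allI le)
qed

text \<open>The imaginary part of the principal square root of $c + i\theta$ for $\theta > 0$.\<close>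

definition csqrt_height :: "real \<Rightarrow> real \<Rightarrow> real" where
  "csqrt_height c \<theta> = sqrt ((sqrt (c ^ 2 + \<theta> ^ 2) - c) / 2)"

definition ray_error :: "real \<Rightarrow> real \<Rightarrow> real \<Rightarrow> real \<Rightarrow> real" where
  "ray_error a b c \<theta> = exp (b * c + a * c / \<theta> ^ 2) / (b * csqrt_height c \<theta>)"

text \<open>Convergence of G is established only for the difference of its values at the two ends of
  the line. The cost of the horizontal shift is therefore kept as a null sequence h, and the limit
  is taken after both ends are combined.\<close>

lemma to_ray_end:
  assumes G: "\<And>s. Re s > 0 \<Longrightarrow> (G has_field_derivative bessel_kernel a b s) (at s)"
    and a: "a \<ge> 0" and b: "b > 0" and c: "c > 0" and \<theta>: "\<theta> > 0" and \<epsilon>: "\<epsilon> = 1 \<or> \<epsilon> = (- 1 :: real)"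
  obtains h where "h \<longlonglongrightarrow> (0::real)"
    "\<forall>\<^sub>F n in sequentially. norm (G (1 + \<i> * of_real (\<epsilon> * real n)) - G (csqrt (Complex c (\<epsilon> * \<theta>)))) \<le> ray_error a b c \<theta> + h n"
proof -
  define s where "s = csqrt (Complex c (\<epsilon> * \<theta>))"
  define y where "y = csqrt_height c \<theta>"
  have norm_z: "norm (Complex c (\<epsilon> * \<theta>)) = sqrt (c ^ 2 + \<theta> ^ 2)" using \<epsilon> by (auto simp: cmod_def)
  have "c = sqrt (c ^ 2)" using c by simp
  also have "\<dots> < sqrt (c ^ 2 + \<theta> ^ 2)" using \<theta> by (intro real_sqrt_less_mono) simp
  finally have y: "y > 0" by (simp add: y_def csqrt_height_def)
  have s2: "s ^ 2 = Complex c (\<epsilon> * \<theta>)" by (simp add: s_def)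
  have Re_s: "Re s > 0" unfolding s_def using c by (simp add: norm_z add_pos_nonneg)
  have Im_s: "\<epsilon> * Im s = y" unfolding s_def y_def csqrt_height_def using \<epsilon> \<theta> by (auto simp: norm_z)
  have \<epsilon>2: "\<epsilon> ^ 2 = 1" using \<epsilon> by auto
  define d where "d n = G (of_real (Re s) + \<i> * of_real (\<epsilon> * real n)) - G (1 + \<i> * of_real (\<epsilon> * real n))" for n
  have d: "d \<longlonglongrightarrow> 0" unfolding d_def by (rule horizontal_LIMSEQ[OF G Re_s \<epsilon>2 a b])
  have ev: "norm (G (1 + \<i> * of_real (\<epsilon> * real n)) - G s) \<le> ray_error a b c \<theta> + norm (d n)" if n: "y \<le> real n" for n
  proof -
    have "norm (G (s + \<i> * of_real (\<epsilon> * (real n - y))) - G s) \<le> ray_error a b c \<theta>"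
      unfolding ray_error_def y_def[symmetric]
      by (rule ray_bound[OF G Re_s \<epsilon> Im_s y a b _ c]) (use n \<epsilon> \<theta> s2 in auto)
    moreover have "s + \<i> * of_real (\<epsilon> * (real n - y)) = of_real (Re s) + \<i> * of_real (\<epsilon> * real n)"
    proof -
      have "Im s = \<epsilon> * y" using Im_s \<epsilon> by auto
      then show ?thesis by (simp add: complex_eq_iff algebra_simps)
    qed
    ultimately have le: "norm (G (of_real (Re s) + \<i> * of_real (\<epsilon> * real n)) - G s) \<le> ray_error a b c \<theta>" by (simp only:)
    have eq: "G (1 + \<i> * of_real (\<epsilon> * real n)) - G s =
       (G (of_real (Re s) + \<i> * of_real (\<epsilon> * real n)) - G s) - d n" by (simp add: d_def)
    show ?thesis unfolding eq by (rule order_trans[OF norm_triangle_ineq4 add_right_mono[OF le]])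
  qed
  obtain m :: nat where "y \<le> real m" using real_arch_simple by blast
  then have "\<forall>\<^sub>F n in sequentially. norm (G (1 + \<i> * of_real (\<epsilon> * real n)) - G s) \<le> ray_error a b c \<theta> + norm (d n)"
    by (intro eventually_mono[OF eventually_ge_at_top[of m]] ev) auto
  then show ?thesis using that[of "\<lambda>n. norm (d n)"] d tendsto_norm_zero unfolding s_def by blast
qed

text \<open>The minus sign reflects w = c - i \<phi>: the point exp(2 pi i (h/k + \<phi> + i c)) is
  the cusp h/k with parameter k w.\<close>

abbreviation arc_kernel :: "real \<Rightarrow> real \<Rightarrow> real \<Rightarrow> real \<Rightarrow> complex" where
  "arc_kernel a b c \<equiv> \<lambda>\<phi>. exp (of_real a / Complex c (- \<phi>) + of_real b * Complex c (- \<phi>)) / csqrt (Complex c (- \<phi>))"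

text \<open>Substituting w = s^2, the arc integral is -i (U - L) for the values U and L of a
  primitive at the roots of the upper and lower endpoint. Along the full line the same difference
  tends to i times the cosh value, so the error consists of the two rays from the endpoints to
  infinity.\<close>

theorem arc_integral_estimate:
  fixes a b c l r :: real
  assumes a: "a \<ge> 0" and b: "b > 0" and c: "c > 0" and l: "l > 0" and r: "r > 0"
  shows "norm (integral {- l..r} (arc_kernel a b c)
    - of_real (2 * sqrt (pi / b) * cosh (2 * sqrt (a * b)))) \<le> ray_error a b c l + ray_error a b c r"
proof -
  obtain G where G: "\<And>s. Re s > 0 \<Longrightarrow> (G has_field_derivative bessel_kernel a b s) (at s)"
    using bessel_kernel_primitive by blast
  define F where "F = complex_of_real (2 * sqrt (pi / b) * cosh (2 * sqrt (a * b)))"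
  define U where "U = G (csqrt (Complex c l))"
  define L where "L = G (csqrt (Complex c (- r)))"
  have Re_csqrt_pos: "Re (csqrt (Complex c t)) > 0" for t
    using c by (simp add: add_nonneg_pos)
  have "((\<lambda>\<phi>. - \<i> * arc_kernel a b c \<phi>)
      has_integral G (csqrt (Complex c (- r))) - G (csqrt (Complex c (- (- l))))) {- l..r}"
  proof (rule fundamental_theorem_of_calculus)
    fix \<phi>
    define w where "w = Complex c (- \<phi>)"
    have w: "w \<notin> \<real>\<^sub>\<le>\<^sub>0" using c by (auto simp: w_def complex_nonpos_Reals_iff)
    have "(G has_field_derivative bessel_kernel a b (csqrt w)) (at (csqrt w))"
      unfolding w_def by (intro G Re_csqrt_pos)
    then have 1: "((\<lambda>w. G (csqrt w)) has_field_derivative bessel_kernel a b (csqrt w) * inverse (2 * csqrt w)) (at w)"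
      by (rule DERIV_chain2) (rule has_field_derivative_csqrt[OF w])
    have 2: "((\<lambda>\<phi>. Complex c (- \<phi>)) has_vector_derivative - \<i>) (at \<phi> within {- l..r})"
      unfolding Complex_eq by (auto intro!: derivative_eq_intros)
    have "((\<lambda>w. G (csqrt w)) \<circ> (\<lambda>\<phi>. Complex c (- \<phi>)) has_vector_derivative
        - \<i> * (bessel_kernel a b (csqrt w) * inverse (2 * csqrt w))) (at \<phi> within {- l..r})"
      unfolding w_def
      by (rule field_vector_diff_chain_within[OF 2 has_field_derivative_at_within[OF 1[unfolded w_def]]])
    also have "bessel_kernel a b (csqrt w) * inverse (2 * csqrt w) =
        exp (of_real a / w + of_real b * w) / csqrt w"
      unfolding bessel_kernel_def by (simp add: field_simps)
    finally show "((\<lambda>\<phi>. G (csqrt (Complex c (- \<phi>)))) has_vector_derivative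
      - \<i> * arc_kernel a b c \<phi>) (at \<phi> within {- l..r})"
      unfolding w_def by (simp add: o_def)
  qed (use l r in simp)
  from has_integral_mult_right[OF this, of \<i>]
  have "integral {- l..r} (arc_kernel a b c)
      = \<i> * (L - U)"
    unfolding L_def U_def by (auto intro!: integral_unique simp flip: mult.assoc)
  then have "norm (integral {- l..r} (arc_kernel a b c) - F)
      = norm (\<i> * (L - U) - F)" by simp
  also have "\<i> * (L - U) - F = \<i> * (\<i> * F - (U - L))" by (simp add: algebra_simps)
  also have "norm \<dots> = norm (\<i> * F - (U - L))" by (simp only: norm_mult norm_ii mult_1_left)
  also have "\<dots> \<le> ray_error a b c l + ray_error a b c r"
  proof -
    obtain h1 where h1: "h1 \<longlonglongrightarrow> 0" "\<forall>\<^sub>F n in sequentially. norm (G (1 + \<i> * of_real (1 * real n)) - G (csqrt (Complex c (1 * l)))) \<le> ray_error a b c l + h1 n"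
      by (rule to_ray_end[OF G a b c l, of 1]) auto
    obtain h2 where h2: "h2 \<longlonglongrightarrow> 0" "\<forall>\<^sub>F n in sequentially. norm (G (1 + \<i> * of_real (- 1 * real n)) - G (csqrt (Complex c (- 1 * r)))) \<le> ray_error a b c r + h2 n"
      by (rule to_ray_end[OF G a b c r, of "- 1"]) auto
    define D where "D n = G (1 + \<i> * of_real (1 * real n)) - G (1 + \<i> * of_real (- 1 * real n))" for n
    have lim: "D \<longlonglongrightarrow> \<i> * F"
    proof -
      define f where "f t = \<i> * bessel_kernel a b (1 + \<i> * of_real t)" for t
      have f_eq: "f = (\<lambda>t. (2 * \<i>) * exp (of_real a / (of_real 1 + \<i> * of_real t) ^ 2 + of_real b * (of_real 1 + \<i> * of_real t) ^ 2))"
        unfolding f_def bessel_kernel_def by (simp add: mult_ac)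
      note V = vertical_bessel_integral[OF zero_less_one a b]
      have "integrable lborel f" unfolding f_eq by (intro integrable_mult_right V(1))
      moreover have "(LINT t|lborel. f t) = \<i> * F"
        unfolding f_eq F_def integral_mult_right_zero using V(2) by simp
      moreover have "integral {- real n..real n} f = D n" for n
        using integral_unique[OF primitive_along_line[OF G, of 1 "- real n" "real n" 1]]
        unfolding D_def f_def by simp
      ultimately show ?thesis using integral_symmetric_LIMSEQ[of f] by simp
    qed
    have "\<forall>\<^sub>F n in sequentially. norm (D n - (U - L)) \<le> (ray_error a b c l + h1 n) + (ray_error a b c r + h2 n)"
      using h1(2) h2(2)
    proof eventually_elim
      case (elim n)
      have "D n - (U - L) = (G (1 + \<i> * of_real (1 * real n)) - G (csqrt (Complex c (1 * l)))) -
          (G (1 + \<i> * of_real (- 1 * real n)) - G (csqrt (Complex c (- 1 * r))))"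
        by (simp add: D_def U_def L_def)
      then show ?case by (simp only:) (rule order_trans[OF norm_triangle_ineq4 add_mono[OF elim]])
    qed
    moreover have "(\<lambda>n. norm (D n - (U - L))) \<longlonglongrightarrow> norm (\<i> * F - (U - L))"
      by (intro tendsto_intros lim)
    moreover have "(\<lambda>n. (ray_error a b c l + h1 n) + (ray_error a b c r + h2 n)) \<longlonglongrightarrow> (ray_error a b c l + 0) + (ray_error a b c r + 0)"
      by (intro tendsto_intros h1 h2)
    ultimately have "norm (\<i> * F - (U - L)) \<le> (ray_error a b c l + 0) + (ray_error a b c r + 0)"
      by (intro tendsto_le[OF sequentially_bot])
    then show ?thesis by simp
  qed
  finally show ?thesis unfolding F_def .
qed

section \<open>The generating function near a root of unity\<close>

text \<open>This and \<open>cusp_power2\<close> are the two ways to square: an even denominator is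
  halved with z kept, while in general the numerator and z are doubled. The dichotomy separates even
  from odd K.\<close>

lemma cusp_power2_even: "k > 0 \<Longrightarrow> cusp h (2 * k) z ^ 2 = cusp h k z"
  unfolding cusp_def exp_double[symmetric] by (rule arg_cong[of _ _ exp]) (simp add: field_simps)

lemma cusp_power2: "cusp h k z ^ 2 = cusp (2 * h) k (2 * z)"
  unfolding cusp_def exp_double[symmetric] by (rule arg_cong[of _ _ exp]) (simp add: algebra_simps)

lemma norm_cusp_less_1: "k > 0 \<Longrightarrow> Re w > 0 \<Longrightarrow> norm (cusp h k w) < 1"
  unfolding norm_cusp by simp

lemma Re_of_real_mult: "Re (of_real r * z) = r * Re z"
  by simp

lemma Re_inverse_pos: "Re w > 0 \<Longrightarrow> Re (1 / w) > 0"
  by (auto simp: Re_divide power2_eq_square add_pos_nonneg)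

text \<open>P(q) transforms with exponent X, and P(q^2), at denominator k, with 2 X. Solving for the
  value at z leaves -3 X + 4 X = X, one factor 1/\<open>csqrt z\<close>, and the phase shown. One H
  serves both moduli because k divides 2 k.\<close>

theorem crank_gf_cusp_even:
  assumes k: "k > 0" and dvd: "int (2 * k) dvd h * H + 1" and z: "Re z > 0"
  shows "crank_gf (cusp h (2 * k) z) =
    exp (of_real pi * \<i> * of_real (2 * dedekind_sum h k - 3 * dedekind_sum h (2 * k))) / csqrt z *
    exp (of_real pi / (24 * of_nat k) * (1 / z - z)) * crank_gf (cusp H (2 * k) (1 / z))"
proof -
  define X where "X = of_real pi / (24 * of_nat k) * (1 / z - z)"
  define e1 where "e1 = exp (of_real pi * \<i> * of_real (dedekind_sum h (2 * k)))"
  define e2 where "e2 = exp (of_real pi * \<i> * of_real (dedekind_sum h k))"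
  define p1 where "p1 = euler_phi (cusp h (2 * k) z)"
  define p2 where "p2 = euler_phi (cusp h k z)"
  have z0: "csqrt z \<noteq> 0" using z by auto
  have nz: "p1 \<noteq> 0" "p2 \<noteq> 0"
    unfolding p1_def p2_def using k z by (auto intro!: euler_phi_nonzero norm_cusp_less_1)
  have "int k dvd h * H + 1" using dvd by (metis dvd_mult_right of_nat_mult)
  then have T2: "euler_phi (cusp H k (1 / z)) = e2 * csqrt z * exp (2 * X) * p2"
    using euler_phi_modular_transformation[OF k _ z, of h H] unfolding e2_def p2_def X_def by simp
  have T1: "euler_phi (cusp H (2 * k) (1 / z)) = e1 * csqrt z * exp X * p1"
    using euler_phi_modular_transformation[OF _ dvd z] k unfolding e1_def p1_def X_def by simp
  have c1: "crank_gf (cusp H (2 * k) (1 / z)) = (e1 * csqrt z * exp X * p1) ^ 3 / (e2 * csqrt z * exp (2 * X) * p2) ^ 2"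
    using crank_gf_eq_euler_phi[OF norm_cusp_less_1[OF _ Re_inverse_pos[OF z]], of "2 * k" H] k
    unfolding cusp_power2_even[OF k] T1 T2 by simp
  have c2: "crank_gf (cusp h (2 * k) z) = p1 ^ 3 / p2 ^ 2"
    using crank_gf_eq_euler_phi[OF norm_cusp_less_1[OF _ z], of "2 * k" h] k
    unfolding cusp_power2_even[OF k] p1_def p2_def by simp
  have "exp (of_real pi * \<i> * of_real (2 * dedekind_sum h k - 3 * dedekind_sum h (2 * k))) = e2 ^ 2 / e1 ^ 3"
    unfolding e1_def e2_def exp_of_nat_mult[symmetric] exp_diff[symmetric]
    by (rule arg_cong[of _ _ exp]) (simp add: algebra_simps)
  moreover have "exp (2 * X) = exp X ^ 2" by (simp add: exp_double)
  moreover have "e1 \<noteq> 0" "e2 \<noteq> 0" by (simp_all add: e1_def e2_def)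
  ultimately show ?thesis
    unfolding c1 c2 X_def[symmetric] using z0 nz
    by (simp add: field_simps power2_eq_square power3_eq_cube)
qed

section \<open>Explicit bounds for the transformed function\<close>

lemma exists_negative_inverse:
  assumes "coprime h (int k)"
  obtains H where "int k dvd h * H + 1"
proof -
  obtain x where "[h * x = 1] (mod int k)" using cong_solve_coprime_int[OF assms] by blast
  then have "int k dvd - (h * x - 1)" by (simp add: cong_iff_dvd_diff dvd_diff_commute)
  then have "int k dvd h * (- x) + 1" by simp
  then show ?thesis by (rule that)
qed

lemma exp_minus_pi_le: "exp (- pi) \<le> 1 / 20"
proof -
  \<comment> \<open>20 times 0.157 is 3.14 < pi, and the quadratic Taylor bound is raised to the
    20th power.\<close>
  have "(1 + 157/1000 + (157/1000) ^ 2 / 2) ^ 20 \<le> exp (157/1000 :: real) ^ 20"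
    by (intro power_mono exp_lower_Taylor_quadratic) auto
  also have "\<dots> = exp (314/100)" by (simp flip: exp_of_nat_mult)
  also have "\<dots> \<le> exp pi" using pi_approx by simp
  finally have "20 \<le> exp pi" by (simp add: power2_eq_square power_divide)
  then show ?thesis by (simp add: exp_minus field_simps)
qed

text \<open>Here q^2 has numerator 2 h and parameter 2 z, hence the second companion
  \<open>H2\<close>. In units of y = pi/(12 k) the exponents combine to -3 (X - R) + 2 (X/2 - 2 R) =
  -(2 X + R) < 0, so no growth remains: only 2/sqrt|z| and values of P at points near 0.\<close>

lemma norm_crank_gf_cusp_odd_le:
  assumes k: "odd k" and coprime: "coprime h (int k)" and z: "Re z > 0" and le: "real k \<le> 2 * Re (1 / z)"
  shows "norm (crank_gf (cusp h k z)) \<le> 544/100 / sqrt (norm z)"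
proof -
  have k0: "k > 0" using k by (auto intro: Nat.gr0I)
  obtain H1 where H1: "int k dvd h * H1 + 1" using exists_negative_inverse[OF coprime] .
  have "coprime (2 * h) (int k)" using coprime k by simp
  then obtain H2 where H2: "int k dvd 2 * h * H2 + 1" by (rule exists_negative_inverse)
  have z2: "Re (2 * z) > 0" using z by simp
  define X where "X = Re (1 / z)"
  define R where "R = Re z"
  have R: "R > 0" and X: "X > 0" using z Re_inverse_pos[OF z] by (auto simp: R_def X_def)
  define p1 where "p1 = norm (euler_phi (cusp H1 k (1 / z)))"
  define p2 where "p2 = norm (euler_phi (cusp H2 k (1 / (2 * z))))"
  define r1 where "r1 = norm (cusp H1 k (1 / z))"
  define r2 where "r2 = norm (cusp H2 k (1 / (2 * z)))"
  have e0: "norm (exp (of_real pi * \<i> * of_real x)) = 1" for x by (simp add: norm_exp_eq_Re)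
  have T1: "p1 = sqrt (norm z) * exp (pi / (12 * k) * (X - R)) * norm (euler_phi (cusp h k z))"
  proof -
    have "Re (of_real pi / (12 * of_nat k) * (1 / z - z)) = pi / (12 * k) * (X - R)"
    proof -
      have "of_real pi / (12 * of_nat k) * (1 / z - z) = of_real (pi / (12 * k)) * (1 / z - z)" by simp
      then show ?thesis unfolding X_def R_def by (simp only: Re_of_real_mult minus_complex.sel)
    qed
    then show ?thesis
      unfolding p1_def euler_phi_modular_transformation[OF k0 H1 z] norm_mult e0 norm_csqrt norm_exp_eq_Re[of "_ / _ * _"] by simp
  qed
  have half: "Re (1 / (2 * z)) = X / 2"
  proof -
    have "1 / (2 * z) = of_real (1 / 2) * (1 / z)" by simp
    then show ?thesis unfolding X_def by (simp only: Re_of_real_mult)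
  qed
  have T2: "p2 = sqrt (2 * norm z) * exp (pi / (12 * k) * (X / 2 - 2 * R)) * norm (euler_phi (cusp h k z ^ 2))"
  proof -
    have "Re (of_real pi / (12 * of_nat k) * (1 / (2 * z) - 2 * z)) = pi / (12 * k) * (X / 2 - 2 * R)"
    proof -
      have "of_real pi / (12 * of_nat k) * (1 / (2 * z) - 2 * z) = of_real (pi / (12 * k)) * (1 / (2 * z) - 2 * z)" by simp
      moreover have "Re (2 * z) = 2 * R" by (simp add: R_def)
      ultimately show ?thesis by (simp only: Re_of_real_mult minus_complex.sel half)
    qed
    then show ?thesis
      unfolding p2_def cusp_power2 euler_phi_modular_transformation[OF k0 H2 z2] norm_mult e0 norm_csqrt norm_exp_eq_Re[of "_ / _ * _"]
      by (simp add: norm_mult)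
  qed
  have pos: "euler_phi (cusp h k z) \<noteq> 0" "euler_phi (cusp h k z ^ 2) \<noteq> 0"
    unfolding cusp_power2 using k0 z by (auto intro!: euler_phi_nonzero norm_cusp_less_1)
  have z0: "norm z > 0" using z by auto
  define s where "s = sqrt (norm z)"
  have s: "s > 0" "norm z = s ^ 2" using z0 by (auto simp: s_def)
  define y where "y = pi / (12 * k)"
  have y: "y > 0" using k0 by (simp add: y_def)
  have p2: "p2 > 0" unfolding T2 using z0 pos by simp
  have "norm (crank_gf (cusp h k z)) = norm (euler_phi (cusp h k z)) ^ 3 / norm (euler_phi (cusp h k z ^ 2)) ^ 2"
    unfolding crank_gf_eq_euler_phi[OF norm_cusp_less_1[OF k0 z]] by (simp add: norm_divide norm_power)
  also have "norm (euler_phi (cusp h k z)) = p1 / (s * exp (y * (X - R)))"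
    unfolding T1 s_def y_def using z0 by simp
  also have "norm (euler_phi (cusp h k z ^ 2)) = p2 / (sqrt 2 * s * exp (y * (X / 2 - 2 * R)))"
    unfolding T2 s_def y_def using z0 by (simp add: real_sqrt_mult)
  also have "(p1 / (s * exp (y * (X - R)))) ^ 3 / (p2 / (sqrt 2 * s * exp (y * (X / 2 - 2 * R)))) ^ 2 =
      2 / s * (p1 ^ 3 / p2 ^ 2) * (exp (y * (X / 2 - 2 * R)) ^ 2 / exp (y * (X - R)) ^ 3)"
    using s p2 by (simp add: power_divide power_mult_distrib) (simp add: field_simps power2_eq_square power3_eq_cube)
  also have "exp (y * (X / 2 - 2 * R)) ^ 2 / exp (y * (X - R)) ^ 3 = exp (- (y * (2 * X + R)))"
    unfolding exp_of_nat_mult[symmetric] exp_diff[symmetric]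
    by (rule arg_cong[of _ _ exp]) (simp add: algebra_simps)
  also have "2 / s * (p1 ^ 3 / p2 ^ 2) * exp (- (y * (2 * X + R))) \<le> 2 / s * (p1 ^ 3 / p2 ^ 2) * 1"
    using s p2 X R y by (intro mult_left_mono) (auto simp: p1_def)
  also have "p1 ^ 3 / p2 ^ 2 \<le> 272/100"
  proof -
    \<comment> \<open>The first transformed point has modulus at most e^(-pi). For the parameter
      1/(2 z) only the square root of this is available, and 0.2237 exceeds 1/sqrt 20.\<close>
    have r1: "r1 \<le> 1/20"
    proof -
      have "r1 = exp (- (2 * pi * X / k))" unfolding r1_def norm_cusp X_def ..
      also have "\<dots> \<le> exp (- pi)" using le k0 unfolding X_def[symmetric] by (simp add: field_simps)
      also have "\<dots> \<le> 1/20" by (rule exp_minus_pi_le)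
      finally show ?thesis .
    qed
    have r2: "r2 \<le> 2237/10000"
    proof (rule power2_le_imp_le)
      have "r2 ^ 2 = exp (- (2 * pi * X / k))"
        unfolding r2_def norm_cusp half exp_of_nat_mult[symmetric] by (simp add: field_simps)
      also have "\<dots> \<le> exp (- pi)" using le k0 unfolding X_def[symmetric] by (simp add: field_simps)
      also have "\<dots> \<le> 1/20" by (rule exp_minus_pi_le)
      finally show "r2 ^ 2 \<le> (2237/10000) ^ 2" by (simp add: power2_eq_square)
    qed simp
    have "p1 \<le> exp (r1 / (1 - r1))"
      unfolding p1_def r1_def using k0 Re_inverse_pos[OF z] by (intro norm_euler_phi_le norm_cusp_less_1)
    also have "r1 / (1 - r1) \<le> (1/20) / (1 - 1/20)"
      using r1 by (intro frac_le) (auto simp: r1_def)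
    finally have "p1 \<le> exp (1 / 19)" by simp
    then have "p1 ^ 3 \<le> exp (1 / 19) ^ 3" by (intro power_mono) (auto simp: p1_def)
    moreover have "inverse p2 ^ 2 \<le> exp (38 / 100) ^ 2"
    proof (intro power_mono)
      have "inverse p2 \<le> exp (r2 / (1 - r2) ^ 2)"
        unfolding p2_def r2_def norm_inverse[symmetric] using k0 Re_inverse_pos[OF z2]
        by (intro norm_inverse_euler_phi_le norm_cusp_less_1)
      also have "r2 / (1 - r2) ^ 2 \<le> (2237/10000) / (1 - 2237/10000) ^ 2"
        using r2 by (intro frac_le power_mono) (auto simp: r2_def)
      also have "\<dots> \<le> 38 / 100" by (simp add: power2_eq_square)
      finally show "inverse p2 \<le> exp (38 / 100)" by simp
    qed (use p2 in simp)
    ultimately have "p1 ^ 3 * inverse p2 ^ 2 \<le> exp (1 / 19) ^ 3 * exp (38 / 100) ^ 2"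
      by (intro mult_mono) auto
    \<comment> \<open>The exponent is below 1, so e < 2.72 suffices; the factor 2 from (sqrt 2)^2
      then gives 5.44.\<close>
    also have "\<dots> = exp (3 / 19 + 76 / 100)"
      unfolding exp_of_nat_mult[symmetric] exp_add[symmetric] by (rule arg_cong[of _ _ exp]) simp
    also have "\<dots> \<le> exp 1" by simp
    also have "\<dots> \<le> 272/100" using e_less_272 by simp
    finally have le: "p1 ^ 3 * inverse p2 ^ 2 \<le> 272/100" .
    have "p1 ^ 3 / p2 ^ 2 = p1 ^ 3 * inverse p2 ^ 2" by (simp only: divide_inverse power_inverse)
    with le show ?thesis by (simp only:)
  qed
  then have "2 / s * (p1 ^ 3 / p2 ^ 2) * 1 \<le> 2 / s * (272/100) * 1"
    using s by (intro mult_right_mono mult_left_mono) auto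
  finally show ?thesis unfolding s_def by simp
qed

lemma holomorphic_crank_gf: "crank_gf holomorphic_on ball 0 1"
proof -
  have "(euler_phi \<circ> (\<lambda>x. x ^ 2)) holomorphic_on ball 0 1"
    by (rule holomorphic_on_compose_gen[OF _ holomorphic_euler_phi[OF order_refl]])
       (auto intro!: holomorphic_intros simp: norm_power power_less_one_iff)
  then have "(\<lambda>x. euler_phi (x ^ 2)) holomorphic_on ball 0 1" by (simp add: o_def)
  then have "(\<lambda>x. euler_phi x ^ 3 / euler_phi (x ^ 2) ^ 2) holomorphic_on ball 0 1"
    by (intro holomorphic_intros) (auto simp: norm_power power_less_one_iff intro!: euler_phi_nonzero)
  then show ?thesis
    by (rule holomorphic_transform) (simp add: crank_gf_eq_euler_phi)
qed

text \<open>Schwarz's lemma for (f(x/4) - 1)/M on the unit disc: f - 1 vanishes at 0 and is below M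
  = 4.2 on |q| < 1/4, which gives the slope 4 M = 16.8.\<close>

lemma norm_crank_gf_minus_1_le:
  assumes q: "norm q < 1/4"
  shows "norm (crank_gf q - 1) \<le> 168/10 * norm q"
proof -
  define M :: real where "M = 42/10"
  have bound: "norm (crank_gf x - 1) < M" if x: "norm x < 1/4" for x
  proof -
    have x2: "norm (x ^ 2) < 1/16"
      using x power_strict_mono[of "norm x" "1/4" 2] by (simp add: norm_power power_divide)
    have "norm (crank_gf x) = norm (euler_phi x) ^ 3 * norm (inverse (euler_phi (x ^ 2))) ^ 2"
    proof -
      have "norm x < 1" using x by simp
      then show ?thesis
        by (simp only: crank_gf_eq_euler_phi norm_divide norm_power divide_inverse norm_mult norm_inverse power_inverse)
    qed
    also have "\<dots> \<le> exp (1/3) ^ 3 * exp (16/225) ^ 2"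
    proof (intro mult_mono power_mono)
      have "norm (euler_phi x) \<le> exp (norm x / (1 - norm x))" using x by (intro norm_euler_phi_le) simp
      also have "norm x / (1 - norm x) \<le> (1/4) / (1 - 1/4)" using x by (intro frac_le) auto
      finally show "norm (euler_phi x) \<le> exp (1/3)" by simp
      have "norm (inverse (euler_phi (x ^ 2))) \<le> exp (norm (x ^ 2) / (1 - norm (x ^ 2)) ^ 2)"
        using x2 by (intro norm_inverse_euler_phi_le) simp
      also have "norm (x ^ 2) / (1 - norm (x ^ 2)) ^ 2 \<le> (1/16) / (1 - 1/16) ^ 2"
        using x2 by (intro frac_le power_mono) auto
      finally show "norm (inverse (euler_phi (x ^ 2))) \<le> exp (16/225)" by (simp add: power2_eq_square)
    qed auto
    also have "\<dots> = exp 1 * exp (32/225)"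
      unfolding exp_of_nat_mult[symmetric] by simp
    also have "\<dots> \<le> 272/100 * (1 + 32/225 + (32/225) ^ 2)"
      using e_less_272 by (intro mult_mono exp_bound) auto
    also have "\<dots> < M - 1" by (simp add: M_def power2_eq_square)
    finally show ?thesis using norm_triangle_ineq4[of "crank_gf x" 1] by simp
  qed
  note holomorphic_crank_gf
  then have hol2: "(\<lambda>x. (crank_gf (x / 4) - 1) / of_real M) holomorphic_on ball 0 1"
  proof -
    assume h: "crank_gf holomorphic_on ball 0 1"
    have "(crank_gf \<circ> (\<lambda>x. x / 4)) holomorphic_on ball 0 1"
      by (rule holomorphic_on_compose_gen[OF _ h]) (auto intro!: holomorphic_intros simp: norm_divide)
    then show ?thesis by (auto intro!: holomorphic_intros simp: o_def M_def)
  qed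
  have "norm ((crank_gf ((4 * q) / 4) - 1) / of_real M) \<le> norm (4 * q)"
  proof (rule Schwarz_Lemma(1)[OF hol2])
    have "crank_gf 0 = 1" by (simp add: crank_gf_def)
    then show "(crank_gf (0 / 4) - 1) / complex_of_real M = 0" by simp
    have M: "M > 0" "norm (complex_of_real M) = M" by (simp_all add: M_def)
    show "norm ((crank_gf (x / 4) - 1) / of_real M) < 1" if "norm x < 1" for x
      unfolding norm_divide M(2) using bound[of "x / 4"] M(1) that by simp
    show "norm (4 * q) < 1" using q by (simp add: norm_mult)
  qed
  moreover have "norm (complex_of_real M) = M" by (simp add: M_def)
  ultimately show ?thesis unfolding norm_divide by (simp add: norm_mult) (simp add: M_def)
qed

text \<open>With y = pi Re(1/z)/k the prefactor is at most e^(y/24) and f(q') - 1 at most 16.8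
  e^(-y). Since y >= pi, 23 y/24 >= 3, and e^3 > 16.8.\<close>

lemma norm_crank_gf_cusp_error_le:
  assumes k: "k > 0" and X: "real k \<le> Re (1 / z)" and z: "Re z > 0"
  shows "norm (exp (of_real pi / (24 * of_nat k) * (1 / z - z)) * (crank_gf (cusp H (2 * k) (1 / z)) - 1)) \<le> 1"
proof -
  define y where "y = pi * Re (1 / z) / k"
  have y: "y \<ge> pi" using X k by (simp add: y_def field_simps)
  have r: "norm (cusp H (2 * k) (1 / z)) = exp (- y)"
    unfolding norm_cusp y_def using k by simp
  have "exp (- y) \<le> exp (- pi)" using y by simp
  with exp_minus_pi_le have lt: "norm (cusp H (2 * k) (1 / z)) < 1/4" unfolding r by linarith
  have "Re (of_real pi / (24 * of_nat k) * (1 / z - z)) = pi / (24 * k) * (Re (1 / z) - Re z)"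
  proof -
    have "of_real pi / (24 * of_nat k) * (1 / z - z) = of_real (pi / (24 * k)) * (1 / z - z)" by simp
    then show ?thesis by (simp only: Re_of_real_mult minus_complex.sel)
  qed
  also have "\<dots> \<le> pi / (24 * k) * Re (1 / z)" using z by (intro mult_left_mono) auto
  also have "\<dots> = y / 24" by (simp add: y_def)
  finally have "norm (exp (of_real pi / (24 * of_nat k) * (1 / z - z))) \<le> exp (y / 24)"
    unfolding norm_exp_eq_Re by simp
  then have "norm (exp (of_real pi / (24 * of_nat k) * (1 / z - z)) * (crank_gf (cusp H (2 * k) (1 / z)) - 1))
      \<le> exp (y / 24) * (168/10 * exp (- y))"
    unfolding norm_mult r[symmetric] by (intro mult_mono norm_crank_gf_minus_1_le lt) auto
  also have "\<dots> = 168/10 * exp (- (23 / 24 * y))"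
    by (simp add: mult_exp_exp)
  also have "\<dots> \<le> 168/10 * exp (- 3)"
    using y pi_approx by simp
  also have "\<dots> \<le> 1"
  proof -
    have "(1 + 15/100 + (15/100) ^ 2 / 2) ^ 20 \<le> exp (15/100 :: real) ^ 20"
      by (intro power_mono exp_lower_Taylor_quadratic) auto
    also have "\<dots> = exp 3" by (simp flip: exp_of_nat_mult)
    finally have "168/10 \<le> exp (3::real)" by (simp add: power2_eq_square power_divide)
    then show ?thesis by (simp add: exp_minus field_simps)
  qed
  finally show ?thesis .
qed

section \<open>The circle method\<close>

definition circle_integrand :: "nat \<Rightarrow> real \<Rightarrow> real \<Rightarrow> complex" where
  "circle_integrand n c x =
     (let q = exp (2 * of_real pi * \<i> * Complex x c) in crank_gf q / q ^ n)"

lemma continuous_circle_integrand: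
  assumes "c > 0"
  shows "continuous_on A (circle_integrand n c)"
proof -
  have "continuous_on A (\<lambda>x. crank_gf (exp (2 * of_real pi * \<i> * Complex x c)))"
    by (rule continuous_on_compose2[OF holomorphic_on_imp_continuous_on[OF holomorphic_crank_gf]])
       (use assms in \<open>auto intro!: continuous_intros simp: Complex_eq norm_exp_eq_Re\<close>)
  then show ?thesis
    unfolding circle_integrand_def[abs_def] Let_def
    by (intro continuous_intros) (auto intro!: continuous_intros simp: Complex_eq)
qed

lemma circle_integrand_plus_1: "circle_integrand n c (x + 1) = circle_integrand n c x"
proof -
  have "2 * of_real pi * \<i> * Complex (x + 1) c = 2 * of_real pi * \<i> * Complex x c + 2 * of_real pi * \<i>"
    by (simp add: complex_eq_iff algebra_simps)
  then have "exp (2 * of_real pi * \<i> * Complex (x + 1) c) = exp (2 * of_real pi * \<i> * Complex x c)"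
    by (simp only: exp_add) simp
  then show ?thesis unfolding circle_integrand_def by simp
qed

text \<open>Cauchy's formula on the circle of radius exp(-2 pi c); the factor u in du cancels one of
  the n + 1 powers in the denominator.\<close>

lemma MeMo_eq_integral:
  assumes c: "c > 0"
  shows "MeMo n = integral {0..1} (circle_integrand n c)"
proof -
  define r where "r = exp (- (2 * pi * c))"
  have r: "0 < r" "r < 1" using c by (auto simp: r_def)
  have q: "complex_of_real r * exp (2 * of_real pi * \<i> * of_real x) = exp (2 * of_real pi * \<i> * Complex x c)" for x
    unfolding r_def exp_of_real[symmetric] exp_add[symmetric]
    by (rule arg_cong[of _ _ exp]) (simp add: complex_eq_iff)
  have "((\<lambda>u. crank_gf u / (u - 0) ^ Suc n) has_contour_integral
      (complex_of_real (2 * pi) * \<i>) / fact n * (deriv ^^ n) crank_gf 0) (circlepath 0 r)"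
  proof (rule Cauchy_has_contour_integral_higher_derivative_circlepath)
    show "continuous_on (cball 0 r) crank_gf"
      using r by (intro holomorphic_on_imp_continuous_on holomorphic_on_subset[OF holomorphic_crank_gf]) auto
    show "crank_gf holomorphic_on ball 0 r"
      using r by (intro holomorphic_on_subset[OF holomorphic_crank_gf]) auto
  qed (use r in auto)
  then have "(2 * of_real pi * \<i>) / fact n * (deriv ^^ n) crank_gf 0 =
      contour_integral (circlepath 0 r) (\<lambda>u. crank_gf u / (u - 0) ^ Suc n)"
    by (simp add: contour_integral_unique)
  also have "\<dots> = integral {0..1} (\<lambda>x. 2 * of_real pi * \<i> * circle_integrand n c x)"
    unfolding contour_integral_integral vector_derivative_circlepath
  proof (intro Henstock_Kurzweil_Integration.integral_cong)
    fix x
    define u where "u = exp (2 * of_real pi * \<i> * Complex x c)"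
    have u0: "u \<noteq> 0" by (simp add: u_def)
    have cp: "circlepath 0 r x = u" unfolding circlepath u_def q[symmetric] by simp
    have vd: "complex_of_real (2 * pi) * \<i> * of_real r * exp (2 * of_real pi * \<i> * of_real x) = 2 * of_real pi * \<i> * u"
      unfolding u_def q[symmetric] by simp
    show "crank_gf (circlepath 0 r x) / (circlepath 0 r x - 0) ^ Suc n *
        (complex_of_real (2 * pi) * \<i> * of_real r * exp (2 * of_real pi * \<i> * of_real x)) =
        2 * of_real pi * \<i> * circle_integrand n c x"
      unfolding circle_integrand_def Let_def u_def[symmetric] cp vd using u0 by simp
  qed
  also have "\<dots> = 2 * of_real pi * \<i> * integral {0..1} (circle_integrand n c)"
    by simp
  finally have "2 * of_real pi * \<i> * ((deriv ^^ n) crank_gf 0 / fact n) =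
      2 * of_real pi * \<i> * integral {0..1} (circle_integrand n c)" by simp
  then have "(deriv ^^ n) crank_gf 0 / fact n = integral {0..1} (circle_integrand n c)"
    unfolding mult_cancel_left by simp
  then show ?thesis by (simp add: MeMo_def)
qed

lemma integral_translate:
  fixes f :: "real \<Rightarrow> complex"
  assumes "continuous_on UNIV f"
  shows "integral {a + t..b + t} f = integral {a..b} (\<lambda>x. f (x + t))"
  using integral_shift[of a t b f] continuous_on_subset[OF assms] by (simp add: o_def)

definition farey_pairs :: "nat \<Rightarrow> (nat \<times> nat) set" where
  "farey_pairs N = {(h, k). coprime h k \<and> 0 < k \<and> k \<le> N \<and> h < k}"

text \<open>The dissection of [0, 1] leaves half arcs at 0 and 1. Periodicity moves the one at 1 to
  the left of 0, so 0/1 also owns a full arc.\<close>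

theorem MeMo_dissection:
  assumes c: "c > 0" and N: "N \<ge> 1"
  obtains L R where "\<And>h k. (h, k) \<in> farey_pairs N \<Longrightarrow> admissible_arc N k (L (h, k)) \<and> admissible_arc N k (R (h, k))"
    "MeMo n = (\<Sum>(h, k) \<in> farey_pairs N. integral {- L (h, k)..R (h, k)} (\<lambda>x. circle_integrand n c (real h / real k + x)))"
proof -
  define G where "G = circle_integrand n c"
  have G: "continuous_on UNIV G" unfolding G_def by (rule continuous_circle_integrand[OF c])
  obtain L R l r where lr: "admissible_arc N 1 r" "admissible_arc N 1 l"
    "\<forall>(h, k) \<in> farey_between N 0 1 1 1. admissible_arc N k (L (h, k)) \<and> admissible_arc N k (R (h, k))"
    "integral {real 0 / real 1..real 1 / real 1} G =
      integral {real 0 / real 1..real 0 / real 1 + r} G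
      + (\<Sum>(h, k) \<in> farey_between N 0 1 1 1. integral {real h / real k - L (h, k)..real h / real k + R (h, k)} G)
      + integral {real 1 / real 1 - l..real 1 / real 1} G"
    using farey_dissection[OF G, of 1 1 0 1 N] N by auto
  define L' where "L' p = (if p = (0, 1) then l else L p)" for p :: "nat \<times> nat"
  define R' where "R' p = (if p = (0, 1) then r else R p)" for p :: "nat \<times> nat"
  have pairs: "farey_pairs N = insert (0, 1) (farey_between N 0 1 1 1)"
  proof (intro equalityI subrelI)
    fix h k assume hk: "(h, k) \<in> farey_pairs N"
    then show "(h, k) \<in> insert (0, 1) (farey_between N 0 1 1 1)"
      by (cases "h = 0") (auto simp: farey_pairs_def farey_between_def)
  qed (use N in \<open>auto simp: farey_pairs_def farey_between_def\<close>)
  have notin: "(0, 1) \<notin> farey_between N 0 1 1 1" by (simp add: farey_between_def)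
  define I where "I L R = (\<lambda>(h, k). integral {- L (h, k)..R (h, k)} (\<lambda>x. G (real h / real k + x)))" for L R :: "nat \<times> nat \<Rightarrow> real"
  have lr0: "0 \<le> l" "0 \<le> r"
    using lr(1,2) unfolding admissible_arc_def by (smt (verit) divide_nonneg_nonneg mult_nonneg_nonneg of_nat_0_le_iff)+
  have "integral {1 - l..1} G = integral {- l + 1..0 + 1} G" by simp
  also have "\<dots> = integral {- l..0} (\<lambda>x. G (x + 1))" by (rule integral_translate[OF G])
  finally have wrap: "integral {1 - l..1} G = integral {- l..0} G"
    by (simp add: G_def circle_integrand_plus_1)
  have "(\<Sum>p \<in> farey_pairs N. I L' R' p) = I L' R' (0, 1) + (\<Sum>p \<in> farey_between N 0 1 1 1. I L' R' p)"
    unfolding pairs using notin by (intro sum.insert finite_farey_between) auto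
  also have "(\<Sum>p \<in> farey_between N 0 1 1 1. I L' R' p) = (\<Sum>p \<in> farey_between N 0 1 1 1. I L R p)"
    using notin by (intro sum.cong refl) (auto simp: I_def L'_def R'_def)
  also have "I L' R' (0, 1) = integral {- l..0} G + integral {0..r} G"
    using lr0 Henstock_Kurzweil_Integration.integral_combine[of "- l" 0 r G] integrable_continuous_interval[of "- l" r G]
      continuous_on_subset[OF G] by (simp add: I_def L'_def R'_def)
  also have "(\<Sum>p \<in> farey_between N 0 1 1 1. I L R p) =
      (\<Sum>(h, k) \<in> farey_between N 0 1 1 1. integral {real h / real k - L (h, k)..real h / real k + R (h, k)} G)"
  proof (intro sum.cong refl)
    fix p :: "nat \<times> nat"
    obtain h k where p: "p = (h, k)" by (cases p)
    have "integral {- L (h, k) + real h / real k..R (h, k) + real h / real k} G = I L R (h, k)"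
      unfolding I_def integral_translate[OF G] by (simp add: add.commute)
    then show "I L R p = (case p of (h, k) \<Rightarrow> integral {real h / real k - L (h, k)..real h / real k + R (h, k)} G)"
      unfolding p by (simp add: add.commute)
  qed
  finally have "MeMo n = (\<Sum>p \<in> farey_pairs N. I L' R' p)"
    unfolding MeMo_eq_integral[OF c] G_def[symmetric] using lr(4) wrap by simp
  moreover have "admissible_arc N k (L' (h, k)) \<and> admissible_arc N k (R' (h, k))" if "(h, k) \<in> farey_pairs N" for h k
    using that lr(1-3) unfolding pairs by (auto simp: L'_def R'_def)
  ultimately show ?thesis using that[of L' R'] unfolding I_def G_def by blast
qed

section \<open>Estimates on a single Farey arc\<close>

lemma circle_integrand_cusp:
  assumes k: "k > 0"
  shows "circle_integrand n c (real h / real k + x) =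
    crank_gf (cusp (int h) k (of_nat k * Complex c (- x))) *
    (exp (- 2 * of_real pi * \<i> * of_nat n * of_nat h / of_nat k) * exp (2 * of_real pi * of_nat n * Complex c (- x)))"
proof -
  have 1: "2 * of_real pi * \<i> * Complex (real h / real k + x) c =
      2 * of_real pi * \<i> * (of_int (int h) + \<i> * (of_nat k * Complex c (- x))) / of_nat k"
    using k by (simp add: Complex_eq field_simps)
  have "1 / exp (2 * of_real pi * \<i> * Complex (real h / real k + x) c) ^ n =
      exp (- 2 * of_real pi * \<i> * of_nat n * of_nat h / of_nat k + 2 * of_real pi * of_nat n * Complex c (- x))"
    unfolding exp_of_nat_mult[symmetric] using k
    by (simp add: divide_inverse exp_minus[symmetric] del: exp_minus) (rule arg_cong[of _ _ exp], simp add: Complex_eq field_simps)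
  then show ?thesis
    unfolding circle_integrand_def Let_def cusp_def 1[symmetric] exp_add[symmetric]
    by (metis times_divide_eq_right mult.right_neutral)
qed

text \<open>(c + 2\<theta>/9)^2 <= c^2 + \<theta>^2, because c <= 2\<theta> bounds the excess over
  c^2 by (8/9 + 4/81) \<theta>^2. This leaves \<theta>/9 under the root, hence the 1/3.\<close>

lemma csqrt_height_ge:
  assumes c: "c > 0" and \<theta>: "c \<le> 2 * \<theta>"
  shows "sqrt \<theta> / 3 \<le> csqrt_height c \<theta>"
proof -
  have "c * \<theta> \<le> 2 * \<theta> * \<theta>" using c \<theta> by (intro mult_right_mono) auto
  then have "(c + 2 * \<theta> / 9) ^ 2 \<le> c ^ 2 + \<theta> ^ 2"
    by (simp add: power2_eq_square algebra_simps add_divide_distrib) (use zero_le_square[of \<theta>] in linarith)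
  then have "c + 2 * \<theta> / 9 \<le> sqrt (c ^ 2 + \<theta> ^ 2)" by (rule real_le_rsqrt)
  then have "\<theta> / 9 \<le> (sqrt (c ^ 2 + \<theta> ^ 2) - c) / 2" by simp
  then have "sqrt (\<theta> / 9) \<le> csqrt_height c \<theta>" unfolding csqrt_height_def by (rule real_sqrt_le_mono)
  then show ?thesis by (simp add: real_sqrt_divide)
qed

text \<open>N is pinned from both sides: the upper bound gives N^2 c <= 1, the lower one (N+1)^2 c
  >= 1. The upper bound is strict to match the strict range of the sum over k.\<close>

locale farey_order =
  fixes n N :: nat and c :: real
  assumes n_pos: "n > 0" and N_less: "real N < 5 * sqrt (real n)" and N_ge: "5 * sqrt (real n) \<le> real N + 1"
  defines "c \<equiv> 1 / (25 * real n)"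
begin

lemma c_pos: "c > 0"
  using n_pos by (simp add: c_def)

lemma N_ge_4: "N \<ge> 4"
proof -
  have "1 \<le> sqrt (real n)" using n_pos by simp
  then show ?thesis using N_ge by linarith
qed

lemma N_square_less: "real N ^ 2 < 25 * real n"
proof -
  have "real N ^ 2 < (5 * sqrt (real n)) ^ 2" using N_less by (intro power_strict_mono) auto
  then show ?thesis by (simp add: power_mult_distrib)
qed

lemma N_square_c: "real N ^ 2 * c \<le> 1"
  using N_square_less n_pos by (simp add: c_def field_simps)

lemma inverse_square_le_c: "1 / (real N + 1) ^ 2 \<le> c"
proof -
  have "(5 * sqrt (real n)) ^ 2 \<le> (real N + 1) ^ 2" using N_ge by (intro power_mono) auto
  then have "25 * real n \<le> (real N + 1) ^ 2" by (simp add: power_mult_distrib)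
  then show ?thesis using n_pos unfolding c_def by (intro divide_left_mono) auto
qed

lemma sqrt_c: "1 / sqrt c = 5 * sqrt (real n)"
proof -
  have "sqrt (25 * real n) = 5 * sqrt (real n)" by (simp add: real_sqrt_mult)
  then show ?thesis by (simp add: c_def real_sqrt_divide)
qed

text \<open>Re(1/z) = c/(k (c^2 + x^2)). From N^2 c <= 1 follows k^2 c^2 <= c, and from |x| <= 1/(k
  (N+1)) follows k^2 x^2 <= c, so k^2 (c^2 + x^2) <= 2 c.\<close>

lemma Re_inverse_ge:
  assumes k: "0 < k" "k \<le> N" and x: "\<bar>x\<bar> \<le> 1 / (real k * (real N + 1))"
  shows "real k \<le> 2 * Re (1 / (of_nat k * Complex c (- x)))"
proof -
  have "real k ^ 2 * c ^ 2 \<le> c"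
  proof -
    have "real k ^ 2 * c \<le> real N ^ 2 * c" using k c_pos by (intro mult_right_mono power_mono) auto
    also have "\<dots> \<le> 1" by (rule N_square_c)
    finally have "real k ^ 2 * c * c \<le> 1 * c" using c_pos by (intro mult_right_mono) auto
    then show ?thesis by (simp add: power2_eq_square mult_ac)
  qed
  moreover have "real k ^ 2 * x ^ 2 \<le> c"
  proof -
    have "\<bar>x\<bar> * real k \<le> 1 / (real k * (real N + 1)) * real k"
      by (intro mult_right_mono x) auto
    also have "\<dots> = 1 / (real N + 1)" using k by simp
    finally have "(\<bar>x\<bar> * real k) ^ 2 \<le> (1 / (real N + 1)) ^ 2" by (intro power_mono) auto
    also have "\<dots> = 1 / (real N + 1) ^ 2" by (simp add: power_divide)
    also have "\<dots> \<le> c" by (rule inverse_square_le_c)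
    finally show ?thesis by (simp add: power_mult_distrib mult.commute)
  qed
  ultimately have le: "real k * (real k * (c ^ 2 + x ^ 2)) \<le> 2 * c"
    by (simp add: power2_eq_square algebra_simps)
  have pos: "0 < real k * (c ^ 2 + x ^ 2)" using k c_pos by (intro mult_pos_pos add_pos_nonneg) auto
  have "1 / (of_nat k * Complex c (- x)) = of_real (1 / real k) * (1 / Complex c (- x))" by simp
  then have "Re (1 / (of_nat k * Complex c (- x))) = 1 / real k * Re (1 / Complex c (- x))"
    by (simp only: Re_of_real_mult)
  also have "\<dots> = c / (real k * (c ^ 2 + x ^ 2))" by (simp add: Re_divide)
  finally have "2 * Re (1 / (of_nat k * Complex c (- x))) = 2 * c / (real k * (c ^ 2 + x ^ 2))" by simp
  then show ?thesis using le pos by (simp add: pos_le_divide_eq)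
qed

lemma inverse_sqrt_norm_le:
  assumes k: "0 < k"
  shows "1 / sqrt (norm (of_nat k * Complex c (- x))) \<le> 5 * sqrt (real n) / sqrt (real k)"
proof -
  have "c \<le> norm (Complex c (- x))" using complex_Re_le_cmod[of "Complex c (- x)"] by simp
  then have le: "real k * c \<le> norm (of_nat k * Complex c (- x))"
    by (simp add: norm_mult mult_left_mono)
  have pos: "0 < real k * c" using k c_pos by simp
  have "1 / sqrt (norm (of_nat k * Complex c (- x))) \<le> 1 / sqrt (real k * c)"
    by (intro divide_left_mono real_sqrt_le_mono le mult_pos_pos real_sqrt_gt_zero pos less_le_trans[OF pos le]) simp
  also have "\<dots> = 1 / sqrt c / sqrt (real k)" by (simp add: real_sqrt_mult)
  finally show ?thesis unfolding sqrt_c .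
qed

lemma admissible_arc_pos: "0 < k \<Longrightarrow> admissible_arc N k x \<Longrightarrow> 0 < x"
proof -
  assume k: "0 < k" and x: "admissible_arc N k x"
  have "0 < 1 / (2 * real k * real N)" using k N_ge_4 by simp
  then show "0 < x" using x unfolding admissible_arc_def by linarith
qed

text \<open>The arc has length at most 2/(k (N+1)) <= 2/(5 k sqrt n), which cancels the 5 sqrt n of
  the pointwise bound and makes the result independent of n.\<close>

lemma arc_integral_bound:
  assumes k: "0 < k" and L: "admissible_arc N k L" and R: "admissible_arc N k R"
    and f: "continuous_on {- L..R} f" and M: "M \<ge> 0"
    and bound: "\<And>x. x \<in> {- L..R} \<Longrightarrow> norm (f x :: complex) \<le> M * (5 * sqrt (real n) / sqrt (real k))"
  shows "norm (integral {- L..R} f) \<le> 2 * M / (real k * sqrt (real k))"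
proof -
  have LR: "0 < L" "0 < R" using admissible_arc_pos k L R by auto
  have s: "0 < sqrt (real n)" "0 < sqrt (real k)" using n_pos k by auto
  have "norm (integral {- L..R} f) \<le> M * (5 * sqrt (real n) / sqrt (real k)) * (R - (- L))"
    using LR by (intro integral_bound f bound) auto
  also have "\<dots> \<le> M * (5 * sqrt (real n) / sqrt (real k)) * (2 / (real k * (5 * sqrt (real n))))"
  proof (rule mult_left_mono)
    have "R - (- L) \<le> 2 / (real k * (real N + 1))" using L R unfolding admissible_arc_def by simp
    also have "\<dots> \<le> 2 / (real k * (5 * sqrt (real n)))"
      using N_ge k s by (intro divide_left_mono mult_left_mono mult_pos_pos) auto
    finally show "R - (- L) \<le> 2 / (real k * (5 * sqrt (real n)))" .
  qed (use M in simp)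
  also have "\<dots> = 2 * M / (real k * sqrt (real k))" using s by (simp add: field_simps)
  finally show ?thesis .
qed

lemma arc_range:
  assumes "admissible_arc N k L" "admissible_arc N k R" "x \<in> {- L..R}"
  shows "\<bar>x\<bar> \<le> 1 / (real k * (real N + 1))"
  using assms unfolding admissible_arc_def by auto

text \<open>The size of q^(-n) on the circle, constant because n c = 1/25.\<close>

lemma norm_exp_width:
  "norm (exp (- 2 * of_real pi * \<i> * of_nat n * of_nat h / of_nat k) * exp (2 * of_real pi * of_nat n * Complex c (- x))) = exp (2 * pi / 25)"
proof -
  have "Re (- 2 * of_real pi * \<i> * of_nat n * of_nat h / of_nat k) = 0"
    by (simp add: Re_divide_of_nat)
  moreover have "Re (2 * of_real pi * of_nat n * Complex c (- x)) = 2 * pi / 25"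
    using n_pos by (simp add: c_def)
  ultimately show ?thesis unfolding norm_mult norm_exp_eq_Re by simp
qed

lemma exp_width_le: "exp (2 * pi / 25) \<le> 132/100"
proof -
  have "2 * pi / 25 \<le> 2514/10000" using pi_approx by simp
  then have "exp (2 * pi / 25) \<le> exp (2514/10000)" by simp
  also have "\<dots> \<le> 1 + 2514/10000 + (2514/10000) ^ 2" by (rule exp_bound) auto
  also have "\<dots> \<le> 132/100" by (simp add: power2_eq_square)
  finally show ?thesis .
qed

lemma continuous_arc: "continuous_on A (\<lambda>x. circle_integrand n c (t + x))"
  by (rule continuous_on_compose2[OF continuous_circle_integrand[OF c_pos, of UNIV]]) (auto intro!: continuous_intros)

lemma odd_arc:
  assumes k: "odd k" "k \<le> N" and h: "coprime h k" and L: "admissible_arc N k L" and R: "admissible_arc N k R"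
  shows "norm (integral {- L..R} (\<lambda>x. circle_integrand n c (real h / real k + x))) \<le> 144/10 / (real k * sqrt (real k))"
proof -
  have k0: "k > 0" using k by (auto intro: Nat.gr0I)
  \<comment> \<open>5.44 for the function times 1.32 for q^(-n), rounded up to 7.19; twice this is
    rounded up to 14.4.\<close>
  have "norm (circle_integrand n c (real h / real k + x)) \<le> 719/100 * (5 * sqrt (real n) / sqrt (real k))"
    if x: "x \<in> {- L..R}" for x
  proof -
    define z where "z = of_nat k * Complex c (- x)"
    have z: "Re z > 0" unfolding z_def using k0 c_pos by simp
    have "norm (circle_integrand n c (real h / real k + x)) = norm (crank_gf (cusp (int h) k z)) * exp (2 * pi / 25)"
      unfolding circle_integrand_cusp[OF k0] norm_mult[of "crank_gf _"] norm_exp_width z_def ..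
    also have "\<dots> \<le> (544/100 / sqrt (norm z)) * (132/100)"
      using Re_inverse_ge[OF k0 k(2) arc_range[OF L R x]] h z k
      by (intro mult_mono exp_width_le norm_crank_gf_cusp_odd_le) (auto simp: z_def)
    also have "\<dots> = 544/100 * (132/100) * (1 / sqrt (norm z))" by simp
    also have "\<dots> \<le> 719/100 * (5 * sqrt (real n) / sqrt (real k))"
      unfolding z_def by (intro mult_mono inverse_sqrt_norm_le k0) auto
    finally show ?thesis .
  qed
  then have "norm (integral {- L..R} (\<lambda>x. circle_integrand n c (real h / real k + x))) \<le> 2 * (719/100) / (real k * sqrt (real k))"
    by (intro arc_integral_bound k0 L R continuous_arc) auto
  also have "\<dots> \<le> 144/10 / (real k * sqrt (real k))" using k0 by (intro divide_right_mono) auto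
  finally show ?thesis .
qed

text \<open>The bound \<theta> >= 1/(2 K N) with K = 2 k enters twice: it gives a c/\<theta>^2 <=
  (pi/3) N^2 c <= pi/3, and a height of at least sqrt(\<theta>)/3, whose dependence on K cancels the
  prefactor. With b >= 6 n this leaves a multiple of sqrt(N)/n.\<close>

lemma ray_error_le:
  assumes k: "0 < k" "2 * k \<le> N" and \<theta>: "admissible_arc N (2 * k) \<theta>"
  shows "1 / sqrt (2 * real k) * ray_error (pi / (48 * real k ^ 2)) (2 * pi * (real n - 1/24)) c \<theta> \<le> 268/100 * sqrt (real N) / real n"
proof -
  define K where "K = 2 * real k"
  have K: "0 < K" "K \<le> real N" "real (2 * k) = K" using k by (auto simp: K_def)
  have N: "real N > 0" using N_ge_4 by simp
  define b where "b = 2 * pi * (real n - 1/24)"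
  have n: "real n \<ge> 1" using n_pos by simp
  have \<theta>_ge: "1 / (2 * K * real N) \<le> \<theta>" using \<theta> unfolding admissible_arc_def K(3) by simp
  have \<theta>0: "0 < \<theta>" using admissible_arc_pos[OF _ \<theta>] k by simp
  \<comment> \<open>n >= 1 gives n - 1/24 >= (23/24) n, and 6.28 times 23/24 exceeds 6.\<close>
  have b_ge: "6 * real n \<le> b"
  proof -
    have "6 * real n \<le> 628/100 * (real n - 1/24)" using n by simp
    also have "\<dots> \<le> b" unfolding b_def using n pi_approx by (intro mult_right_mono) auto
    finally show ?thesis .
  qed
  then have b0: "b > 0" using n by linarith
  have \<theta>c: "c \<le> 2 * \<theta>"
  proof -
    have "2 * K * real N * c \<le> 2 * (real N ^ 2 * c)" using K N c_pos by (simp add: power2_eq_square mult_right_mono)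
    also have "\<dots> \<le> 2" using N_square_c by simp
    finally have "c \<le> 2 / (2 * K * real N)" using K N by (simp add: pos_le_divide_eq mult_ac)
    also have "\<dots> = 2 * (1 / (2 * K * real N))" by simp
    also have "\<dots> \<le> 2 * \<theta>" using \<theta>_ge by simp
    finally show ?thesis .
  qed
  have bc: "b * c \<le> 2514/10000"
  proof -
    have "b * c \<le> 2 * pi * real n * c" unfolding b_def using c_pos by (intro mult_right_mono mult_left_mono) auto
    also have "\<dots> = 2 * pi / 25" using n_pos by (simp add: c_def)
    also have "\<dots> \<le> 2514/10000" using pi_approx by simp
    finally show ?thesis .
  qed
  have ac: "pi / (48 * real k ^ 2) * c / \<theta> ^ 2 \<le> 10473/10000"
  proof -
    have "(1 / (2 * K * real N)) ^ 2 \<le> \<theta> ^ 2" using \<theta>_ge K N by (intro power_mono) auto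
    then have "pi / (48 * real k ^ 2) * c / \<theta> ^ 2 \<le> pi / (48 * real k ^ 2) * c / (1 / (2 * K * real N)) ^ 2"
      using c_pos K N \<theta>0 by (intro divide_left_mono) (auto intro!: mult_pos_pos)
    also have "\<dots> = pi / 3 * (real N ^ 2 * c)" using k by (simp add: K_def power2_eq_square field_simps)
    also have "\<dots> \<le> pi / 3 * 1" using N_square_c by (intro mult_left_mono) auto
    also have "\<dots> \<le> 10473/10000" using pi_approx by simp
    finally show ?thesis .
  qed
  have e: "exp (b * c + pi / (48 * real k ^ 2) * c / \<theta> ^ 2) \<le> 3776/1000"
  proof -
    \<comment> \<open>0.2514 + 1.0473 = 1.2987; the integer part is split off for e < 2.72 and the
      rest goes to the quadratic bound.\<close>
    have "exp (b * c + pi / (48 * real k ^ 2) * c / \<theta> ^ 2) \<le> exp (1 + 2987/10000)" using bc ac by simp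
    also have "\<dots> = exp 1 * exp (2987/10000)" by (rule exp_add)
    also have "\<dots> \<le> 272/100 * (1 + 2987/10000 + (2987/10000) ^ 2)"
      using e_less_272 by (intro mult_mono exp_bound) auto
    also have "\<dots> \<le> 3776/1000" by (simp add: power2_eq_square)
    finally show ?thesis .
  qed
  have "0 < sqrt \<theta> / 3" using \<theta>0 by simp
  then have height_pos: "0 < csqrt_height c \<theta>"
    using csqrt_height_ge[OF c_pos \<theta>c] by (rule less_le_trans)
  have height: "1 / csqrt_height c \<theta> \<le> 3 * (14143/10000 * sqrt K * sqrt (real N))"
  proof -
    have "1 / csqrt_height c \<theta> \<le> 1 / (sqrt \<theta> / 3)"
      using csqrt_height_ge[OF c_pos \<theta>c] \<theta>0 height_pos by (intro divide_left_mono mult_pos_pos) auto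
    also have "\<dots> = 3 * (1 / sqrt \<theta>)" by simp
    also have "1 / sqrt \<theta> \<le> 1 / sqrt (1 / (2 * K * real N))"
      using \<theta>_ge K N \<theta>0 by (intro divide_left_mono real_sqrt_le_mono) auto
    also have "\<dots> = sqrt 2 * sqrt K * sqrt (real N)" by (simp add: real_sqrt_divide real_sqrt_mult)
    also have "\<dots> \<le> 14143/10000 * sqrt K * sqrt (real N)"
    proof -
      have "sqrt 2 \<le> 14143/10000" by (rule real_le_lsqrt) (auto simp: power2_eq_square)
      then show ?thesis using K by (intro mult_right_mono) auto
    qed
    finally show ?thesis by simp
  qed
  have "1 / sqrt K * ray_error (pi / (48 * real k ^ 2)) b c \<theta> =
      1 / sqrt K * (exp (b * c + pi / (48 * real k ^ 2) * c / \<theta> ^ 2) * (1 / b) * (1 / csqrt_height c \<theta>))"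
    unfolding ray_error_def by simp
  also have "\<dots> \<le> 1 / sqrt K * (3776/1000 * (1 / (6 * real n)) * (3 * (14143/10000 * sqrt K * sqrt (real N))))"
  proof (intro mult_left_mono mult_mono e height)
    show "1 / b \<le> 1 / (6 * real n)" using b_ge n b0 by (intro divide_left_mono) auto
    show "0 \<le> 1 / csqrt_height c \<theta>"
      using height_pos by simp
  qed (use b0 n K in auto)
  also have "\<dots> = 3776/1000 * 3 * (14143/10000) / 6 * (sqrt (real N) / real n)" using K by simp
  also have "\<dots> \<le> 268/100 * (sqrt (real N) / real n)" by (intro mult_right_mono) auto
  finally show ?thesis unfolding K_def b_def by simp
qed

definition main_term :: "nat \<Rightarrow> nat \<Rightarrow> complex" where
  "main_term h k = exp (complex_of_real pi * \<i> * complex_of_real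
             (2 * dedekind_sum (int h) k - 3 * dedekind_sum (int h) (2 * k)))
    * exp (- 2 * complex_of_real pi * \<i> * of_nat n * of_nat h / of_nat (2 * k))
    * of_real (1 / sqrt (real n - 1/24) / sqrt (real k) * cosh (pi / real k * sqrt ((real n - 1/24) / 6)))"

text \<open>With z = 2 k w the exponents combine to pi/(24 k) (1/z - z) + 2 pi n w = a/w + b w,
  which is where n - 1/24 arises. The first error is f(q') - 1 integrated over the arc, the second
  the two truncated tails of 2.68 sqrt(N)/n each.\<close>

lemma even_arc:
  assumes k: "0 < k" "2 * k \<le> N" and h: "coprime h (2 * k)"
    and L: "admissible_arc N (2 * k) L" and R: "admissible_arc N (2 * k) R"
  shows "norm (integral {- L..R} (\<lambda>x. circle_integrand n c (real h / real (2 * k) + x)) - main_term h k)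
    \<le> 144/10 / (real (2 * k) * sqrt (real (2 * k))) + 536/100 * sqrt (real N) / real n"
proof -
  define K where "K = 2 * k"
  have K: "K > 0" "K \<le> N" using k by (auto simp: K_def)
  define a where "a = pi / (48 * real k ^ 2)"
  define b where "b = 2 * pi * (real n - 1/24)"
  have n: "real n \<ge> 1" using n_pos by simp
  have ab: "a \<ge> 0" "b > 0" using n by (auto simp: a_def b_def)
  define \<Omega> where "\<Omega> = exp (of_real pi * \<i> * of_real (2 * dedekind_sum (int h) k - 3 * dedekind_sum (int h) K))"
  define \<eta> where "\<eta> = exp (- 2 * of_real pi * \<i> * of_nat n * of_nat h / of_nat K)"
  define p where "p x = exp (of_real a / Complex c (- x) + of_real b * Complex c (- x)) / csqrt (Complex c (- x))" for x
  define C where "C = \<Omega> * \<eta> / of_real (sqrt (real K))"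
  define f where "f x = circle_integrand n c (real h / real K + x)" for x
  have \<Omega>\<eta>: "norm \<Omega> = 1" "norm \<eta> = 1"
    unfolding \<Omega>_def \<eta>_def norm_exp_eq_Re by (simp_all add: Re_divide_of_nat)
  have w0: "Complex c (- x) \<noteq> 0" for x using c_pos by (simp add: complex_eq_iff)
  have wnp: "Complex c (- x) \<notin> \<real>\<^sub>\<le>\<^sub>0" for x using c_pos by (simp add: complex_nonpos_Reals_iff)
  have contp: "continuous_on A p" for A
  proof -
    have "continuous_on A (\<lambda>x. Complex c (- x))" unfolding Complex_eq by (intro continuous_intros)
    moreover have "continuous_on A (\<lambda>x. csqrt (Complex c (- x)))"
      by (rule continuous_on_compose2[OF continuous_on_csqrt calculation]) (use wnp in auto)
    ultimately show ?thesis unfolding p_def using w0 by (intro continuous_intros) auto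
  qed
  have contf: "continuous_on A f" for A unfolding f_def by (rule continuous_arc)
  have "coprime (int h) (int K)" using h by (simp add: K_def)
  then obtain H where H: "int K dvd int h * H + 1" by (rule exists_negative_inverse)
  have diff: "norm (f x - C * p x) \<le> 719/100 * (5 * sqrt (real n) / sqrt (real K))" if x: "x \<in> {- L..R}" for x
  proof -
    define w where "w = Complex c (- x)"
    define z where "z = of_nat K * w"
    have z: "Re z > 0" unfolding z_def w_def using K c_pos by simp
    have le: "real K \<le> 2 * Re (1 / z)"
      unfolding z_def w_def by (rule Re_inverse_ge[OF K arc_range[OF L[folded K_def] R[folded K_def] x]])
    define Y where "Y = exp (of_real pi / (24 * of_nat k) * (1 / z - z))"
    define E where "E = exp (2 * of_real pi * of_nat n * w)"
    have f_eq: "f x = \<Omega> / csqrt z * Y * crank_gf (cusp H K (1 / z)) * (\<eta> * E)"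
      unfolding f_def circle_integrand_cusp[OF K(1)] z_def[symmetric] w_def[symmetric] E_def[symmetric] \<eta>_def[symmetric]
      using crank_gf_cusp_even[OF k(1) H[unfolded K_def] z] unfolding \<Omega>_def Y_def K_def by simp
    have csq: "csqrt z = of_real (sqrt (real K)) * csqrt w"
    proof -
      have "csqrt (of_nat K * w) = csqrt (of_nat K) * csqrt w"
        by (rule csqrt_mult_Re_pos) (use K c_pos in \<open>auto simp: w_def\<close>)
      moreover have "csqrt (of_nat K) = of_real (sqrt (real K))"
        using csqrt_of_real[of "real K"] by simp
      ultimately show ?thesis unfolding z_def by simp
    qed
    have "Y * E = exp (of_real a / w + of_real b * w)"
    proof -
      have "of_real pi / (24 * of_nat k) * (1 / z - z) + 2 * of_real pi * of_nat n * w =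
          of_real a / w + of_real b * w"
        using k w0[of x] unfolding z_def a_def b_def K_def w_def[symmetric]
        by (simp add: field_simps power2_eq_square)
      then show ?thesis unfolding Y_def E_def exp_add[symmetric] by simp
    qed
    then have p_eq: "C * p x = \<Omega> / csqrt z * (\<eta> * E) * Y"
      unfolding C_def p_def w_def[symmetric] csq by (simp add: mult_ac)
    have "f x - C * p x = (\<Omega> / csqrt z * (\<eta> * E)) * (Y * (crank_gf (cusp H K (1 / z)) - 1))"
      unfolding f_eq p_eq by (simp add: algebra_simps)
    then have "norm (f x - C * p x) = (1 / sqrt (norm z) * norm (\<eta> * E)) * norm (Y * (crank_gf (cusp H K (1 / z)) - 1))"
      by (simp add: norm_mult norm_divide \<Omega>\<eta>)
    also have "norm (\<eta> * E) = exp (2 * pi / 25)" unfolding \<eta>_def E_def w_def by (rule norm_exp_width)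
    also have "(1 / sqrt (norm z) * exp (2 * pi / 25)) * norm (Y * (crank_gf (cusp H K (1 / z)) - 1)) \<le>
        ((5 * sqrt (real n) / sqrt (real K)) * (132/100)) * 1"
    proof (intro mult_mono exp_width_le)
      show "1 / sqrt (norm z) \<le> 5 * sqrt (real n) / sqrt (real K)"
        unfolding z_def w_def by (rule inverse_sqrt_norm_le[OF K(1)])
      show "norm (Y * (crank_gf (cusp H K (1 / z)) - 1)) \<le> 1"
        unfolding Y_def K_def using norm_crank_gf_cusp_error_le[OF k(1) _ z] le by (simp add: K_def)
    qed auto
    \<comment> \<open>The factor 1.32 is relaxed to 7.19 so that even and odd arcs share one
      bound.\<close>
    also have "\<dots> \<le> 719/100 * (5 * sqrt (real n) / sqrt (real K))"
    proof -
      have *: "t * (132/100) * 1 \<le> 719/100 * t" if "t \<ge> 0" for t :: real using that by simp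
      show ?thesis by (rule *) simp
    qed
    finally show ?thesis .
  qed
  have int: "f integrable_on {- L..R}" "p integrable_on {- L..R}"
    by (intro integrable_continuous_interval contf contp)+
  have 1: "norm (integral {- L..R} (\<lambda>x. f x - C * p x)) \<le> 2 * (719/100) / (real K * sqrt (real K))"
    by (intro arc_integral_bound K L[folded K_def] R[folded K_def] continuous_intros contf contp diff) auto
  have LR: "L > 0" "R > 0" using admissible_arc_pos[OF _ L] admissible_arc_pos[OF _ R] k by auto
  define F where "F = complex_of_real (2 * sqrt (pi / b) * cosh (2 * sqrt (a * b)))"
  have "norm (integral {- L..R} p - F) \<le> ray_error a b c L + ray_error a b c R"
    unfolding p_def F_def by (rule arc_integral_estimate[OF ab c_pos LR])
  then have "norm C * norm (integral {- L..R} p - F) \<le> 1 / sqrt (real K) * (ray_error a b c L + ray_error a b c R)"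
    unfolding C_def norm_mult norm_divide \<Omega>\<eta> using K by (intro mult_mono) auto
  also have "\<dots> = 1 / sqrt (2 * real k) * ray_error a b c L + 1 / sqrt (2 * real k) * ray_error a b c R"
    by (simp add: K_def distrib_left add_divide_distrib)
  also have "\<dots> \<le> 268/100 * sqrt (real N) / real n + 268/100 * sqrt (real N) / real n"
    unfolding a_def b_def by (intro add_mono ray_error_le k L R)
  finally have 2: "norm (C * (integral {- L..R} p - F)) \<le> 536/100 * sqrt (real N) / real n"
    by (simp add: norm_mult)
  have main: "C * F = main_term h k"
  proof -
    define m where "m = real n - 1/24"
    have m: "m > 0" using n by (simp add: m_def)
    have "1 / sqrt (real K) * (2 * sqrt (pi / b)) = 1 / sqrt m / sqrt (real k)"
    proof -
      have "pi / b = 1 / (2 * m)" unfolding b_def m_def[symmetric] using m by simp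
      then have "2 * sqrt (pi / b) = 2 / (sqrt 2 * sqrt m)" by (simp add: real_sqrt_divide real_sqrt_mult)
      moreover have "sqrt (real K) = sqrt 2 * sqrt (real k)" by (simp add: K_def real_sqrt_mult)
      ultimately show ?thesis by (simp add: field_simps)
    qed
    moreover have "2 * sqrt (a * b) = pi / real k * sqrt (m / 6)"
    proof -
      have "a * b = (pi / (2 * real k)) ^ 2 * (m / 6)"
        unfolding a_def b_def m_def[symmetric] using k by (simp add: field_simps power2_eq_square)
      then have "sqrt (a * b) = pi / (2 * real k) * sqrt (m / 6)"
        by (simp only: real_sqrt_mult real_sqrt_abs) simp
      then show ?thesis by simp
    qed
    ultimately have "1 / sqrt (real K) * (2 * sqrt (pi / b) * cosh (2 * sqrt (a * b))) =
        1 / sqrt m / sqrt (real k) * cosh (pi / real k * sqrt (m / 6))" by (metis mult.assoc)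
    moreover have "C * F = \<Omega> * \<eta> * of_real (1 / sqrt (real K) * (2 * sqrt (pi / b) * cosh (2 * sqrt (a * b))))"
      unfolding C_def F_def by simp
    ultimately show ?thesis
      unfolding main_term_def \<Omega>_def \<eta>_def K_def m_def by simp
  qed
  have "integral {- L..R} f - main_term h k = integral {- L..R} (\<lambda>x. f x - C * p x) + C * (integral {- L..R} p - F)"
  proof -
    have "(\<lambda>x. C * p x) integrable_on {- L..R}"
      by (intro integrable_continuous_interval continuous_intros contp)
    then have "integral {- L..R} (\<lambda>x. f x - C * p x) = integral {- L..R} f - integral {- L..R} (\<lambda>x. C * p x)"
      by (rule Henstock_Kurzweil_Integration.integral_diff[OF int(1)])
    also have "integral {- L..R} (\<lambda>x. C * p x) = C * integral {- L..R} p" by simp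
    finally show ?thesis unfolding main[symmetric] by (simp add: right_diff_distrib)
  qed
  then have "norm (integral {- L..R} f - main_term h k) \<le> 2 * (719/100) / (real K * sqrt (real K)) + 536/100 * sqrt (real N) / real n"
    using norm_triangle_le[OF add_mono[OF 1 2]] by simp
  also have "2 * (719/100) / (real K * sqrt (real K)) \<le> 144/10 / (real K * sqrt (real K))"
    using K by (intro divide_right_mono) auto
  finally show ?thesis unfolding f_def K_def by simp
qed

end

section \<open>Summation over all arcs\<close>

lemma sum_farey_pairs:
  "(\<Sum>(h, k) \<in> farey_pairs N. f h k) = (\<Sum>k=1..N. \<Sum>h | h \<in> {0..<k} \<and> gcd h k = 1. f h k)"
proof -
  have "(\<Sum>k=1..N. \<Sum>h | h \<in> {0..<k} \<and> gcd h k = 1. f h k) =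
      (\<Sum>(k, h) \<in> Sigma {1..N} (\<lambda>k. {h. h \<in> {0..<k} \<and> gcd h k = 1}). f h k)"
    by (intro sum.Sigma) auto
  also have "\<dots> = (\<Sum>(h, k) \<in> farey_pairs N. f h k)"
    unfolding farey_pairs_def coprime_iff_gcd_eq_1
    by (rule sum.reindex_bij_witness[of _ prod.swap prod.swap]) auto
  finally show ?thesis ..
qed

text \<open>From 2 sqrt(N (N+1)) <= 2 N + 1 follows 1/sqrt(N+1) <= 2 (sqrt(N+1) - sqrt N), which
  telescopes.\<close>

lemma sum_inverse_sqrt_le: "(\<Sum>k=1..N. 1 / sqrt (real k)) \<le> 2 * sqrt (real N)"
proof (induction N)
  case (Suc N)
  define x where "x = sqrt (real N)"
  define y where "y = sqrt (real (Suc N))"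
  have xy: "x \<ge> 0" "y > 0" "y ^ 2 = x ^ 2 + 1" by (auto simp: x_def y_def)
  have "2 * x * y \<le> x ^ 2 + y ^ 2" using sum_squares_bound[of x y] by simp
  then have "2 * x * y + 1 \<le> 2 * y * y" using xy by (simp add: power2_eq_square)
  then have "2 * x + 1 / y \<le> 2 * y" using xy(2) by (simp add: field_simps)
  with Suc.IH show ?case unfolding x_def y_def by simp
qed simp

lemma sum_even_le: "(\<Sum>k=1..N. if even k then real k else 0) \<le> real N * (real N + 2) / 4"
proof -
  have "(\<Sum>k=1..N. if even k then real k else 0) =
      (if even N then real N * (real N + 2) / 4 else (real N - 1) * (real N + 1) / 4)"
    by (induction N) (auto simp: field_simps)
  also have "\<dots> \<le> real N * (real N + 2) / 4" by (auto simp: algebra_simps)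
  finally show ?thesis .
qed

context farey_order
begin

definition arc_error :: "nat \<Rightarrow> real" where
  "arc_error k = 144/10 / (real k * sqrt (real k)) + (if even k then 536/100 * sqrt (real N) / real n else 0)"

text \<open>The weight k bounds the number of numerators. The first error sums to at most 28.8 sqrt
  N. For the second, the even k sum to at most N (N + 2)/4 <= 3 N^2/8 < 9.375 n, and 5.36 times
  9.375 is 50.25.\<close>

lemma sum_arc_error: "(\<Sum>k=1..N. real k * arc_error k) \<le> 7905/100 * sqrt (real N)"
proof -
  have "(\<Sum>k=1..N. real k * arc_error k) =
      144/10 * (\<Sum>k=1..N. 1 / sqrt (real k)) + 536/100 * sqrt (real N) / real n * (\<Sum>k=1..N. if even k then real k else 0)"
    unfolding sum_distrib_left sum.distrib[symmetric] arc_error_def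
    by (intro sum.cong refl) (auto simp: field_simps)
  also have "\<dots> \<le> 144/10 * (2 * sqrt (real N)) + 536/100 * sqrt (real N) / real n * (375/40 * real n)"
  proof (intro add_mono mult_left_mono sum_inverse_sqrt_le)
    \<comment> \<open>N >= 4 lets the quadratic term absorb the linear one.\<close>
    have "2 * real N \<le> real N ^ 2 / 2"
      using N_ge_4 by (simp add: power2_eq_square)
    then have "real N * (real N + 2) / 4 \<le> 375/40 * real n"
      using N_square_less by (simp add: power2_eq_square algebra_simps)
    then show "(\<Sum>k=1..N. if even k then real k else 0) \<le> 375/40 * real n"
      using sum_even_le order_trans by blast
  qed auto
  also have "\<dots> = 7905/100 * sqrt (real N)" using n_pos by simp
  finally show ?thesis .
qed

lemma sum_main_term:
  "(\<Sum>h | h \<in> {0..<2 * k} \<and> gcd h (2 * k) = 1. main_term h k) =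
    complex_of_real (1 / sqrt (real n - 1/24)) * (B_sum k n / complex_of_real (sqrt (real k)) *
          complex_of_real (cosh (pi / real k * sqrt ((real n - 1/24) / 6))))"
proof -
  have *: "A * of_real (1 / a / b * d) = of_real (1 / a) * (A / of_real b * of_real d)" for A :: complex and a b d :: real
    by simp
  show ?thesis
    unfolding B_sum_def main_term_def sum_distrib_left sum_distrib_right sum_divide_distrib
    by (intro sum.cong refl) (rule *)
qed

abbreviation main_sum :: complex where
  "main_sum \<equiv> complex_of_real (1 / sqrt (real n - 1/24)) *
       (\<Sum>k\<in>{k::nat. 0 < k \<and> real k < 5 * sqrt (real n) / 2}.
          B_sum k n / complex_of_real (sqrt (real k)) *
          complex_of_real (cosh (pi / real k * sqrt ((real n - 1/24) / 6))))"

theorem MeMo_estimate: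
  "norm (MeMo n - main_sum)
     \<le> 7905/100 * sqrt (real N)"
proof -
  obtain L R where LR: "\<And>h k. (h, k) \<in> farey_pairs N \<Longrightarrow> admissible_arc N k (L (h, k)) \<and> admissible_arc N k (R (h, k))"
    "MeMo n = (\<Sum>(h, k) \<in> farey_pairs N. integral {- L (h, k)..R (h, k)} (\<lambda>x. circle_integrand n c (real h / real k + x)))"
  proof (rule MeMo_dissection[OF c_pos, of N n])
    show "1 \<le> N" using N_ge_4 by simp
  qed blast
  define T where "T h k = (if even k then main_term h (k div 2) else 0)" for h k
  have fin: "finite (farey_pairs N)"
    by (rule finite_subset[of _ "{..N} \<times> {..N}"]) (auto simp: farey_pairs_def)
  have arc: "norm (integral {- L (h, k)..R (h, k)} (\<lambda>x. circle_integrand n c (real h / real k + x)) - T h k) \<le> arc_error k"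
    if hk: "(h, k) \<in> farey_pairs N" for h k
  proof (cases "even k")
    case True
    then obtain j where j: "k = 2 * j" by blast
    have "0 < j" "2 * j \<le> N" "coprime h (2 * j)" using hk j by (auto simp: farey_pairs_def)
    then show ?thesis
      using even_arc[of j h "L (h, k)" "R (h, k)"] LR(1)[OF hk] unfolding T_def arc_error_def j by simp
  next
    case False
    then show ?thesis
      using odd_arc[of k h "L (h, k)" "R (h, k)"] LR(1)[OF hk] hk
      unfolding T_def arc_error_def by (simp add: farey_pairs_def)
  qed
  have main: "(\<Sum>(h, k) \<in> farey_pairs N. T h k) = main_sum"
  proof -
    \<comment> \<open>5 sqrt n lies in the half-open interval from N, excluded, to N + 1, included.
      Hence 2 k <= N means exactly 2 k < 5 sqrt n, even when 5 sqrt n is an integer.\<close>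
    have range: "2 * k \<le> N \<longleftrightarrow> real k < 5 * sqrt (real n) / 2" for k
    proof
      assume "2 * k \<le> N"
      then have "2 * real k \<le> real N" by linarith
      then show "real k < 5 * sqrt (real n) / 2" using N_less by linarith
    next
      assume "real k < 5 * sqrt (real n) / 2"
      then have "2 * real k < real N + 1" using N_ge by linarith
      then show "2 * k \<le> N" by linarith
    qed
    have "(\<Sum>(h, k) \<in> farey_pairs N. T h k) = (\<Sum>k=1..N. \<Sum>h | h \<in> {0..<k} \<and> gcd h k = 1. T h k)"
      by (rule sum_farey_pairs)
    also have "\<dots> = (\<Sum>k\<in>{k \<in> {1..N}. even k}. \<Sum>h | h \<in> {0..<k} \<and> gcd h k = 1. T h k)"
      by (intro sum.mono_neutral_right) (auto simp: T_def)
    also have "\<dots> = (\<Sum>k\<in>{k::nat. 0 < k \<and> real k < 5 * sqrt (real n) / 2}.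
        \<Sum>h | h \<in> {0..<2 * k} \<and> gcd h (2 * k) = 1. main_term h k)"
      unfolding range[symmetric]
      by (rule sum.reindex_bij_witness[of _ "\<lambda>k. 2 * k" "\<lambda>k. k div 2"]) (auto simp: T_def)
    also have "\<dots> = main_sum" unfolding sum_main_term sum_distrib_left ..
    finally show ?thesis .
  qed
  have "norm (MeMo n - main_sum) = norm (\<Sum>(h, k) \<in> farey_pairs N.
      integral {- L (h, k)..R (h, k)} (\<lambda>x. circle_integrand n c (real h / real k + x)) - T h k)"
    unfolding main[symmetric] LR(2) by (simp add: sum_subtractf case_prod_unfold)
  also have "\<dots> \<le> (\<Sum>(h, k) \<in> farey_pairs N. arc_error k)"
    by (rule sum_norm_le) (use arc in auto)
  also have "\<dots> = (\<Sum>k=1..N. real (card {h. h \<in> {0..<k} \<and> gcd h k = 1}) * arc_error k)"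
    unfolding sum_farey_pairs by simp
  also have "\<dots> \<le> (\<Sum>k=1..N. real k * arc_error k)"
  proof (intro sum_mono mult_right_mono)
    fix k
    show "real (card {h. h \<in> {0..<k} \<and> gcd h k = 1}) \<le> real k"
    proof -
      have "card {h. h \<in> {0..<k} \<and> gcd h k = 1} \<le> card {0..<k}" by (rule card_mono) auto
      then show ?thesis by simp
    qed
    show "0 \<le> arc_error k" by (simp add: arc_error_def)
  qed
  also have "\<dots> \<le> 7905/100 * sqrt (real N)" by (rule sum_arc_error)
  finally show ?thesis .
qed

end

theorem theorem1p5:
  fixes n :: nat
  assumes "n > 0"
  shows "norm (MeMo n -
     complex_of_real (1 / sqrt (real n - 1/24)) *
       (\<Sum>k\<in>{k::nat. 0 < k \<and> real k < 5 * sqrt (real n) / 2}.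
          B_sum k n / complex_of_real (sqrt (real k)) *
          complex_of_real (cosh (pi / real k * sqrt ((real n - 1/24) / 6)))))
     < 194 * real n powr (1/4)"
proof -
  \<comment> \<open>The largest integer strictly below 5 sqrt n; the floor would equal 5 sqrt n when
    n is a square.\<close>
  define N where "N = nat (\<lceil>5 * sqrt (real n)\<rceil> - 1)"
  have pos: "5 * sqrt (real n) > 0" using assms by simp
  then have "real N = of_int \<lceil>5 * sqrt (real n)\<rceil> - 1"
    unfolding N_def by (simp add: of_nat_nat)
  then have N: "real N < 5 * sqrt (real n)" "5 * sqrt (real n) \<le> real N + 1" by linarith+
  interpret farey_order n N "1 / (25 * real n)"
    by unfold_locales (use assms N in auto)
  note MeMo_estimate
  \<comment> \<open>79.05 times 2.237 is less than 177, well below 194.\<close>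
  also have "7905/100 * sqrt (real N) < 194 * real n powr (1/4)"
  proof -
    have root: "real n powr (1/4) = sqrt (sqrt (real n))"
      by (simp add: powr_half_sqrt[symmetric] powr_powr)
    have "sqrt (real N) \<le> sqrt (5 * sqrt (real n))" using N(1) by simp
    also have "\<dots> = sqrt 5 * sqrt (sqrt (real n))" by (simp add: real_sqrt_mult)
    also have "\<dots> \<le> 2237/1000 * sqrt (sqrt (real n))"
      by (intro mult_right_mono real_le_lsqrt) (auto simp: power2_eq_square)
    finally have "7905/100 * sqrt (real N) \<le> 7905/100 * (2237/1000) * sqrt (sqrt (real n))" by simp
    also have "\<dots> < 194 * sqrt (sqrt (real n))" using assms by (intro mult_strict_right_mono) auto
    finally show ?thesis unfolding root .
  qed
  finally show ?thesis .
qed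

end
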